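(* Assume that the supports of all the random variables $e_j^{(n)}$ are contained in a compact set in $\mathbb R$, and that the following conditions hold. (A1) (a) $\lim_{n\to\infty} p_n^2/n = 0$; (b) $\lim_{n\to\infty} p_n^2 M_n^2/n^2 = 0$; (c) $\lim_{n\to\infty} p_n/M_n^{s_\theta} = 0$. (A2) The smallest eigenvalue $\lambda_{\min}(\Xi^{(n)})$ of $\Xi^{(n)}$ satisfies $\liminf_{n\to\infty}\lambda_{\min}(\Xi^{(n)}) = c_\lambda > 0$. (A3) $\lambda_n = o(k_n^{-1/2})$. (A4) $\liminf_{n\to\infty}\min_{1\le j\le k_n}|\beta_j^{(n)}| = c_\beta>0$. (A5) With $\lambda_{\max}(\Xi^{(n)})$ the largest eigenvalue of $\Xi^{(n)}$: (a) $\lim_{n\to\infty}\sqrt{p_n\lambda_{\max}(\Xi^{(n)})}/(\sqrt n\,\lambda_n)=0$; (b) $\lim_{n\to\infty}\sqrt{p_n\lambda_{\max}(\Xi^{(n)})}/(M_n^{s_g}\lambda_n)=0$. Then $\lim_{n\to\infty}P(\widehat{\boldsymbol\beta}_2^{(n)}=\mathbf 0)=1$.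
   Context: Model. For each sample size $n$, the data $(\mathbf X_i^{(n)},T_i,Y_i)$, $i=1,\dots,n$, are i.i.d. copies of $(\mathbf X^{(n)},T,Y)$ with $\mathbf X^{(n)}\in\mathbb R^{p_n}$, $T\in[0,1]$, and $$Y_i=\mathbf X_i^{(n)\prime}\boldsymbol\beta^{(n)}+g(T_i)+\varepsilon_i,$$ where $\varepsilon_i$ is independent of $(\mathbf X_i^{(n)},T_i)$ with mean $0$ and variance $\sigma^2$, and $g:[0,1]\to\mathbb R$ is an unknown function. The dimension $p_n$ may diverge with $n$. A prime denotes transpose and $\|\cdot\|$ the Euclidean norm of a vector. The coefficient vector is $\boldsymbol\beta^{(n)}=(\boldsymbol\beta_1^{(n)\prime},\boldsymbol\beta_2^{(n)\prime})'$, where $\boldsymbol\beta_1^{(n)}=(\beta_1^{(n)},\dots,\beta_{k_n}^{(n)})'$ has nonzero entries and $\boldsymbol\beta_2^{(n)}=\mathbf 0\in\mathbb R^{m_n}$, $m_n=p_n-k_n$. Write $\mathbf Y=(Y_1,\dots,Y_n)'$ and let $\mathbb X^{(n)}$ be the $n\times p_n$ matrix with rows $\mathbf X_i^{(n)\prime}$. Splines. $\Delta_n=\{\xi_{n\nu}\}_{\nu=1}^{M_n}$ is a partition of $[0,1]$ (with $\xi_{n0}=0$, $\xi_{n,M_n+1}=1$) into $M_n+1$ subintervals $[\xi_{n\nu},\xi_{n,\nu+1})$, $\nu=0,\dots,M_n-1$, and $[\xi_{nM_n},1]$, with largest mesh size $O(M_n^{-1})$. For a fixed order $m$, $\mathcal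 S_m(\Delta_n)$ is the space of functions on $[0,1]$ that are polynomials of order $m$ (degree at most $m-1$) on each subinterval and, if $m\ge2$, are $m-2$ times continuously differentiable on $[0,1]$. Let $B_{n1},\dots,B_{nq_n}$, $q_n=M_n+m$, be a local (B-spline) basis of it, $\mathbf Z(t;\Delta_n)=(B_{n1}(t),\dots,B_{nq_n}(t))'$, and $\mathbb Z^{(n)}$ the $n\times q_n$ matrix with rows $\mathbf Z(T_i;\Delta_n)'$. Estimator. For fixed $a>2$ and $\lambda>0$ the SCAD penalty is $p_\lambda(\theta;a)=\lambda|\theta|$ if $|\theta|\le\lambda$; $-(\theta^2-2a\lambda|\theta|+\lambda^2)/[2(a-1)]$ if $\lambda<|\theta|\le a\lambda$; $(a+1)\lambda^2/2$ if $|\theta|>a\lambda$. The pair $(\widehat{\boldsymbol\beta}^{(n)},\widehat{\boldsymbol\alpha}^{(n)})$ is a (global) minimizer over $(\mathbf b,\mathbf a)\in\mathbb R^{p_n}\times\mathbb R^{q_n}$ of $$\|\mathbf Y-\mathbb X^{(n)}\mathbf b-\mathbb Z^{(n)}\mathbf a\|^2+n\sum_{j=1}^{p_n}p_{\lambda_n}(b_j;a).$$ Write $\widehat{\boldsymbol\beta}^{(n)}=(\widehat{\boldsymbol\beta}_1^{(n)\prime},\widehat{\boldsymbol\beta}_2^{(n)\prime})'$ with $\widehat{\boldsymbol\beta}_1^{(n)}\in\mathbb R^{k_n}$, $\widehat{\boldsymbol\beta}_2^{(n)}\in\mathbb R^{m_n}$. Notation. $\theta_j^{(n)}(t)=E[X_j^{(n)}\mid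 T=t]$, $\mathbf e^{(n)}=(e_1^{(n)},\dots,e_{p_n}^{(n)})'=\mathbf X^{(n)}-E[\mathbf X^{(n)}\mid T]$, $\Sigma^{(n)}(t)=\mathrm{Var}(\mathbf e^{(n)}\mid T=t)$, $\Xi^{(n)}=E[\Sigma^{(n)}(T)]$ (the unconditional covariance matrix of $\mathbf e^{(n)}$). Standing assumptions. $M_n$ is allowed to tend to infinity with $M_n=o(n)$; $\lambda_n\to0$; and: Condition 1: there are constants $\gamma_\theta,M_\theta>0$ and an integer $r_\theta$ with $0\le r_\theta\le m-1$ such that the $r_\theta$-th derivatives satisfy $\sup_{n\ge1}\sup_{1\le j\le p_n}|(\theta_j^{(n)})^{(r_\theta)}(t_2)-(\theta_j^{(n)})^{(r_\theta)}(t_1)|\le M_\theta|t_2-t_1|^{\gamma_\theta}$ for all $t_1,t_2\in[0,1]$; $s_\theta=r_\theta+\gamma_\theta$. Condition 2: there is a constant $\sigma_{4e}$ such that $E[(e_j^{(n)})^4\mid T]\le\sigma_{4e}$ almost surely for all $n$ and $1\le j\le p_n$. Condition 3: there are constants $\gamma_g,M_g>0$ and an integer $r_g$ with $0\le r_g\le m-1$ such that $|g^{(r_g)}(t_2)-g^{(r_g)}(t_1)|\le M_g|t_2-t_1|^{\gamma_g}$ for all $t_1,t_2\in[0,1]$; $s_g=r_g+\gamma_g$. The compact set containing the supports is the same for all $j$ and $n$. *)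

theory Defs
  imports
    "HOL-Probability.Probability"
    "HOL-Library.Landau_Symbols"
    "Jordan_Normal_Form.Spectral_Radius"
begin

text \<open>\<open>D i\<close> is the \<open>i\<close>-th derivative of \<open>f\<close> on \<open>[0,1]\<close> for \<open>i \<le> r\<close>, one-sided at the two
  endpoints. Values outside \<open>[0,1]\<close> play no role, and on \<open>[0,1]\<close> the functions \<open>D i\<close> are uniquely
  determined by \<open>f\<close>.\<close>

definition derivs_on_unit :: "nat \<Rightarrow> (real \<Rightarrow> real) \<Rightarrow> (nat \<Rightarrow> real \<Rightarrow> real) \<Rightarrow> bool" where
  "derivs_on_unit r f D \<longleftrightarrow>
     (\<forall>t\<in>{0..1}. D 0 t = f t) \<and>
     (\<forall>i<r. \<forall>t\<in>{0..1}. (D i has_real_derivative D (Suc i) t) (at t within {0..1}))"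

definition holder_deriv :: "nat \<Rightarrow> real \<Rightarrow> real \<Rightarrow> (real \<Rightarrow> real) \<Rightarrow> bool" where
  "holder_deriv r \<gamma> L f \<longleftrightarrow>
     (\<exists>D. derivs_on_unit r f D \<and>
          (\<forall>t1\<in>{0..1}. \<forall>t2\<in>{0..1}. \<bar>D r t2 - D r t1\<bar> \<le> L * \<bar>t2 - t1\<bar> powr \<gamma>))"

definition C_on_unit :: "nat \<Rightarrow> (real \<Rightarrow> real) \<Rightarrow> bool" where
  "C_on_unit r f \<longleftrightarrow> (\<exists>D. derivs_on_unit r f D \<and> continuous_on {0..1} (D r))"

text \<open>A partition with \<open>M\<close> interior knots \<open>\<xi> 1, \<dots>, \<xi> M\<close>.\<close>

definition unit_partition :: "nat \<Rightarrow> (nat \<Rightarrow> real) \<Rightarrow> bool" where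
  "unit_partition M \<xi> \<longleftrightarrow> \<xi> 0 = 0 \<and> \<xi> (Suc M) = 1 \<and> (\<forall>\<nu>\<le>M. \<xi> \<nu> < \<xi> (Suc \<nu>))"

definition mesh_size :: "nat \<Rightarrow> (nat \<Rightarrow> real) \<Rightarrow> real" where
  "mesh_size M \<xi> = Max ((\<lambda>\<nu>. \<xi> (Suc \<nu>) - \<xi> \<nu>) ` {..M})"

definition knot_interval :: "nat \<Rightarrow> (nat \<Rightarrow> real) \<Rightarrow> nat \<Rightarrow> real set" where
  "knot_interval M \<xi> \<nu> = (if \<nu> < M then {\<xi> \<nu>..<\<xi> (Suc \<nu>)} else {\<xi> M..1})"

text \<open>The spline space of order \<open>m \<ge> 1\<close>. Its members are functions on \<open>[0,1]\<close>, represented by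
  functions on the reals whose values outside \<open>[0,1]\<close> are irrelevant.\<close>

definition spline_space :: "nat \<Rightarrow> nat \<Rightarrow> (nat \<Rightarrow> real) \<Rightarrow> (real \<Rightarrow> real) set" where
  "spline_space m M \<xi> =
     {f. (\<forall>\<nu>\<le>M. \<exists>q :: real poly. degree q < m \<and> (\<forall>t\<in>knot_interval M \<xi> \<nu>. f t = poly q t)) \<and>
         (2 \<le> m \<longrightarrow> C_on_unit (m - 2) f)}"

text \<open>A local basis \<open>B 0, \<dots>, B (M + m - 1)\<close> of the spline space: as for B-splines, \<open>B k\<close> vanishes
  outside the (at most \<open>m\<close>) consecutive subintervals between \<open>\<xi> (k + 1 - m)\<close> and \<open>\<xi> (k + 1)\<close>, the
  indices being clipped to \<open>0, \<dots>, M + 1\<close>. The B-splines, in any normalization, are such a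
  basis.\<close>

definition local_spline_basis ::
    "nat \<Rightarrow> nat \<Rightarrow> (nat \<Rightarrow> real) \<Rightarrow> (nat \<Rightarrow> real \<Rightarrow> real) \<Rightarrow> bool" where
  "local_spline_basis m M \<xi> B \<longleftrightarrow>
     (\<forall>k<M + m. B k \<in> spline_space m M \<xi>) \<and>
     (\<forall>f\<in>spline_space m M \<xi>. \<exists>c. \<forall>t\<in>{0..1}. f t = (\<Sum>k<M + m. c k * B k t)) \<and>
     (\<forall>c. (\<forall>t\<in>{0..1}. (\<Sum>k<M + m. c k * B k t) = 0) \<longrightarrow> (\<forall>k<M + m. c k = 0)) \<and>
     (\<forall>k<M + m. \<forall>t\<in>{0..1} - {\<xi> (Suc k - m)..\<xi> (min (Suc k) (Suc M))}. B k t = 0)"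

text \<open>The (closed) support of the law of a real random variable.\<close>

definition rv_support :: "'a measure \<Rightarrow> ('a \<Rightarrow> real) \<Rightarrow> real set" where
  "rv_support M V =
     {x. \<forall>U. open U \<longrightarrow> x \<in> U \<longrightarrow> 0 < measure M (V -` U \<inter> space M)}"

definition cond_mean :: "'a measure \<Rightarrow> ('a \<Rightarrow> real) \<Rightarrow> ('a \<Rightarrow> real) \<Rightarrow> 'a \<Rightarrow> real" where
  "cond_mean M T V = real_cond_exp M (vimage_algebra (space M) T borel) V"

definition cond_resid :: "'a measure \<Rightarrow> ('a \<Rightarrow> real) \<Rightarrow> ('a \<Rightarrow> real) \<Rightarrow> 'a \<Rightarrow> real" where
  "cond_resid M T V = (\<lambda>\<omega>. V \<omega> - cond_mean M T V \<omega>)"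

definition cond_cov ::
    "'a measure \<Rightarrow> ('a \<Rightarrow> real) \<Rightarrow> ('a \<Rightarrow> real) \<Rightarrow> ('a \<Rightarrow> real) \<Rightarrow> 'a \<Rightarrow> real" where
  "cond_cov M T U V = cond_mean M T (\<lambda>\<omega>. cond_resid M T U \<omega> * cond_resid M T V \<omega>)"

text \<open>The expectation of the conditional covariance matrix, given \<open>T\<close>, of the vector of residuals
  \<open>X j - E[X j | T]\<close>, \<open>j < p\<close>.\<close>

definition Xi_mat :: "'a measure \<Rightarrow> ('a \<Rightarrow> real) \<Rightarrow> (nat \<Rightarrow> 'a \<Rightarrow> real) \<Rightarrow> nat \<Rightarrow> real mat" where
  "Xi_mat M T X p =
     Matrix.mat p p (\<lambda>(i, j). \<integral>\<omega>. cond_cov M T (cond_resid M T (X i)) (cond_resid M T (X j)) \<omega> \<partial>M)"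

text \<open>Meant for symmetric matrices of positive dimension, whose eigenvalues are all real.\<close>

definition min_eigenvalue :: "real mat \<Rightarrow> real" where
  "min_eigenvalue A = Min (spectrum A)"

definition max_eigenvalue :: "real mat \<Rightarrow> real" where
  "max_eigenvalue A = Max (spectrum A)"

definition covariate_space :: "nat \<Rightarrow> ((nat \<Rightarrow> real) \<times> real) measure" where
  "covariate_space p = (\<Pi>\<^sub>M j\<in>{..<p}. borel) \<Otimes>\<^sub>M borel"

definition covariates :: "nat \<Rightarrow> (nat \<Rightarrow> 'a \<Rightarrow> real) \<Rightarrow> ('a \<Rightarrow> real) \<Rightarrow> 'a \<Rightarrow> (nat \<Rightarrow> real) \<times> real" where
  "covariates p X T = (\<lambda>\<omega>. (restrict (\<lambda>j. X j \<omega>) {..<p}, T \<omega>))"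

text \<open>Independence of random variables with values in spaces of different type.\<close>

definition indep_rv :: "'a measure \<Rightarrow> 'b measure \<Rightarrow> ('a \<Rightarrow> 'b) \<Rightarrow> 'c measure \<Rightarrow> ('a \<Rightarrow> 'c) \<Rightarrow> bool" where
  "indep_rv M N V N' W \<longleftrightarrow>
     V \<in> measurable M N \<and> W \<in> measurable M N' \<and>
     prob_space.indep_set M (sets (vimage_algebra (space M) V N)) (sets (vimage_algebra (space M) W N'))"

definition obs_space :: "nat \<Rightarrow> (((nat \<Rightarrow> real) \<times> real) \<times> real) measure" where
  "obs_space p = covariate_space p \<Otimes>\<^sub>M borel"

definition obs ::
    "nat \<Rightarrow> (nat \<Rightarrow> 'a \<Rightarrow> real) \<Rightarrow> ('a \<Rightarrow> real) \<Rightarrow> ('a \<Rightarrow> real) \<Rightarrow> 'a \<Rightarrow> ((nat \<Rightarrow> real) \<times> real) \<times> real" where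
  "obs p X T Y = (\<lambda>\<omega>. (covariates p X T \<omega>, Y \<omega>))"

definition scad :: "real \<Rightarrow> real \<Rightarrow> real \<Rightarrow> real" where
  "scad a lam \<theta> =
     (if \<bar>\<theta>\<bar> \<le> lam then lam * \<bar>\<theta>\<bar>
      else if \<bar>\<theta>\<bar> \<le> a * lam then - (\<theta>\<^sup>2 - 2 * a * lam * \<bar>\<theta>\<bar> + lam\<^sup>2) / (2 * (a - 1))
      else (a + 1) * lam\<^sup>2 / 2)"

text \<open>\<open>x i j\<close> and \<open>z i k\<close> are the entries of the \<open>n \<times> p\<close> and \<open>n \<times> q\<close> design matrices, \<open>y\<close> is the
  response, and only \<open>b 0, \<dots>, b (p - 1)\<close> and \<open>c 0, \<dots>, c (q - 1)\<close> are relevant, so that minimizing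
  over all \<open>b\<close> and \<open>c\<close> is the same as minimizing over the \<open>p\<close>- and \<open>q\<close>-dimensional vectors.\<close>

definition scad_objective ::
    "real \<Rightarrow> real \<Rightarrow> nat \<Rightarrow> nat \<Rightarrow> nat \<Rightarrow> (nat \<Rightarrow> nat \<Rightarrow> real) \<Rightarrow> (nat \<Rightarrow> nat \<Rightarrow> real) \<Rightarrow> (nat \<Rightarrow> real) \<Rightarrow>
     (nat \<Rightarrow> real) \<Rightarrow> (nat \<Rightarrow> real) \<Rightarrow> real" where
  "scad_objective a lam n p q x z y b c =
     (\<Sum>i<n. (y i - (\<Sum>j<p. x i j * b j) - (\<Sum>k<q. z i k * c k))\<^sup>2) +
     real n * (\<Sum>j<p. scad a lam (b j))"

definition scad_minimizer ::
    "real \<Rightarrow> real \<Rightarrow> nat \<Rightarrow> nat \<Rightarrow> nat \<Rightarrow> (nat \<Rightarrow> nat \<Rightarrow> real) \<Rightarrow> (nat \<Rightarrow> nat \<Rightarrow> real) \<Rightarrow> (nat \<Rightarrow> real) \<Rightarrow>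
     (nat \<Rightarrow> real) \<Rightarrow> (nat \<Rightarrow> real) \<Rightarrow> bool" where
  "scad_minimizer a lam n p q x z y b c \<longleftrightarrow>
     (\<forall>b' c'. scad_objective a lam n p q x z y b c \<le> scad_objective a lam n p q x z y b' c')"

end

theory Submission
  imports Defs
begin

text \<open>Minimizing over the spline coefficients replaces the data by their projections onto the orthogonal
  complement of the spline columns. Write \<open>N\<close> for this projection and \<open>v\<close> for the estimation error. The
  penalized least squares criterion becomes the quadratic form \<open>\<parallel>N x v\<parallel>\<^sup>2 - 2 (N (g + \<epsilon>)) \<bullet> (N x v)\<close> plus the
  penalty. With probability tending to one this form is bounded below by a multiple of \<open>n \<parallel>v\<parallel>\<^sup>2\<close>, because the
  \<open>\<theta> j\<close> are nearly splines, the residuals have empirical covariance close to \<open>\<Xi>\<close>, and they are almost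
  uncorrelated with the splines; and the linear term is at most \<open>\<tau> sqrt n \<parallel>N x v\<parallel>\<close> with \<open>\<tau>\<close> a small multiple of
  \<open>lam\<close>, because \<open>g\<close> is nearly a spline and the noise has only \<open>p\<close> relevant components. On that event a
  nonzero coordinate among the last ones could be set to zero with profit: the penalty gains \<open>n lam \<bar>b\<bar>\<close>,
  while the quadratic part loses only a small multiple of this.

  All bounds in probability come from second moments. The residual columns are projected onto an orthonormal
  basis that is a function of the \<open>T\<close>-sample, the noise onto one that is a function of the covariate sample, so
  that both are conditionally centred. Orthonormal bases come from the Gram--Schmidt process, which is
  explicit and hence measurable.\<close>


section \<open>Approximation by splines\<close>

text \<open>One Gram-Schmidt family serves both projections because the spline columns come first:
  its first \<open>q = M + m\<close> vectors use the times alone, the next \<open>p\<close> use all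
  covariates. Removing the first \<open>q\<close> leaves exactly \<open>p\<close> vectors that the
  noise can meet. The residuals are bounded by a constant \<open>R\<close>, so the form divided by
  \<open>n\<close> has diagonal entries at most \<open>2 * R\<^sup>2 + 2\<close>, whatever
  \<open>n\<close> and \<open>p\<close> are. Together with coercivity this allows the admissible
  ratio \<eta> between the linear term and \<open>lam\<close> to be fixed from \<open>c\<close> and
  \<open>R\<close> alone. Each rate condition pays for one error. \<open>A1a\<close> controls p^2/n
  (empirical covariance), \<open>A1a\<close> and \<open>A1b\<close> control pq/n (residuals against
  splines), \<open>A1c\<close> the distance of the \<theta>'s from splines, summed over
  \<open>p\<close> coordinates. \<open>A3\<close> makes k lam^2 vanish, the total penalty of the
  true coefficients; with \<open>A4\<close> this separates them from the non-flat part of the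
  penalty. \<open>A5a\<close> and \<open>A5b\<close> give p/(n lam^2) \<rightarrow> 0 for the noise
  and M^(-s_g)/lam \<rightarrow> 0 for the bias of \<open>g\<close>, since the largest eigenvalue
  eventually exceeds \<open>c\<close>.\<close>

lemma unit_partition_mono:
  assumes "unit_partition M \<xi>" "i \<le> j" "j \<le> Suc M"
  shows "\<xi> i \<le> \<xi> j"
  using assms(2,3)
proof (induction j rule: dec_induct)
  case (step j)
  then have "\<xi> j < \<xi> (Suc j)" using assms(1) unfolding unit_partition_def by auto
  with step show ?case by auto
qed simp

lemma unit_partition_strict:
  assumes "unit_partition M \<xi>" "i < j" "j \<le> Suc M"
  shows "\<xi> i < \<xi> j"
proof -
  have "\<xi> i < \<xi> (Suc i)" using assms unfolding unit_partition_def by auto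
  also have "\<dots> \<le> \<xi> j" using unit_partition_mono[OF assms(1)] assms by auto
  finally show ?thesis .
qed

lemma unit_partition_range:
  assumes "unit_partition M \<xi>" "i \<le> Suc M"
  shows "0 \<le> \<xi> i" "\<xi> i \<le> 1"
  using unit_partition_mono[OF assms(1), of 0 i] unit_partition_mono[OF assms(1), of i "Suc M"] assms
  unfolding unit_partition_def by auto

lemma mesh_size_ge:
  assumes "\<nu> \<le> M"
  shows "\<xi> (Suc \<nu>) - \<xi> \<nu> \<le> mesh_size M \<xi>"
  unfolding mesh_size_def using assms by (intro Max_ge) auto

lemma knot_diff_le:
  assumes "unit_partition M \<xi>" "mesh_size M \<xi> \<le> h" "i \<le> j" "j \<le> Suc M"
  shows "\<xi> j - \<xi> i \<le> real (j - i) * h"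
  using assms(3,4)
proof (induction j rule: dec_induct)
  case (step j)
  have "\<xi> (Suc j) - \<xi> j \<le> h" using mesh_size_ge[of j M \<xi>] step assms by auto
  with step show ?case by (auto simp: Suc_diff_le algebra_simps)
qed simp

lemma knot_interval_cover:
  assumes "unit_partition M \<xi>" "t \<in> {0..1}"
  obtains \<nu> where "\<nu> \<le> M" "t \<in> knot_interval M \<xi> \<nu>"
proof -
  define \<nu> where "\<nu> = Max {i. i \<le> M \<and> \<xi> i \<le> t}"
  have ne: "0 \<in> {i. i \<le> M \<and> \<xi> i \<le> t}" using assms unfolding unit_partition_def by auto
  have mem: "\<nu> \<in> {i. i \<le> M \<and> \<xi> i \<le> t}" unfolding \<nu>_def
    by (rule Max_in) (use ne in auto)
  have "\<not> \<xi> (Suc \<nu>) \<le> t" if "\<nu> < M"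
  proof
    assume "\<xi> (Suc \<nu>) \<le> t"
    then have "Suc \<nu> \<le> \<nu>" unfolding \<nu>_def using that[unfolded \<nu>_def] by (intro Max_ge) auto
    then show False by simp
  qed
  then have "t \<in> knot_interval M \<xi> \<nu>"
    using mem assms(2) by (cases "\<nu> < M") (auto simp: knot_interval_def)
  with mem that show ?thesis by auto
qed

lemma knot_interval_subset:
  assumes "unit_partition M \<xi>" "\<nu> \<le> M"
  shows "knot_interval M \<xi> \<nu> \<subseteq> {\<xi> \<nu>..\<xi> (Suc \<nu>)}" "{\<xi> \<nu>..<\<xi> (Suc \<nu>)} \<subseteq> knot_interval M \<xi> \<nu>"
  using assms unfolding knot_interval_def unit_partition_def
  by (auto split: if_splits)

section \<open>Linear structure of the spline space\<close>

lemma C_on_unit_lincomb: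
  assumes "C_on_unit r f" "C_on_unit r g"
  shows "C_on_unit r (\<lambda>t. a * f t + b * g t)"
proof -
  from assms obtain D E where D: "derivs_on_unit r f D" "continuous_on {0..1} (D r)"
    and E: "derivs_on_unit r g E" "continuous_on {0..1} (E r)"
    unfolding C_on_unit_def by blast
  have "derivs_on_unit r (\<lambda>t. a * f t + b * g t) (\<lambda>i t. a * D i t + b * E i t)"
    using D(1) E(1) unfolding derivs_on_unit_def
    by (auto intro!: derivative_eq_intros)
  moreover have "continuous_on {0..1} (\<lambda>t. a * D r t + b * E r t)"
    using D(2) E(2) by (intro continuous_intros)
  ultimately show ?thesis unfolding C_on_unit_def by (intro exI[of _ "\<lambda>i t. a * D i t + b * E i t"]) auto
qed

lemma spline_lincomb:
  assumes "f \<in> spline_space m M \<xi>" "g \<in> spline_space m M \<xi>"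
  shows "(\<lambda>t. a * f t + b * g t) \<in> spline_space m M \<xi>"
proof -
  have "\<exists>q::real poly. degree q < m \<and> (\<forall>t\<in>knot_interval M \<xi> \<nu>. a * f t + b * g t = poly q t)"
    if \<nu>: "\<nu> \<le> M" for \<nu>
  proof -
    obtain q1 q2 :: "real poly" where q: "degree q1 < m" "\<forall>t\<in>knot_interval M \<xi> \<nu>. f t = poly q1 t"
      "degree q2 < m" "\<forall>t\<in>knot_interval M \<xi> \<nu>. g t = poly q2 t"
      using assms \<nu> unfolding spline_space_def by blast
    have "degree (Polynomial.smult a q1 + Polynomial.smult b q2) < m"
      using q(1,3) by (intro degree_add_less) (auto intro: le_less_trans[OF degree_smult_le])
    then show ?thesis using q by (intro exI[of _ "Polynomial.smult a q1 + Polynomial.smult b q2"]) auto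
  qed
  then show ?thesis using assms C_on_unit_lincomb unfolding spline_space_def by auto
qed

lemma spline_const:
  assumes "m \<ge> 1"
  shows "(\<lambda>t. c) \<in> spline_space m M \<xi>"
proof -
  have "C_on_unit r (\<lambda>t. c)" for r
    unfolding C_on_unit_def derivs_on_unit_def
    by (rule exI[of _ "\<lambda>i t. if i = 0 then c else 0"]) (auto intro!: derivative_eq_intros)
  moreover have "\<exists>q::real poly. degree q < m \<and> (\<forall>t\<in>A. c = poly q t)" for A
    using assms by (intro exI[of _ "[:c:]"]) auto
  ultimately show ?thesis unfolding spline_space_def by auto
qed

lemma spline_sum:
  assumes "m \<ge> 1" "\<And>i. i \<in> I \<Longrightarrow> f i \<in> spline_space m M \<xi>"
  shows "(\<lambda>t. \<Sum>i\<in>I. c i * f i t) \<in> spline_space m M \<xi>"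
proof (cases "finite I")
  case True
  then show ?thesis using assms(2)
  proof (induction I rule: finite_induct)
    case empty
    then show ?case using spline_const[OF assms(1)] by simp
  next
    case (insert i I)
    then show ?case using spline_lincomb[of "f i" m M \<xi> "\<lambda>t. \<Sum>i\<in>I. c i * f i t" "c i" 1] by auto
  qed
qed (use spline_const[OF assms(1)] in auto)

section \<open>Integration of splines\<close>

lemma poly_antiderivative:
  fixes q :: "real poly"
  obtains Q where "pderiv Q = q" "degree Q \<le> Suc (degree q)"
proof
  let ?Q = "\<Sum>i\<le>degree q. monom (coeff q i / real (Suc i)) (Suc i)"
  have "pderiv ?Q = (\<Sum>i\<le>degree q. monom (coeff q i) i)"
    by (simp add: pderiv_sum pderiv_monom del: of_nat_Suc)
  then show "pderiv ?Q = q" by (simp add: poly_as_sum_of_monoms)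
  show "degree ?Q \<le> Suc (degree q)"
    by (intro degree_sum_le) (auto intro: order_trans[OF degree_monom_le])
qed

lemma spline_piece_integral:
  assumes "unit_partition M \<xi>" "f \<in> spline_space m M \<xi>" "\<nu> \<le> M"
  obtains Q :: "real poly" where "degree Q \<le> m"
    "\<And>t. t \<in> {\<xi> \<nu>..\<xi> (Suc \<nu>)} \<Longrightarrow> (f has_integral poly Q t - poly Q (\<xi> \<nu>)) {\<xi> \<nu>..t}"
proof -
  obtain q :: "real poly" where q: "degree q < m" "\<forall>t\<in>knot_interval M \<xi> \<nu>. f t = poly q t"
    using assms unfolding spline_space_def by blast
  obtain Q where Q: "pderiv Q = q" "degree Q \<le> Suc (degree q)" by (rule poly_antiderivative)
  have "(f has_integral poly Q t - poly Q (\<xi> \<nu>)) {\<xi> \<nu>..t}" if t: "t \<in> {\<xi> \<nu>..\<xi> (Suc \<nu>)}" for t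
  proof -
    have "(poly q has_integral poly Q t - poly Q (\<xi> \<nu>)) {\<xi> \<nu>..t}"
      using t poly_DERIV[of Q] Q(1)
      by (intro fundamental_theorem_of_calculus)
         (auto simp: has_real_derivative_iff_has_vector_derivative[symmetric] intro: DERIV_subset)
    \<comment> \<open>At the right end of the subinterval the value of \<open>f\<close> may belong
      to the next piece; a single point does not affect the integral.\<close>
    then show ?thesis
    proof (rule has_integral_spike_finite[where S = "{t}", rotated 2])
      fix x assume "x \<in> {\<xi> \<nu>..t} - {t}"
      then have "x \<in> knot_interval M \<xi> \<nu>" using knot_interval_subset(2)[OF assms(1,3)] t by auto
      with q show "f x = poly q x" by auto
    qed simp
  qed
  with that Q q show ?thesis by (metis Suc_leI order_trans)
qed

lemma spline_integrable:
  assumes "unit_partition M \<xi>" "f \<in> spline_space m M \<xi>"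
  shows "f integrable_on {0..1}"
proof -
  have "f integrable_on {0..\<xi> j}" if "j \<le> Suc M" for j
    using that
  proof (induction j)
    case 0
    have "\<xi> 0 = 0" using assms(1) by (simp add: unit_partition_def)
    moreover have "f integrable_on {0..0}" using integrable_on_refl[of f "0::real"] by (simp add: cbox_interval)
    ultimately show ?case by (simp only:)
  next
    case (Suc j)
    obtain Q :: "real poly" where "(f has_integral poly Q (\<xi> (Suc j)) - poly Q (\<xi> j)) {\<xi> j..\<xi> (Suc j)}"
      using spline_piece_integral[OF assms, of j] Suc.prems unit_partition_mono[OF assms(1), of j "Suc j"]
      by (metis Suc_le_mono atLeastAtMost_iff le_Suc_eq order_refl)
    then have "f integrable_on {\<xi> j..\<xi> (Suc j)}" by blast
    then show ?case
      using Suc unit_partition_range[OF assms(1), of j] unit_partition_mono[OF assms(1), of j "Suc j"]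
      by (intro Henstock_Kurzweil_Integration.integrable_combine[of 0 "\<xi> j" "\<xi> (Suc j)"]) auto
  qed
  from this[of "Suc M"] show ?thesis using assms(1) unfolding unit_partition_def by auto
qed

lemma continuous_on_derivs_0:
  assumes "derivs_on_unit r f D" "continuous_on {0..1} (D r)"
  shows "continuous_on {0..1} f"
proof -
  have "continuous_on {0..1} (D 0)"
  proof (cases r)
    case (Suc r')
    then show ?thesis using assms(1) unfolding derivs_on_unit_def
      by (auto simp: continuous_on_eq_continuous_within intro: DERIV_continuous)
  qed (use assms in auto)
  moreover have "continuous_on {0..1} (D 0) \<longleftrightarrow> continuous_on {0..1} f"
    using assms(1) unfolding derivs_on_unit_def by (intro continuous_on_cong) auto
  ultimately show ?thesis by simp
qed

text \<open>Integration raises the degree of each piece by one and adds one derivative. For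
  \<open>m = 1\<close> the integrand may jump, but then only continuity of the integral is asked
  for, and that holds for every integrable function.\<close>

lemma spline_antiderivative:
  assumes "unit_partition M \<xi>" "f \<in> spline_space m M \<xi>" "m \<ge> 1"
  shows "(\<lambda>t. integral {0..t} f) \<in> spline_space (Suc m) M \<xi>"
proof -
  let ?F = "\<lambda>t. integral {0..t} f"
  have int: "f integrable_on {0..1}" by (rule spline_integrable[OF assms(1,2)])
  have pieces: "\<exists>q::real poly. degree q < Suc m \<and> (\<forall>t\<in>knot_interval M \<xi> \<nu>. ?F t = poly q t)"
    if \<nu>: "\<nu> \<le> M" for \<nu>
  proof -
    obtain Q :: "real poly" where Q: "degree Q \<le> m"
      "\<And>t. t \<in> {\<xi> \<nu>..\<xi> (Suc \<nu>)} \<Longrightarrow> (f has_integral poly Q t - poly Q (\<xi> \<nu>)) {\<xi> \<nu>..t}"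
      using spline_piece_integral[OF assms(1,2) \<nu>] by blast
    have "?F t = poly (Q + [:?F (\<xi> \<nu>) - poly Q (\<xi> \<nu>):]) t" if t: "t \<in> knot_interval M \<xi> \<nu>" for t
    proof -
      have t': "t \<in> {\<xi> \<nu>..\<xi> (Suc \<nu>)}" using knot_interval_subset(1)[OF assms(1) \<nu>] t by auto
      have t1: "t \<le> 1" "0 \<le> \<xi> \<nu>"
        using t' \<nu> unit_partition_range[OF assms(1), of "Suc \<nu>"] unit_partition_range[OF assms(1), of \<nu>] by auto
      have "f integrable_on {0..t}" by (rule integrable_subinterval_real[OF int]) (use t1 in auto)
      then have "?F t = ?F (\<xi> \<nu>) + integral {\<xi> \<nu>..t} f"
        using t' t1 by (subst Henstock_Kurzweil_Integration.integral_combine) auto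
      also have "integral {\<xi> \<nu>..t} f = poly Q t - poly Q (\<xi> \<nu>)"
        by (rule integral_unique[OF Q(2)[OF t']])
      finally show ?thesis by simp
    qed
    moreover have "degree (Q + [:?F (\<xi> \<nu>) - poly Q (\<xi> \<nu>):]) < Suc m"
      using Q(1) by (intro degree_add_less) auto
    ultimately show ?thesis by blast
  qed
  have smooth: "C_on_unit (m - 1) ?F"
  proof (cases "m = 1")
    case True
    then show ?thesis unfolding C_on_unit_def derivs_on_unit_def
      using indefinite_integral_continuous_1[OF int] by (intro exI[of _ "\<lambda>i. ?F"]) auto
  next
    case False
    define k where "k = m - 2"
    have k: "m = Suc (Suc k)" using False assms(3) unfolding k_def by simp
    have "C_on_unit k f" using assms(2) False assms(3) unfolding spline_space_def k_def by simp
    then obtain D where D: "derivs_on_unit k f D" "continuous_on {0..1} (D k)"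
      unfolding C_on_unit_def by blast
    have cont: "continuous_on {0..1} f" by (rule continuous_on_derivs_0[OF D])
    define E where "E i = (case i of 0 \<Rightarrow> ?F | Suc i \<Rightarrow> D i)" for i
    have "(E i has_real_derivative E (Suc i) t) (at t within {0..1})" if i: "i < Suc k" and t: "t \<in> {0..1::real}" for i t
    proof (cases i)
      case 0
      have "D 0 t = f t" using D(1) t unfolding derivs_on_unit_def by blast
      then show ?thesis using integral_has_real_derivative[OF cont t] 0 by (simp add: E_def)
    next
      case (Suc i')
      then have "(D i' has_real_derivative D (Suc i') t) (at t within {0..1})"
        using D(1) i t unfolding derivs_on_unit_def by blast
      then show ?thesis using Suc by (simp add: E_def)
    qed
    moreover have "E 0 = ?F" "E (Suc k) = D k" by (simp_all add: E_def)
    moreover have "m - 1 = Suc k" using k by simp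
    ultimately show ?thesis unfolding C_on_unit_def derivs_on_unit_def
      using D(2) by (intro exI[of _ E]) simp
  qed
  show ?thesis using pieces smooth unfolding spline_space_def by auto
qed

text \<open>Smoothed Heaviside functions. The step of the next order is the normalized integral of
  the difference of two steps, the second starting after the first has finished: this difference is
  nonnegative and vanishes off a bounded stretch of knots, so its integral rises monotonically from
  0 to 1. At order one the step is a jump at \<open>\<xi> a\<close>.\<close>

lemma step_spline:
  assumes "unit_partition M \<xi>" "m \<ge> 1" "a + 2 ^ (m - 1) \<le> Suc M"
  shows "\<exists>\<Phi>\<in>spline_space m M \<xi>. \<forall>t\<in>{0..1}. 0 \<le> \<Phi> t \<and> \<Phi> t \<le> 1 \<and>
           (t < \<xi> a \<longrightarrow> \<Phi> t = 0) \<and> (\<xi> (a + 2 ^ (m - 1) - 1) \<le> t \<longrightarrow> \<Phi> t = 1)"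
  using assms(2,3)
proof (induction m arbitrary: a rule: dec_induct)
  case base
  let ?\<Phi> = "\<lambda>t. if t < \<xi> a then 0 else (1::real)"
  have "\<exists>q::real poly. degree q < 1 \<and> (\<forall>t\<in>knot_interval M \<xi> \<nu>. ?\<Phi> t = poly q t)" if "\<nu> \<le> M" for \<nu>
  proof (cases "\<nu> < a")
    case True
    have "?\<Phi> t = 0" if "t \<in> knot_interval M \<xi> \<nu>" for t
      using that True base unit_partition_mono[OF assms(1), of "Suc \<nu>" a]
      by (auto simp: knot_interval_def)
    then show ?thesis by (intro exI[of _ 0]) auto
  next
    case False
    have "?\<Phi> t = 1" if "t \<in> knot_interval M \<xi> \<nu>" for t
      using that False base unit_partition_mono[OF assms(1), of a \<nu>] knot_interval_subset(1)[OF assms(1) \<open>\<nu> \<le> M\<close>] \<open>\<nu> \<le> M\<close>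
      by auto
    then show ?thesis by (intro exI[of _ 1]) auto
  qed
  then have "?\<Phi> \<in> spline_space 1 M \<xi>" unfolding spline_space_def by auto
  then show ?case by (intro bexI[of _ ?\<Phi>]) auto
next
  case (step m)
  \<comment> \<open>\<open>L\<close> subintervals carry the rise of a step of order
    \<open>m\<close>. Two such rises, separated by one further subinterval, give the rise
    \<open>2 * L + 1 = 2 ^ m - 1\<close> of the next order.\<close>
  define L where "L = (2::nat) ^ (m - 1) - 1"
  have L: "2 ^ (m - 1) = Suc L" unfolding L_def by simp
  have L2: "2 ^ (Suc m - 1) = 2 * L + 2" using L step.hyps by (cases m) auto
  have aM: "a + 2 * L + 1 \<le> M" using step.prems L2 by simp
  obtain \<Phi>1 where P1: "\<Phi>1 \<in> spline_space m M \<xi>" "\<And>t. t\<in>{0..1} \<Longrightarrow> 0 \<le> \<Phi>1 t" "\<And>t. t\<in>{0..1} \<Longrightarrow> \<Phi>1 t \<le> 1"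
     "\<And>t. t\<in>{0..1} \<Longrightarrow> t < \<xi> a \<Longrightarrow> \<Phi>1 t = 0" "\<And>t. t\<in>{0..1} \<Longrightarrow> \<xi> (a + L) \<le> t \<Longrightarrow> \<Phi>1 t = 1"
    using step.IH[of a] aM unfolding L by auto
  obtain \<Phi>2 where P2: "\<Phi>2 \<in> spline_space m M \<xi>" "\<And>t. t\<in>{0..1} \<Longrightarrow> 0 \<le> \<Phi>2 t" "\<And>t. t\<in>{0..1} \<Longrightarrow> \<Phi>2 t \<le> 1"
     "\<And>t. t\<in>{0..1} \<Longrightarrow> t < \<xi> (a + L + 1) \<Longrightarrow> \<Phi>2 t = 0" "\<And>t. t\<in>{0..1} \<Longrightarrow> \<xi> (a + 2 * L + 1) \<le> t \<Longrightarrow> \<Phi>2 t = 1"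
    using step.IH[of "a + L + 1"] aM unfolding L by (auto simp: mult_2 add_ac)
  define D where "D t = \<Phi>1 t - \<Phi>2 t" for t
  have Dspl: "D \<in> spline_space m M \<xi>"
    using spline_lincomb[OF P1(1) P2(1), of 1 "-1"] unfolding D_def by simp
  have int: "D integrable_on {0..1}" by (rule spline_integrable[OF assms(1) Dspl])
  have mono: "\<xi> i \<le> \<xi> j" if "i \<le> j" "j \<le> Suc M" for i j using unit_partition_mono[OF assms(1) that] .
  have D0: "0 \<le> D t" if "t \<in> {0..1}" for t
    using P1(2,3,5)[OF that] P2(2,3,4)[OF that] mono[of "a + L" "a + L + 1"] aM unfolding D_def
    by (cases "t < \<xi> (a + L + 1)") auto
  have Dl: "D t = 0" if "t \<in> {0..1}" "t < \<xi> a" for t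
    using P1(4)[OF that] P2(4)[OF that(1)] that mono[of a "a + L + 1"] aM unfolding D_def by auto
  have Dr: "D t = 0" if "t \<in> {0..1}" "\<xi> (a + 2 * L + 1) \<le> t" for t
    using P1(5)[OF that(1)] P2(5)[OF that] that mono[of "a + L" "a + 2 * L + 1"] aM unfolding D_def by auto
  define I where "I = integral {0..1} D"
  let ?u = "\<xi> (a + L)" and ?v = "\<xi> (a + L + 1)"
  have uv: "?u < ?v" "0 \<le> ?u" "?v \<le> 1"
    using unit_partition_strict[OF assms(1), of "a + L" "a + L + 1"] aM
      unit_partition_range[OF assms(1), of "a + L"] unit_partition_range[OF assms(1), of "a + L + 1"] by auto
  have sub: "D integrable_on {s..t}" if "0 \<le> s" "t \<le> 1" for s t
    by (rule integrable_subinterval_real[OF int]) (use that in auto)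
  have "((\<lambda>t. 1) has_integral 1 * (?v - ?u)) {?u..?v}"
    using has_integral_const_real[of "1::real" ?u ?v] uv by simp
  \<comment> \<open>On the separating subinterval the first step is already 1 and the second still
    0; this keeps the normalizing constant \<open>I\<close> positive. The point \<open>?v\<close> is
    left out, since at order one the second step jumps there.\<close>
  then have "(D has_integral 1 * (?v - ?u)) {?u..?v}"
    by (rule has_integral_spike_finite[where S = "{?v}", rotated 2])
       (use P1(5) P2(4) uv in \<open>auto simp: D_def\<close>)
  then have "?v - ?u = integral {?u..?v} D" by (simp add: integral_unique)
  also have "\<dots> \<le> I" unfolding I_def
    by (rule integral_subset_le) (use uv D0 sub in auto)
  finally have I: "I > 0" using uv by simp
  define \<Phi> where "\<Phi> t = inverse I * integral {0..t} D" for t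
  have spl: "\<Phi> \<in> spline_space (Suc m) M \<xi>"
    using spline_lincomb[OF spline_antiderivative[OF assms(1) Dspl step.hyps(1)] spline_const[of "Suc m" 0], of "inverse I" 0]
    unfolding \<Phi>_def by simp
  have "0 \<le> \<Phi> t \<and> \<Phi> t \<le> 1 \<and> (t < \<xi> a \<longrightarrow> \<Phi> t = 0) \<and> (\<xi> (a + 2 * L + 1) \<le> t \<longrightarrow> \<Phi> t = 1)"
    if t: "t \<in> {0..1}" for t
  proof (intro conjI impI)
    have "0 \<le> integral {0..t} D" by (rule integral_nonneg) (use t sub D0 in auto)
    then show "0 \<le> \<Phi> t" unfolding \<Phi>_def using I by auto
    have "integral {0..t} D \<le> I" unfolding I_def
      by (rule integral_subset_le) (use t sub D0 in auto)
    then show "\<Phi> t \<le> 1" unfolding \<Phi>_def using I by (auto simp: field_simps)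
    show "\<Phi> t = 0" if "t < \<xi> a"
    proof -
      have "integral {0..t} D = integral {0..t} (\<lambda>t. 0)"
        by (rule Henstock_Kurzweil_Integration.integral_cong) (use t that Dl in auto)
      then show ?thesis unfolding \<Phi>_def by simp
    qed
    show "\<Phi> t = 1" if "\<xi> (a + 2 * L + 1) \<le> t"
    proof -
      have "I = integral {0..t} D + integral {t..1} D" unfolding I_def
        using Henstock_Kurzweil_Integration.integral_combine[of 0 t 1 D] t int by auto
      also have "integral {t..1} D = integral {t..1} (\<lambda>t. 0)"
        by (rule Henstock_Kurzweil_Integration.integral_cong) (use t that Dr in auto)
      finally show ?thesis unfolding \<Phi>_def using I by simp
    qed
  qed
  then show ?case using spl L2 by (intro bexI[of _ \<Phi>]) auto
qed

text \<open>Quasi-interpolation by step splines: on each block of \<open>2 ^ (m - 1)\<close> subintervals the spline is a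
  convex combination of the values of \<open>F\<close> at the two ends of the block.\<close>

lemma spline_approx_modulus:
  assumes "unit_partition M \<xi>" "m \<ge> 1" "mesh_size M \<xi> \<le> h"
    and F: "\<And>s t. s \<in> {0..1} \<Longrightarrow> t \<in> {0..1} \<Longrightarrow> \<bar>s - t\<bar> \<le> 2 ^ (m - 1) * h \<Longrightarrow> \<bar>F s - F t\<bar> \<le> w"
  shows "\<exists>s\<in>spline_space m M \<xi>. \<forall>t\<in>{0..1}. \<bar>F t - s t\<bar> \<le> w"
proof -
  define K where "K = (2::nat) ^ (m - 1)"
  have K: "K \<ge> 1" unfolding K_def by simp
  have h: "h \<ge> 0"
  proof -
    have "\<xi> (Suc 0) - \<xi> 0 \<le> h" using mesh_size_ge[of 0 M \<xi>] assms(3) by simp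
    then show ?thesis using unit_partition_strict[OF assms(1), of 0 1] by simp
  qed
  \<comment> \<open>The number of complete blocks. Fewer than \<open>K\<close> subintervals remain
    at the right end, and there the approximant is constant.\<close>
  define J where "J = Suc M div K"
  have JK: "J * K \<le> Suc M" "Suc M < J * K + K"
    unfolding J_def using K dividend_less_div_times[of K "Suc M"] by auto
  have "\<exists>\<Phi>\<in>spline_space m M \<xi>. \<forall>t\<in>{0..1}. 0 \<le> \<Phi> t \<and> \<Phi> t \<le> 1 \<and>
           (t < \<xi> (i * K) \<longrightarrow> \<Phi> t = 0) \<and> (\<xi> (i * K + K - 1) \<le> t \<longrightarrow> \<Phi> t = 1)" if "i < J" for i
  proof -
    have "Suc i * K \<le> J * K" using that by (intro mult_right_mono) auto
    then show ?thesis using step_spline[OF assms(1,2), of "i * K"] JK unfolding K_def by auto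
  qed
  then obtain \<Phi> where \<Phi>: "\<And>i. i < J \<Longrightarrow> \<Phi> i \<in> spline_space m M \<xi>"
      "\<And>i t. i < J \<Longrightarrow> t \<in> {0..1} \<Longrightarrow> 0 \<le> \<Phi> i t \<and> \<Phi> i t \<le> 1 \<and>
           (t < \<xi> (i * K) \<longrightarrow> \<Phi> i t = 0) \<and> (\<xi> (i * K + K - 1) \<le> t \<longrightarrow> \<Phi> i t = 1)"
    by metis
  define \<tau> where "\<tau> i = \<xi> (i * K)" for i
  \<comment> \<open>At a point of block \<open>i\<close> all steps before \<open>i\<close> have
    reached 1 and all steps after \<open>i\<close> are still 0, so the sum telescopes to
    \<open>F (\<tau> i)\<close> plus a fraction of the increment to
    \<open>F (\<tau> (Suc i))\<close>.\<close>
  define s where "s t = 1 * F (\<tau> 0) + 1 * (\<Sum>i<J. (F (\<tau> (Suc i)) - F (\<tau> i)) * \<Phi> i t)" for t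
  have "s \<in> spline_space m M \<xi>" unfolding s_def
    by (intro spline_lincomb spline_const spline_sum assms \<Phi>) auto
  moreover have "\<bar>F t - s t\<bar> \<le> w" if t: "t \<in> {0..1}" for t
  proof -
    define i where "i = Max {i. i \<le> J \<and> \<tau> i \<le> t}"
    have "0 \<in> {i. i \<le> J \<and> \<tau> i \<le> t}" using t assms(1) unfolding \<tau>_def unit_partition_def by auto
    then have "i \<in> {i. i \<le> J \<and> \<tau> i \<le> t}"
      unfolding i_def by (intro Max_in) auto
    then have i: "i \<le> J" "\<tau> i \<le> t" by auto
    have i_next: "t < \<tau> (Suc i)" if "i < J"
    proof (rule ccontr)
      assume "\<not> t < \<tau> (Suc i)"
      then have "Suc i \<le> i" unfolding i_def using that[unfolded i_def] by (intro Max_ge) auto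
      then show False by simp
    qed
    have \<tau>_le: "i' * K \<le> Suc M" if "i' \<le> J" for i'
      using JK(1) mult_le_mono1[OF that, of K] by linarith
    have \<tau>_unit: "\<tau> i' \<in> {0..1}" if "i' \<le> J" for i'
      using unit_partition_range[OF assms(1) \<tau>_le[OF that]] unfolding \<tau>_def by auto
    have one: "\<Phi> i' t = 1" if "i' < i" for i'
    proof -
      have "i' * K + K \<le> i * K" using mult_right_mono[of "Suc i'" i K] that by simp
      then have "\<xi> (i' * K + K - 1) \<le> \<tau> i" unfolding \<tau>_def
        using \<tau>_le[OF i(1)] by (intro unit_partition_mono[OF assms(1)]) auto
      then show ?thesis using \<Phi>(2)[OF _ t, of i'] i that by auto
    qed
    have zero: "\<Phi> i' t = 0" if "i < i'" "i' < J" for i'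
    proof -
      have "\<tau> (Suc i) \<le> \<tau> i'" unfolding \<tau>_def
        using that \<tau>_le[of i'] by (intro unit_partition_mono[OF assms(1)] mult_right_mono) auto
      then show ?thesis using \<Phi>(2)[OF _ t, of i'] that i_next unfolding \<tau>_def by auto
    qed
    have tele: "(\<Sum>i'<i. (F (\<tau> (Suc i')) - F (\<tau> i')) * \<Phi> i' t) = F (\<tau> i) - F (\<tau> 0)"
      using one sum_lessThan_telescope[of "\<lambda>i. F (\<tau> i)" i] by simp
    have near: "\<bar>t - \<tau> i\<bar> \<le> K * h"
    proof (cases "i < J")
      case True
      have "\<tau> (Suc i) - \<tau> i \<le> real (Suc i * K - i * K) * h" unfolding \<tau>_def
        using \<tau>_le[of "Suc i"] True by (intro knot_diff_le[OF assms(1,3)]) auto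
      then show ?thesis using i_next[OF True] i(2) by simp
    next
      case False
      then have "i = J" using i by simp
      have "\<xi> (Suc M) - \<tau> i \<le> real (Suc M - i * K) * h" unfolding \<tau>_def
        using \<tau>_le[of i] i by (intro knot_diff_le[OF assms(1,3)]) auto
      also have "\<dots> \<le> real K * h" using JK(2) \<open>i = J\<close> h by (intro mult_right_mono) auto
      finally show ?thesis using t i(2) assms(1) unfolding unit_partition_def by simp
    qed
    then have e1: "\<bar>F (\<tau> i) - F t\<bar> \<le> w"
      using F[of "\<tau> i" t] \<tau>_unit[OF i(1)] t unfolding K_def by (simp add: abs_minus_commute)
    show ?thesis
    proof (cases "i < J")
      case False
      then have "i = J" using i by simp
      then have "s t = F (\<tau> i)" using tele unfolding s_def by simp
      then show ?thesis using e1 by (simp add: abs_minus_commute)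
    next
      case True
      have split: "{..<J} = {..<i} \<union> {i} \<union> {Suc i..<J}" using True by auto
      have "(\<Sum>i<J. (F (\<tau> (Suc i)) - F (\<tau> i)) * \<Phi> i t)
          = (\<Sum>i'\<in>{..<i} \<union> {i}. (F (\<tau> (Suc i')) - F (\<tau> i')) * \<Phi> i' t)
            + (\<Sum>i'\<in>{Suc i..<J}. (F (\<tau> (Suc i')) - F (\<tau> i')) * \<Phi> i' t)"
        unfolding split by (intro sum.union_disjoint) auto
      also have "(\<Sum>i'\<in>{Suc i..<J}. (F (\<tau> (Suc i')) - F (\<tau> i')) * \<Phi> i' t) = 0"
        using zero by (intro sum.neutral) auto
      finally have "s t = F (\<tau> i) + (F (\<tau> (Suc i)) - F (\<tau> i)) * \<Phi> i t"
        using tele unfolding s_def by (simp add: sum.union_disjoint)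
      then have st: "s t - F t = (1 - \<Phi> i t) * (F (\<tau> i) - F t) + \<Phi> i t * (F (\<tau> (Suc i)) - F t)"
        by (simp add: algebra_simps)
      have "\<tau> (Suc i) - \<tau> i \<le> real (Suc i * K - i * K) * h" unfolding \<tau>_def
        using \<tau>_le[of "Suc i"] True by (intro knot_diff_le[OF assms(1,3)]) auto
      then have "\<bar>\<tau> (Suc i) - t\<bar> \<le> K * h" using i_next[OF True] i(2) by simp
      then have e2: "\<bar>F (\<tau> (Suc i)) - F t\<bar> \<le> w"
        using F[of "\<tau> (Suc i)" t] \<tau>_unit[of "Suc i"] True t unfolding K_def by simp
      have \<Phi>i: "0 \<le> \<Phi> i t" "\<Phi> i t \<le> 1" using \<Phi>(2)[OF True t] by auto
      have "\<bar>s t - F t\<bar> \<le> \<bar>(1 - \<Phi> i t) * (F (\<tau> i) - F t)\<bar> + \<bar>\<Phi> i t * (F (\<tau> (Suc i)) - F t)\<bar>"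
        unfolding st by (rule abs_triangle_ineq)
      also have "\<dots> = (1 - \<Phi> i t) * \<bar>F (\<tau> i) - F t\<bar> + \<Phi> i t * \<bar>F (\<tau> (Suc i)) - F t\<bar>"
        using \<Phi>i by (simp add: abs_mult)
      also have "\<dots> \<le> (1 - \<Phi> i t) * w + \<Phi> i t * w"
        using \<Phi>i e1 e2 by (intro add_mono mult_left_mono) auto
      finally show ?thesis by (simp add: algebra_simps abs_minus_commute)
    qed
  qed
  ultimately show ?thesis by blast
qed

text \<open>The difference quotient is at most L|t - s|^(\<gamma> - 1), which tends to 0, so the
  derivative vanishes. Smoothness exponents are only assumed positive; this settles those above 1,
  where the estimate K^\<gamma> \<le> K for a block length K would fail.\<close>

lemma holder_gt_one_constant:
  fixes f :: "real \<Rightarrow> real"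
  assumes "\<gamma> > 1" "L \<ge> 0" and f: "\<And>s t. s \<in> {0..1} \<Longrightarrow> t \<in> {0..1} \<Longrightarrow> \<bar>f t - f s\<bar> \<le> L * \<bar>t - s\<bar> powr \<gamma>"
  shows "\<exists>c. \<forall>t\<in>{0..1}. f t = c"
proof (rule has_field_derivative_zero_constant)
  show "convex {0..1::real}" by simp
  fix x :: real assume x: "x \<in> {0..1}"
  show "(f has_field_derivative 0) (at x within {0..1})"
    unfolding has_field_derivative_iff
  proof (rule tendsto_0_le[where K = 1])
    have "((\<lambda>y. \<bar>y - x\<bar>) \<longlongrightarrow> \<bar>x - x\<bar>) (at x within {0..1})"
      by (intro tendsto_intros)
    then have "((\<lambda>y. \<bar>y - x\<bar> powr (\<gamma> - 1)) \<longlongrightarrow> 0) (at x within {0..1})"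
      using tendsto_zero_powrI[of "\<lambda>y. \<bar>y - x\<bar>" "at x within {0..1}" "\<lambda>y. \<gamma> - 1" "\<gamma> - 1"] assms(1) by simp
    then show "((\<lambda>y. L * \<bar>y - x\<bar> powr (\<gamma> - 1)) \<longlongrightarrow> 0) (at x within {0..1})"
      by (rule tendsto_mult_right_zero)
    have "norm ((f y - f x) / (y - x)) \<le> norm (L * \<bar>y - x\<bar> powr (\<gamma> - 1)) * 1"
      if "y \<in> {0..1}" "y \<noteq> x" for y
      using f[OF x that(1)] that assms(2) by (simp add: abs_mult powr_diff field_simps)
    then show "\<forall>\<^sub>F y in at x within {0..1}.
       norm ((f y - f x) / (y - x)) \<le> norm (L * \<bar>y - x\<bar> powr (\<gamma> - 1)) * 1"
      by (auto simp: eventually_at_topological)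
  qed
qed

text \<open>Induction on the number of derivatives, the order of the spline moving along. If
  \<open>s\<close> approximates the derivative of \<open>f\<close> within \<epsilon>, and
  \<open>S\<close> is the integral of \<open>s\<close>, then \<open>f - S\<close> is Lipschitz with
  constant \<epsilon>, so approximating it by its values at block ends gains one more factor
  \<open>h\<close>. Each round costs at most a factor \<open>2 ^ m\<close>, whence the power in the
  constant.\<close>

lemma spline_approx_holder:
  assumes "unit_partition M \<xi>" "mesh_size M \<xi> \<le> h" "\<gamma> > 0" "L > 0"
    and "holder_deriv r \<gamma> L f" "r < m"
  shows "\<exists>s\<in>spline_space m M \<xi>. \<forall>t\<in>{0..1}. \<bar>f t - s t\<bar> \<le> L * (2 ^ m) ^ Suc r * h powr (real r + \<gamma>)"
  using assms(5,6)
proof (induction r arbitrary: f m)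
  case 0
  have h: "h > 0"
    using mesh_size_ge[of 0 M \<xi>] assms(2) unit_partition_strict[OF assms(1), of 0 1] by simp
  have f: "\<bar>f t - f s\<bar> \<le> L * \<bar>t - s\<bar> powr \<gamma>" if "s \<in> {0..1}" "t \<in> {0..1}" for s t
    using 0(1) that unfolding holder_deriv_def derivs_on_unit_def by metis
  show ?case
  proof (cases "\<gamma> \<le> 1")
    case True
    show ?thesis
    proof (rule spline_approx_modulus[OF assms(1) _ assms(2)])
      fix s t :: real assume st: "s \<in> {0..1}" "t \<in> {0..1}" "\<bar>s - t\<bar> \<le> 2 ^ (m - 1) * h"
      have "\<bar>f s - f t\<bar> \<le> L * \<bar>s - t\<bar> powr \<gamma>" using f[OF st(2,1)] .
      also have "\<dots> \<le> L * (2 ^ (m - 1) * h) powr \<gamma>"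
        using assms st by (intro mult_left_mono powr_mono2) auto
      also have "\<dots> = L * ((2 ^ (m - 1)) powr \<gamma> * h powr \<gamma>)" using h by (simp add: powr_mult)
      also have "\<dots> \<le> L * (2 ^ (m - 1) * h powr \<gamma>)"
        using assms(4) powr_mono[OF True, of "2 ^ (m - 1)"] by (intro mult_left_mono mult_right_mono) auto
      also have "\<dots> \<le> L * (2 ^ m * h powr \<gamma>)"
        using assms(4) by (intro mult_left_mono mult_right_mono power_increasing) auto
      finally show "\<bar>f s - f t\<bar> \<le> L * (2 ^ m) ^ Suc 0 * h powr (real 0 + \<gamma>)" by simp
    qed (use 0 in auto)
  next
    case False
    then obtain c where "\<forall>t\<in>{0..1}. f t = c"
      using holder_gt_one_constant[of \<gamma> L f] f assms(4) by auto
    then show ?thesis using spline_const[of m c] 0 assms(4) by (intro bexI[of _ "\<lambda>t. c"]) auto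
  qed
next
  case (Suc r)
  obtain k where k: "m = Suc k" "r < k" using Suc.prems(2) by (cases m) auto
  obtain D where D: "derivs_on_unit (Suc r) f D"
      "\<forall>t1\<in>{0..1}. \<forall>t2\<in>{0..1}. \<bar>D (Suc r) t2 - D (Suc r) t1\<bar> \<le> L * \<bar>t2 - t1\<bar> powr \<gamma>"
    using Suc.prems(1) unfolding holder_deriv_def by blast
  have "holder_deriv r \<gamma> L (D 1)"
    unfolding holder_deriv_def
    by (rule exI[of _ "\<lambda>i. D (Suc i)"]) (use D in \<open>auto simp: derivs_on_unit_def\<close>)
  from Suc.IH[OF this k(2)] obtain s where s: "s \<in> spline_space k M \<xi>"
      "\<And>t. t \<in> {0..1} \<Longrightarrow> \<bar>D 1 t - s t\<bar> \<le> L * (2 ^ k) ^ Suc r * h powr (real r + \<gamma>)" by blast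
  define \<epsilon> where "\<epsilon> = L * (2 ^ k) ^ Suc r * h powr (real r + \<gamma>)"
  have h: "h > 0"
    using mesh_size_ge[of 0 M \<xi>] assms(2) unit_partition_strict[OF assms(1), of 0 1] by simp
  have \<epsilon>: "\<epsilon> \<ge> 0" unfolding \<epsilon>_def using assms(4) by simp
  define S where "S t = integral {0..t} s" for t
  have S: "S \<in> spline_space m M \<xi>" unfolding S_def k
    by (rule spline_antiderivative[OF assms(1) s(1)]) (use k in auto)
  have lip: "\<bar>(f t - S t) - (f u - S u)\<bar> \<le> \<epsilon> * (t - u)" if tu: "u \<in> {0..1}" "t \<in> {0..1}" "u \<le> t" for t u
  proof -
    have "(D 1 has_integral f t - f u) {u..t}"
    proof (rule fundamental_theorem_of_calculus[OF tu(3)])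
      fix x assume x: "x \<in> {u..t}"
      then have x1: "x \<in> {0..1}" using tu by auto
      have "(D 0 has_real_derivative D 1 x) (at x within {0..1})" using D(1) x1 unfolding derivs_on_unit_def by auto
      then have "(f has_real_derivative D 1 x) (at x within {0..1})"
        unfolding has_field_derivative_def
        by (rule has_derivative_transform[OF x1, rotated])
           (use D(1) in \<open>simp add: derivs_on_unit_def\<close>)
      then show "(f has_vector_derivative D 1 x) (at x within {u..t})"
        using tu by (auto simp: has_real_derivative_iff_has_vector_derivative[symmetric] intro: DERIV_subset)
    qed
    moreover have "(s has_integral S t - S u) {u..t}"
    proof -
      have int: "s integrable_on {0..1}" by (rule spline_integrable[OF assms(1) s(1)])
      have "S t = S u + integral {u..t} s" unfolding S_def
        using tu integrable_subinterval_real[OF int, of 0 t]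
        by (subst Henstock_Kurzweil_Integration.integral_combine) auto
      moreover have "s integrable_on {u..t}" using tu integrable_subinterval_real[OF int, of u t] by auto
      ultimately show ?thesis by (simp add: has_integral_integral)
    qed
    ultimately have "((\<lambda>x. D 1 x - s x) has_integral (f t - f u) - (S t - S u)) {u..t}"
      by (rule has_integral_diff)
    then have "norm ((f t - f u) - (S t - S u)) \<le> \<epsilon> * Henstock_Kurzweil_Integration.content {u..t}"
      by (rule has_integral_bound_real[OF \<epsilon> finite.emptyI]) (use s(2) tu in \<open>simp add: \<epsilon>_def\<close>)
    then show ?thesis using tu by (simp add: algebra_simps)
  qed
  obtain s' where s': "s' \<in> spline_space m M \<xi>"
      "\<And>t. t \<in> {0..1} \<Longrightarrow> \<bar>(f t - S t) - s' t\<bar> \<le> \<epsilon> * (2 ^ (m - 1) * h)"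
  proof -
    have "\<exists>s'\<in>spline_space m M \<xi>. \<forall>t\<in>{0..1}. \<bar>(f t - S t) - s' t\<bar> \<le> \<epsilon> * (2 ^ (m - 1) * h)"
    proof (rule spline_approx_modulus[OF assms(1) _ assms(2)])
      fix u t :: real assume ut: "u \<in> {0..1}" "t \<in> {0..1}" "\<bar>u - t\<bar> \<le> 2 ^ (m - 1) * h"
      have "\<bar>(f u - S u) - (f t - S t)\<bar> \<le> \<epsilon> * \<bar>u - t\<bar>"
        using lip[of u t] lip[of t u] ut by (cases "u \<le> t") (auto simp: abs_minus_commute)
      also have "\<dots> \<le> \<epsilon> * (2 ^ (m - 1) * h)" using ut \<epsilon> by (intro mult_left_mono) auto
      finally show "\<bar>(f u - S u) - (f t - S t)\<bar> \<le> \<epsilon> * (2 ^ (m - 1) * h)" .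
    qed (use k in auto)
    then show ?thesis using that by blast
  qed
  have hp: "h powr (real r + \<gamma>) * h = h powr (real (Suc r) + \<gamma>)"
    using h powr_add[of h "real r + \<gamma>" 1] by (simp add: add_ac)
  have pw: "(2 ^ k) ^ Suc r * 2 ^ (m - 1) \<le> (2 ^ m :: real) ^ Suc (Suc r)"
  proof -
    have "(2 ^ k :: real) ^ Suc r * 2 ^ (m - 1) = (2 ^ k) ^ Suc (Suc r)" using k by simp
    also have "\<dots> \<le> (2 ^ m) ^ Suc (Suc r)" using k by (intro power_mono power_increasing) auto
    finally show ?thesis .
  qed
  have "\<epsilon> * (2 ^ (m - 1) * h) = L * ((2 ^ k) ^ Suc r * 2 ^ (m - 1)) * (h powr (real r + \<gamma>) * h)"
    unfolding \<epsilon>_def by (simp only: mult_ac)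
  also have "\<dots> = L * ((2 ^ k) ^ Suc r * 2 ^ (m - 1)) * h powr (real (Suc r) + \<gamma>)"
    unfolding hp ..
  also have "\<dots> \<le> L * (2 ^ m) ^ Suc (Suc r) * h powr (real (Suc r) + \<gamma>)"
    using pw assms(4) by (intro mult_right_mono mult_left_mono) auto
  finally have bd: "\<epsilon> * (2 ^ (m - 1) * h) \<le> L * (2 ^ m) ^ Suc (Suc r) * h powr (real (Suc r) + \<gamma>)" .
  show ?case
  proof (intro bexI[of _ "\<lambda>t. 1 * S t + 1 * s' t"] ballI)
    show "(\<lambda>t. 1 * S t + 1 * s' t) \<in> spline_space m M \<xi>" by (rule spline_lincomb[OF S s'(1)])
    fix t :: real assume "t \<in> {0..1}"
    from order_trans[OF s'(2)[OF this] bd]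
    show "\<bar>f t - (1 * S t + 1 * s' t)\<bar> \<le> L * (2 ^ m) ^ Suc (Suc r) * h powr (real (Suc r) + \<gamma>)"
      by (simp add: algebra_simps)
  qed
qed


section \<open>Positive semidefinite forms and Gram--Schmidt\<close>

text \<open>Vectors are functions on all of \<open>nat\<close>, so that a varying dimension needs no
  types; a form may ignore coordinates. Only semidefiniteness is asked, which lets one set of lemmas
  cover inner products on \<open>n\<close> coordinates, projected inner products, and a symmetric
  matrix shifted by its smallest Rayleigh quotient.\<close>

definition psd_form :: "(('a \<Rightarrow> real) \<Rightarrow> ('a \<Rightarrow> real) \<Rightarrow> real) \<Rightarrow> bool" where
  "psd_form q \<longleftrightarrow> (\<forall>u v. q u v = q v u) \<and>
     (\<forall>u w v t. q (\<lambda>i. u i + t * w i) v = q u v + t * q w v) \<and> (\<forall>u. q u u \<ge> 0)"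

lemma psd_form_expand:
  assumes "psd_form q"
  shows "q (\<lambda>i. u i + t * w i) (\<lambda>i. u i + t * w i) = q u u + 2 * t * q u w + t\<^sup>2 * q w w"
proof -
  have sym: "\<And>u v. q u v = q v u" and lin: "\<And>u w v t. q (\<lambda>i. u i + t * w i) v = q u v + t * q w v"
    using assms unfolding psd_form_def by blast+
  show ?thesis
    using lin[of u t w "\<lambda>i. u i + t * w i"] sym[of u "\<lambda>i. u i + t * w i"] sym[of w "\<lambda>i. u i + t * w i"]
      lin[of u t w u] lin[of u t w w] sym[of w u]
    by (simp add: algebra_simps power2_eq_square)
qed

lemma psd_form_nonneg: "psd_form q \<Longrightarrow> q u u \<ge> 0"
  unfolding psd_form_def by blast

lemma psd_form_sum:
  assumes "psd_form q" "finite J"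
  shows "q (\<lambda>i. \<Sum>j\<in>J. c j * w j i) v = (\<Sum>j\<in>J. c j * q (w j) v)"
proof -
  have lin: "\<And>u w v t. q (\<lambda>i. u i + t * w i) v = q u v + t * q w v"
    using assms unfolding psd_form_def by blast
  have zero: "q (\<lambda>i. 0) v = 0" using lin[of "\<lambda>i. 0" 1 "\<lambda>i. 0" v] by simp
  show ?thesis using assms(2)
  proof (induction J rule: finite_induct)
    case (insert j J)
    then show ?case using lin[of "\<lambda>i. \<Sum>j\<in>J. c j * w j i" "c j" "w j" v] by (simp add: add.commute)
  qed (simp add: zero)
qed

lemma psd_form_cauchy_schwarz:
  assumes "psd_form q"
  shows "\<bar>q u w\<bar> \<le> sqrt (q u u) * sqrt (q w w)"
proof -
  have nonneg: "0 \<le> q u u + 2 * t * q u w + t\<^sup>2 * q w w" for t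
    using psd_form_nonneg[OF assms] psd_form_expand[OF assms] by metis
  have "(q u w)\<^sup>2 \<le> q u u * q w w"
  proof (cases "q w w = 0")
    case True
    have "q u w = 0"
    proof (rule ccontr)
      assume "q u w \<noteq> 0"
      \<comment> \<open>For this \<open>t\<close> the nonnegative expansion takes the value
        -1.\<close>
      then show False
        using nonneg[of "- (q u u + 1) / (2 * q u w)"] True by (simp add: field_simps)
    qed
    then show ?thesis using True by simp
  next
    case False
    then have pos: "q w w > 0" using psd_form_nonneg[OF assms, of w] by simp
    have "0 \<le> q u u - (q u w)\<^sup>2 / q w w"
      using nonneg[of "- q u w / q w w"] pos by (simp add: field_simps power2_eq_square)
    then show ?thesis using pos by (simp add: field_simps)
  qed
  then have "sqrt ((q u w)\<^sup>2) \<le> sqrt (q u u * q w w)" by (rule real_sqrt_le_mono)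
  then show ?thesis by (simp add: real_sqrt_mult)
qed

lemma psd_form_add_le:
  assumes "psd_form q"
  shows "q (\<lambda>i. u i + w i) (\<lambda>i. u i + w i) \<le> 2 * q u u + 2 * q w w"
  using psd_form_expand[OF assms, of u 1 w] psd_form_expand[OF assms, of u "-1" w]
    psd_form_nonneg[OF assms, of "\<lambda>i. u i + -1 * w i"] by simp

definition ip :: "nat \<Rightarrow> (nat \<Rightarrow> real) \<Rightarrow> (nat \<Rightarrow> real) \<Rightarrow> real" where
  "ip n u v = (\<Sum>i<n. u i * v i)"

lemma psd_form_ip: "psd_form (ip n)"
  unfolding psd_form_def ip_def
  by (auto simp: algebra_simps sum.distrib sum_distrib_left intro!: sum_nonneg)

lemma ip_cong: "(\<And>i. i < n \<Longrightarrow> u i = u' i) \<Longrightarrow> (\<And>i. i < n \<Longrightarrow> v i = v' i) \<Longrightarrow> ip n u v = ip n u' v'"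
  unfolding ip_def by (intro sum.cong) auto

lemma ip_commute: "ip n u v = ip n v u"
  unfolding ip_def by (simp add: mult.commute)

lemma ip_self_eq_0_iff: "ip n u u = 0 \<longleftrightarrow> (\<forall>i<n. u i = 0)"
  unfolding ip_def by (subst sum_nonneg_eq_0_iff) auto

lemma ip_self_le:
  assumes "\<And>i. i < n \<Longrightarrow> \<bar>u i\<bar> \<le> d"
  shows "ip n u u \<le> real n * d\<^sup>2"
proof -
  have "u i * u i \<le> d\<^sup>2" if "i < n" for i
    using power_mono[OF assms[OF that], of 2] by (simp add: power2_eq_square)
  then have "ip n u u \<le> (\<Sum>i<n. d\<^sup>2)" unfolding ip_def by (intro sum_mono) auto
  then show ?thesis by simp
qed

lemma ip_sum_left: "finite J \<Longrightarrow> ip n (\<lambda>i. \<Sum>j\<in>J. c j * w j i) v = (\<Sum>j\<in>J. c j * ip n (w j) v)"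
  by (rule psd_form_sum[OF psd_form_ip])

lemma ip_add_left: "ip n (\<lambda>i. u i + t * w i) v = ip n u v + t * ip n w v"
  using psd_form_ip unfolding psd_form_def by blast

text \<open>A vector that depends linearly on its predecessors is sent to \<open>0\<close>, since \<open>x / 0 = 0\<close>; thus the
  resulting family consists of orthonormal vectors and zeros.\<close>

function orthonormalize :: "nat \<Rightarrow> (nat \<Rightarrow> nat \<Rightarrow> real) \<Rightarrow> nat \<Rightarrow> nat \<Rightarrow> real" where
  "orthonormalize n z l =
     (let v = (\<lambda>i. z l i - (\<Sum>k<l. ip n (orthonormalize n z k) (z l) * orthonormalize n z k i))
      in (\<lambda>i. v i / sqrt (ip n v v)))"
  by pat_completeness auto
termination by (relation "Wellfounded.measure (\<lambda>(n, z, l). l)") auto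

declare orthonormalize.simps [simp del]

text \<open>The process is triangular: member \<open>l\<close> sees only columns up to
  \<open>l\<close>. Hence the basis vectors belonging to spline columns are functions of the times,
  whatever columns follow.\<close>

lemma orthonormalize_cong:
  assumes "\<And>k i. k \<le> l \<Longrightarrow> i < n \<Longrightarrow> z k i = z' k i" "i < n"
  shows "orthonormalize n z l i = orthonormalize n z' l i"
  using assms
proof (induction l arbitrary: i rule: less_induct)
  case (less l)
  let ?v = "\<lambda>z i. z l i - (\<Sum>k<l. ip n (orthonormalize n z k) (z l) * orthonormalize n z k i)"
  have v: "?v z i = ?v z' i" if "i < n" for i
  proof -
    have IH: "orthonormalize n z k i = orthonormalize n z' k i" if "k < l" "i < n" for k i
      using less.IH[OF that(1)] less.prems(1) that by auto
    then have "ip n (orthonormalize n z k) (z l) = ip n (orthonormalize n z' k) (z' l)" if "k < l" for k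
      using less.prems(1) that by (intro ip_cong) auto
    with IH show ?thesis using less.prems(1) that
      by (intro arg_cong2[of _ _ _ _ "(-)"] sum.cong refl) auto
  qed
  have ipv: "ip n (?v z) (?v z) = ip n (?v z') (?v z')" by (intro ip_cong v)
  have "?v z i / sqrt (ip n (?v z) (?v z)) = ?v z' i / sqrt (ip n (?v z') (?v z'))"
    unfolding ipv v[OF less.prems(2)] ..
  then show ?case unfolding orthonormalize.simps[of n z l] orthonormalize.simps[of n z' l] Let_def .
qed

lemma borel_measurable_orthonormalize:
  assumes "\<And>k i. k \<le> l \<Longrightarrow> i < n \<Longrightarrow> (\<lambda>\<omega>. z \<omega> k i) \<in> borel_measurable N" "i < n"
  shows "(\<lambda>\<omega>. orthonormalize n (z \<omega>) l i) \<in> borel_measurable N"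
  using assms
proof (induction l arbitrary: i rule: less_induct)
  case (less l)
  have [measurable]: "(\<lambda>\<omega>. orthonormalize n (z \<omega>) k i) \<in> borel_measurable N" if "k < l" "i < n" for k i
    using less that by auto
  have [measurable]: "(\<lambda>\<omega>. z \<omega> l i) \<in> borel_measurable N" if "i < n" for i
    using less.prems that by auto
  have [measurable]: "(\<lambda>\<omega>. ip n (orthonormalize n (z \<omega>) k) (z \<omega> l)) \<in> borel_measurable N" if "k < l" for k
    unfolding ip_def using that by (intro borel_measurable_sum borel_measurable_times) auto
  have [measurable]: "(\<lambda>\<omega>. z \<omega> l i - (\<Sum>k<l. ip n (orthonormalize n (z \<omega>) k) (z \<omega> l) * orthonormalize n (z \<omega>) k i))
      \<in> borel_measurable N" if "i < n" for i
    using that by (intro borel_measurable_diff borel_measurable_sum borel_measurable_times) auto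
  have [measurable]: "(\<lambda>\<omega>. ip n (\<lambda>i. z \<omega> l i - (\<Sum>k<l. ip n (orthonormalize n (z \<omega>) k) (z \<omega> l) * orthonormalize n (z \<omega>) k i))
     (\<lambda>i. z \<omega> l i - (\<Sum>k<l. ip n (orthonormalize n (z \<omega>) k) (z \<omega> l) * orthonormalize n (z \<omega>) k i))) \<in> borel_measurable N"
    unfolding ip_def[of n "\<lambda>i. _ i - _ i"] by (intro borel_measurable_sum borel_measurable_times) auto
  show ?case
    using less.prems by (subst orthonormalize.simps) (simp add: Let_def)
qed

definition orthonormal_or_zero :: "nat \<Rightarrow> (nat \<Rightarrow> nat \<Rightarrow> real) \<Rightarrow> bool" where
  "orthonormal_or_zero n e \<longleftrightarrow>
     (\<forall>k l. k \<noteq> l \<longrightarrow> ip n (e k) (e l) = 0) \<and> (\<forall>k. ip n (e k) (e k) = 1 \<or> (\<forall>i<n. e k i = 0))"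

lemma orthonormal_or_zero_orthonormalize: "orthonormal_or_zero n (orthonormalize n z)"
proof -
  let ?e = "orthonormalize n z"
  define v where "v l i = z l i - (\<Sum>k<l. ip n (?e k) (z l) * ?e k i)" for l i
  have e: "?e l = (\<lambda>i. v l i / sqrt (ip n (v l) (v l)))" for l
    by (subst orthonormalize.simps) (simp add: v_def[abs_def] Let_def)
  have norm: "ip n (?e k) (?e k) = 1 \<or> (\<forall>i<n. ?e k i = 0)" for k
  proof (cases "ip n (v k) (v k) = 0")
    case True then show ?thesis unfolding e by simp
  next
    case False
    then have "ip n (v k) (v k) > 0" using psd_form_nonneg[OF psd_form_ip, of n "v k"] by simp
    moreover have "ip n (?e k) (?e k) = ip n (v k) (v k) / (sqrt (ip n (v k) (v k)))\<^sup>2"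
      unfolding e ip_def by (simp add: sum_divide_distrib power2_eq_square)
    ultimately show ?thesis by simp
  qed
  \<comment> \<open>A squared length is 1 or 0, and a zero vector has zero coefficients. Multiplying
    a coefficient by the squared length therefore changes nothing, which treats dependent columns
    without a case distinction.\<close>
  have norm_mult: "ip n (?e k) w * ip n (?e k) (?e k) = ip n (?e k) w" for k w
    using norm[of k] by (auto simp: ip_def)
  have ortho: "ip n (?e k) (?e l) = 0" if "k < l" for k l
    using that
  proof (induction l arbitrary: k rule: less_induct)
    case (less l)
    define X where "X = ip n (?e k) (?e k)"
    have z: "ip n (?e k') (?e k) = (if k' = k then X else 0)" if "k' < l" for k'
      using less.IH[of k k'] less.IH[of k' k] less.prems that ip_commute[of n "?e k" "?e k'"]
      by (cases "k' = k"; cases "k' < k") (auto simp: X_def)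
    have "ip n (v l) (?e k) = ip n (z l) (?e k) - ip n (\<lambda>i. \<Sum>k'<l. ip n (?e k') (z l) * ?e k' i) (?e k)"
      using ip_add_left[of n "z l" "-1" "\<lambda>i. \<Sum>k'<l. ip n (?e k') (z l) * ?e k' i" "?e k"] unfolding v_def by simp
    also have "ip n (\<lambda>i. \<Sum>k'<l. ip n (?e k') (z l) * ?e k' i) (?e k)
        = (\<Sum>k'<l. ip n (?e k') (z l) * ip n (?e k') (?e k))" by (rule ip_sum_left) simp
    also have "\<dots> = (\<Sum>k'<l. if k' = k then ip n (?e k) (z l) * X else 0)"
      by (intro sum.cong refl) (simp add: z)
    also have "\<dots> = ip n (?e k) (z l)" using less.prems norm_mult[of k "z l"] unfolding X_def by simp
    finally have "ip n (v l) (?e k) = 0" by (simp add: ip_commute)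
    then have "ip n (?e k) (v l) = 0" by (simp add: ip_commute)
    then have "(\<Sum>i<n. ?e k i * v l i) / sqrt (ip n (v l) (v l)) = 0" unfolding ip_def by simp
    then show ?case unfolding e[of l] ip_def by (simp add: sum_divide_distrib)
  qed
  show ?thesis unfolding orthonormal_or_zero_def
    using norm ortho by (metis ip_commute linorder_neqE_nat)
qed

section \<open>Spans, Parseval's identity and projections\<close>

definition in_span :: "nat \<Rightarrow> (nat \<Rightarrow> nat \<Rightarrow> real) \<Rightarrow> nat \<Rightarrow> (nat \<Rightarrow> real) \<Rightarrow> bool" where
  "in_span n e r w \<longleftrightarrow> (\<exists>c. \<forall>i<n. w i = (\<Sum>k<r. c k * e k i))"

lemma in_span_orthonormalize:
  assumes "l < r"
  shows "in_span n (orthonormalize n z) r (z l)"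
proof -
  let ?e = "orthonormalize n z"
  define v where "v i = z l i - (\<Sum>k<l. ip n (?e k) (z l) * ?e k i)" for i
  have e: "?e l = (\<lambda>i. v i / sqrt (ip n v v))"
    by (subst orthonormalize.simps) (simp add: v_def[abs_def] Let_def)
  \<comment> \<open>If \<open>v\<close> has length zero, both sides vanish on the coordinates below
    \<open>n\<close>; division by zero loses nothing.\<close>
  have "v i = sqrt (ip n v v) * ?e l i" if "i < n" for i
    using that ip_self_eq_0_iff[of n v] unfolding e by auto
  then have z: "z l i = (\<Sum>k<l. ip n (?e k) (z l) * ?e k i) + sqrt (ip n v v) * ?e l i" if "i < n" for i
  proof -
    have "z l i = (\<Sum>k<l. ip n (?e k) (z l) * ?e k i) + v i" by (simp add: v_def)
    then show ?thesis using \<open>\<And>i. i < n \<Longrightarrow> v i = sqrt (ip n v v) * ?e l i\<close>[OF that] by simp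
  qed
  let ?c = "\<lambda>k. if k < l then ip n (?e k) (z l) else if k = l then sqrt (ip n v v) else 0"
  have "(\<Sum>k<r. ?c k * ?e k i) = (\<Sum>k<Suc l. ?c k * ?e k i)" for i
    using assms by (intro sum.mono_neutral_right) auto
  then show ?thesis unfolding in_span_def using z by (intro exI[of _ ?c]) simp
qed

lemma in_span_sum:
  assumes "finite J" "\<And>j. j \<in> J \<Longrightarrow> in_span n e r (w j)"
  shows "in_span n e r (\<lambda>i. \<Sum>j\<in>J. a j * w j i)"
proof -
  obtain c where c: "\<And>j i. j \<in> J \<Longrightarrow> i < n \<Longrightarrow> w j i = (\<Sum>k<r. c j k * e k i)"
    using assms(2) unfolding in_span_def by metis
  have "(\<Sum>j\<in>J. a j * w j i) = (\<Sum>k<r. (\<Sum>j\<in>J. a j * c j k) * e k i)" if "i < n" for i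
  proof -
    have "(\<Sum>j\<in>J. a j * w j i) = (\<Sum>j\<in>J. \<Sum>k<r. a j * c j k * e k i)"
      using c that by (simp add: sum_distrib_left mult.assoc)
    also have "\<dots> = (\<Sum>k<r. \<Sum>j\<in>J. a j * c j k * e k i)" by (rule sum.swap)
    finally show ?thesis by (simp add: sum_distrib_right)
  qed
  then show ?thesis unfolding in_span_def by (intro exI[of _ "\<lambda>k. \<Sum>j\<in>J. a j * c j k"]) simp
qed

text \<open>The coefficients \<open>c k\<close> at zero vectors are arbitrary, but they enter both
  sides only multiplied by products with \<open>e k\<close>, which are then 0. At unit vectors
  \<open>c k\<close> is the inner product with \<open>w\<close>.\<close>

lemma parseval:
  assumes "orthonormal_or_zero n e" "in_span n e r w"
  shows "ip n w v = (\<Sum>k<r. ip n (e k) w * ip n (e k) v)"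
proof -
  obtain c where c: "\<And>i. i < n \<Longrightarrow> w i = (\<Sum>k<r. c k * e k i)" using assms(2) unfolding in_span_def by auto
  have w: "ip n w v = (\<Sum>k<r. c k * ip n (e k) v)" for v
  proof -
    have "ip n w v = ip n (\<lambda>i. \<Sum>k<r. c k * e k i) v" using c by (intro ip_cong) auto
    then show ?thesis by (simp add: ip_sum_left)
  qed
  have "ip n (e k) w * ip n (e k) v = c k * ip n (e k) v" if "k < r" for k
  proof -
    have "ip n (e k) w = (\<Sum>l<r. c l * ip n (e l) (e k))" using w[of "e k"] by (simp add: ip_commute)
    also have "\<dots> = (\<Sum>l<r. if l = k then c k * ip n (e k) (e k) else 0)"
      using assms(1) unfolding orthonormal_or_zero_def by (intro sum.cong) auto
    also have "\<dots> = c k * ip n (e k) (e k)" using that by simp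
    finally have "ip n (e k) w = c k * ip n (e k) (e k)" .
    moreover have "ip n (e k) (e k) * ip n (e k) v = ip n (e k) v"
      using assms(1) unfolding orthonormal_or_zero_def by (auto simp: ip_def)
    ultimately show ?thesis by (simp add: mult.assoc)
  qed
  then show ?thesis unfolding w by (intro sum.cong[OF refl]) (metis lessThan_iff)
qed

text \<open>The form \<open>(N u) \<bullet> (N v)\<close>, where \<open>N\<close> is the projection onto the orthogonal complement of
  \<open>e 0, \<dots>, e (q - 1)\<close>.\<close>

definition proj_form :: "nat \<Rightarrow> (nat \<Rightarrow> nat \<Rightarrow> real) \<Rightarrow> nat \<Rightarrow> (nat \<Rightarrow> real) \<Rightarrow> (nat \<Rightarrow> real) \<Rightarrow> real" where
  "proj_form n e q u v = ip n u v - (\<Sum>k<q. ip n (e k) u * ip n (e k) v)"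

text \<open>Identifies the algebraic expression with the squared length of a least squares residual.
  This gives positivity of the form, and shows that the value is attained by a choice of spline
  coefficients.\<close>

lemma proj_form_residual:
  fixes q
  assumes "orthonormal_or_zero n e"
  defines "c \<equiv> \<lambda>u k. ip n (e k) u"
  shows "ip n (\<lambda>i. u i - (\<Sum>k<q. c u k * e k i)) (\<lambda>i. u i - (\<Sum>k<q. c u k * e k i)) = proj_form n e q u u"
proof -
  let ?s = "\<lambda>i. \<Sum>k<q. c u k * e k i"
  have cs: "ip n (e k) ?s = (if k < q then c u k else 0)" for k
  proof -
    have "ip n ?s (e k) = (\<Sum>l<q. c u l * ip n (e l) (e k))" by (simp add: ip_sum_left)
    also have "\<dots> = (\<Sum>l<q. if l = k then c u k * ip n (e k) (e k) else 0)"
      using assms(1) unfolding orthonormal_or_zero_def by (intro sum.cong) auto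
    also have "\<dots> = (if k < q then c u k * ip n (e k) (e k) else 0)" by simp
    moreover have "c u k * ip n (e k) (e k) = c u k"
      using assms(1) unfolding orthonormal_or_zero_def c_def by (auto simp: ip_def)
    ultimately show ?thesis by (simp add: ip_commute)
  qed
  have ss: "ip n ?s v = (\<Sum>k<q. c u k * c v k)" for v
    by (simp add: ip_sum_left c_def)
  have "c ?s k = (if k < q then c u k else 0)" for k using cs[of k] unfolding c_def .
  then have "ip n ?s ?s = (\<Sum>k<q. c u k * c u k)" unfolding ss by (intro sum.cong) auto
  moreover have "ip n ?s u = (\<Sum>k<q. c u k * c u k)" by (rule ss)
  ultimately show ?thesis
    using psd_form_expand[OF psd_form_ip, of n u "-1" ?s] ip_commute[of n u ?s]
    unfolding proj_form_def by (simp add: c_def)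
qed

lemma psd_form_proj:
  assumes "orthonormal_or_zero n e"
  shows "psd_form (proj_form n e q)"
  unfolding psd_form_def
proof (intro conjI allI)
  show "proj_form n e q u v = proj_form n e q v u" for u v
    unfolding proj_form_def by (simp add: ip_commute mult.commute)
  show "proj_form n e q (\<lambda>i. u i + t * w i) v = proj_form n e q u v + t * proj_form n e q w v" for u w v t
    unfolding proj_form_def ip_commute[of n "e _" "\<lambda>i. u i + t * w i"] ip_add_left
    by (simp add: algebra_simps sum.distrib sum_distrib_left ip_commute)
  show "0 \<le> proj_form n e q u u" for u
    unfolding proj_form_residual[OF assms, symmetric] by (rule psd_form_nonneg[OF psd_form_ip])
qed

lemma bessel:
  assumes "orthonormal_or_zero n e"
  shows "(\<Sum>k<q. (ip n (e k) u)\<^sup>2) \<le> ip n u u"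
  using psd_form_nonneg[OF psd_form_proj[OF assms], of q u]
  unfolding proj_form_def by (simp add: power2_eq_square)

lemma proj_form_le_ip:
  "proj_form n e q u u \<le> ip n u u"
  unfolding proj_form_def by (simp add: sum_nonneg)

lemma proj_form_span:
  assumes "orthonormal_or_zero n e" "in_span n e q w"
  shows "proj_form n e q w v = 0"
  using parseval[OF assms] unfolding proj_form_def by simp

text \<open>The way in which a smooth function is exchanged for its distance to a spline.\<close>

lemma proj_form_sub_span:
  assumes "orthonormal_or_zero n e" "in_span n e q w"
  shows "proj_form n e q (\<lambda>i. u i - w i) (\<lambda>i. u i - w i) = proj_form n e q u u"
proof -
  have "proj_form n e q w u = proj_form n e q u w"
    using psd_form_proj[OF assms(1)] unfolding psd_form_def by blast
  then show ?thesis
    using psd_form_expand[OF psd_form_proj[OF assms(1)], of q u "-1" w] proj_form_span[OF assms] by simp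
qed

lemma orthonormal_comp_le_one:
  assumes "orthonormal_or_zero n e" "i < n"
  shows "\<bar>e k i\<bar> \<le> 1"
proof -
  have "ip n (e k) (e k) = 1 \<or> (\<forall>i<n. e k i = 0)" using assms(1) unfolding orthonormal_or_zero_def by blast
  then have "ip n (e k) (e k) \<le> 1" by (auto simp: ip_def)
  moreover have "e k i * e k i \<le> ip n (e k) (e k)"
    unfolding ip_def using assms(2) by (intro member_le_sum) auto
  ultimately show ?thesis by (metis order_trans abs_le_square_iff abs_one one_power2 power2_eq_square)
qed

lemma orthonormal_sum_squares_le_one:
  assumes "orthonormal_or_zero n e"
  shows "(\<Sum>i<n. (e k i)\<^sup>2) \<le> 1"
proof -
  have "ip n (e k) (e k) = 1 \<or> (\<forall>i<n. e k i = 0)" using assms(1) unfolding orthonormal_or_zero_def by blast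
  then show ?thesis by (auto simp: ip_def power2_eq_square)
qed


section \<open>Minimizers of a SCAD-penalized quadratic form\<close>

lemma scad_nonneg:
  assumes "a > 2" "lam > 0"
  shows "0 \<le> scad a lam t"
proof -
  consider "\<bar>t\<bar> \<le> lam" | "lam < \<bar>t\<bar>" "\<bar>t\<bar> \<le> a * lam" | "a * lam < \<bar>t\<bar>" "lam < \<bar>t\<bar>" by linarith
  then show ?thesis
  proof cases
    case 2
    have "t\<^sup>2 - 2 * a * lam * \<bar>t\<bar> + lam\<^sup>2 \<le> 0"
    proof -
      have "\<bar>t\<bar> * \<bar>t\<bar> \<le> a * lam * \<bar>t\<bar>" using 2 by (intro mult_right_mono) auto
      moreover have "lam * lam \<le> a * lam * \<bar>t\<bar>"
        using 2 assms by (intro mult_mono) auto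
      ultimately show ?thesis by (simp add: power2_eq_square)
    qed
    then show ?thesis using 2 assms unfolding scad_def by (auto intro!: divide_nonneg_nonneg simp: divide_le_0_iff)
  qed (use assms in \<open>auto simp: scad_def\<close>)
qed

lemma scad_le:
  assumes "a > 2" "lam > 0"
  shows "scad a lam t \<le> (a + 1) * lam\<^sup>2 / 2"
proof -
  consider "\<bar>t\<bar> \<le> lam" | "lam < \<bar>t\<bar>" "\<bar>t\<bar> \<le> a * lam" | "a * lam < \<bar>t\<bar>" "lam < \<bar>t\<bar>" by linarith
  then show ?thesis
  proof cases
    case 1
    have "lam * \<bar>t\<bar> \<le> lam * lam" using 1 assms by (intro mult_left_mono) auto
    also have "\<dots> \<le> (a + 1) / 2 * (lam * lam)" using assms mult_right_mono[of 1 "(a + 1) / 2" "lam * lam"] by auto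
    finally show ?thesis using 1 unfolding scad_def by (simp add: power2_eq_square)
  next
    case 2
    \<comment> \<open>Divided by \<open>2 * (a - 1)\<close>, this square is exactly the gap between
      the plateau of the penalty and its middle branch.\<close>
    have "0 \<le> (\<bar>t\<bar> - a * lam)\<^sup>2" by simp
    then have "- (t\<^sup>2 - 2 * a * lam * \<bar>t\<bar> + lam\<^sup>2) \<le> (a + 1) * lam\<^sup>2 * (a - 1)"
      by (simp add: power2_eq_square algebra_simps)
    then show ?thesis using 2 assms unfolding scad_def by (simp add: field_simps)
  qed (use assms in \<open>auto simp: scad_def\<close>)
qed

text \<open>Comparing \<open>bh\<close> with \<open>\<beta>\<close> gives a crude bound on \<open>bh - \<beta>\<close>, which already puts the first \<open>k\<close>
  coordinates of \<open>bh\<close> into the flat part of the penalty. The penalties of \<open>bh\<close> and \<open>\<beta>\<close> then agree there,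
  and the same comparison gives \<open>s \<le> 2 * \<tau>\<close>, so that \<open>bh j\<close> lies in the linear part of the penalty.
  Finally \<open>bh\<close> is compared with \<open>bh(j := 0)\<close>.\<close>

lemma scad_zero_of_quadratic:
  fixes q :: "(nat \<Rightarrow> real) \<Rightarrow> (nat \<Rightarrow> real) \<Rightarrow> real" and L :: "(nat \<Rightarrow> real) \<Rightarrow> real"
  assumes q: "psd_form q"
    and L: "\<And>u w t. L (\<lambda>j. u j + t * w j) = L u + t * L w"
    and L_le: "\<And>u. \<bar>L u\<bar> \<le> \<tau> * sqrt (q u u)"
    and coercive: "\<And>u. \<kappa> * (\<Sum>j<p. (u j)\<^sup>2) \<le> q u u" and \<kappa>: "\<kappa> > 0"
    and diag: "\<And>j. j < p \<Longrightarrow> q (\<lambda>i. if i = j then 1 else 0) (\<lambda>i. if i = j then 1 else 0) \<le> R"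
    and min: "\<And>b. q (\<lambda>j. bh j - \<beta> j) (\<lambda>j. bh j - \<beta> j) - 2 * L (\<lambda>j. bh j - \<beta> j) + (\<Sum>j<p. scad a lam (bh j))
                \<le> q (\<lambda>j. b j - \<beta> j) (\<lambda>j. b j - \<beta> j) - 2 * L (\<lambda>j. b j - \<beta> j) + (\<Sum>j<p. scad a lam (b j))"
    and k: "k \<le> p" and \<beta>0: "\<And>j. k \<le> j \<Longrightarrow> j < p \<Longrightarrow> \<beta> j = 0" and \<beta>1: "\<And>j. j < k \<Longrightarrow> b0 \<le> \<bar>\<beta> j\<bar>"
    and a: "a > 2" and lam: "lam > 0" and \<tau>: "\<tau> \<ge> 0"
    and S1: "a * lam < b0" "4 * \<tau>\<^sup>2 + (a + 1) * real k * lam\<^sup>2 < \<kappa> * (b0 - a * lam)\<^sup>2"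
    and S2: "4 * \<tau>\<^sup>2 \<le> \<kappa> * lam\<^sup>2"
    and S3: "6 * \<tau> * sqrt R + 2 * \<tau> / sqrt \<kappa> * R < lam"
    and j: "k \<le> j" "j < p"
  shows "bh j = 0"
proof (rule ccontr)
  assume bhj: "bh j \<noteq> 0"
  define v where "v j = bh j - \<beta> j" for j
  define s where "s = sqrt (q v v)"
  have qv: "q v v = s\<^sup>2" "s \<ge> 0" unfolding s_def using psd_form_nonneg[OF q, of v] by auto
  have L0: "L (\<lambda>j. 0) = 0" using L[of "\<lambda>j. 0" 1 "\<lambda>j. 0"] by simp
  have q0: "q (\<lambda>j. 0) (\<lambda>j. 0) = 0" using psd_form_expand[OF q, of "\<lambda>j. 0" 1 "\<lambda>j. 0"] by simp
  have split: "(\<Sum>j<p. f j) = (\<Sum>j<k. f j) + (\<Sum>j=k..<p. f j)" for f :: "nat \<Rightarrow> real"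
    using k by (metis sum.atLeastLessThan_concat atLeast0LessThan zero_le)
  have scad0: "scad a lam 0 = 0" unfolding scad_def using lam by simp
  have comp: "\<kappa> * (v i)\<^sup>2 \<le> s\<^sup>2" if "i < p" for i
  proof -
    have "\<kappa> * (v i)\<^sup>2 \<le> \<kappa> * (\<Sum>j<p. (v j)\<^sup>2)"
      using that \<kappa> by (intro mult_left_mono member_le_sum) auto
    then show ?thesis using coercive[of v] qv by simp
  qed
  have base: "s\<^sup>2 - 2 * \<tau> * s + (\<Sum>j<p. scad a lam (bh j)) \<le> (\<Sum>j<p. scad a lam (\<beta> j))"
  proof -
    have "q v v - 2 * L v + (\<Sum>j<p. scad a lam (bh j)) \<le> (\<Sum>j<p. scad a lam (\<beta> j))"
      using min[of \<beta>] L0 q0 unfolding v_def by simp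
    moreover have "L v \<le> \<tau> * s" using L_le[of v] unfolding s_def by simp
    ultimately show ?thesis unfolding qv by linarith
  qed
  have pen\<beta>: "(\<Sum>j<p. scad a lam (\<beta> j)) = (\<Sum>j<k. scad a lam (\<beta> j))"
    unfolding split using \<beta>0 scad0 by simp
  have "(\<Sum>j<k. scad a lam (\<beta> j)) \<le> (\<Sum>j<k. (a + 1) * lam\<^sup>2 / 2)"
    by (intro sum_mono scad_le a lam)
  moreover have "0 \<le> (\<Sum>j<p. scad a lam (bh j))" by (intro sum_nonneg scad_nonneg a lam)
  ultimately have "s\<^sup>2 - 2 * \<tau> * s \<le> (a + 1) * real k * lam\<^sup>2 / 2"
    using base pen\<beta> by (simp add: algebra_simps)
  \<comment> \<open>The weights are chosen so that half of the square is absorbed on the left and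
    \<open>s\<^sup>2\<close> keeps the coefficient 1/2.\<close>
  moreover have "2 * \<tau> * s \<le> 2 * \<tau>\<^sup>2 + s\<^sup>2 / 2"
    using zero_le_power2[of "2 * \<tau> - s"] by (simp add: power2_eq_square algebra_simps)
  ultimately have s_le: "s\<^sup>2 \<le> 4 * \<tau>\<^sup>2 + (a + 1) * real k * lam\<^sup>2" by (simp add: field_simps)
  \<comment> \<open>\<open>S1(2)\<close> makes each of the first \<open>k\<close> errors shorter
    than \<open>b0 - a * lam\<close>, so \<open>\<bar>bh i\<bar>\<close> cannot fall from at least
    \<open>b0\<close> to the threshold \<open>a * lam\<close>.\<close>
  have large: "a * lam < \<bar>bh i\<bar>" if "i < k" for i
  proof -
    have "\<kappa> * (v i)\<^sup>2 < \<kappa> * (b0 - a * lam)\<^sup>2" using comp[of i] that k s_le S1(2) by linarith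
    then have "(v i)\<^sup>2 < (b0 - a * lam)\<^sup>2" using \<kappa> by simp
    then have "\<bar>v i\<bar> < \<bar>b0 - a * lam\<bar>" by (metis abs_le_square_iff not_less)
    then show ?thesis using \<beta>1[OF that] S1(1) unfolding v_def by linarith
  qed
  have lam_alam: "lam < a * lam" using a lam by simp
  have "scad a lam (bh i) = scad a lam (\<beta> i)" if "i < k" for i
  proof -
    have "a * lam < \<bar>\<beta> i\<bar>" using \<beta>1[OF that] S1(1) by linarith
    then show ?thesis using large[OF that] lam_alam unfolding scad_def by simp
  qed
  then have same: "(\<Sum>j<k. scad a lam (bh j)) = (\<Sum>j<k. scad a lam (\<beta> j))" by simp
  have "0 \<le> (\<Sum>j=k..<p. scad a lam (bh j))" by (intro sum_nonneg scad_nonneg a lam)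
  then have "s\<^sup>2 \<le> 2 * \<tau> * s" using base pen\<beta> same split[of "\<lambda>j. scad a lam (bh j)"] by simp
  then have s2: "s \<le> 2 * \<tau>" using qv(2) \<tau> by (cases "s = 0") (auto simp: power2_eq_square)
  have s22: "s\<^sup>2 \<le> 4 * \<tau>\<^sup>2" using power_mono[OF s2 qv(2), of 2] by (simp add: power_mult_distrib)
  have vj: "v j = bh j" unfolding v_def using \<beta>0[OF j] by simp
  have "\<kappa> * (bh j)\<^sup>2 \<le> \<kappa> * lam\<^sup>2" using comp[OF j(2)] s22 S2 vj by simp
  then have "(bh j)\<^sup>2 \<le> lam\<^sup>2" using \<kappa> by simp
  then have small: "\<bar>bh j\<bar> \<le> lam" using lam abs_le_square_iff[of "bh j" lam] by simp
  have bhj_le: "\<bar>bh j\<bar> \<le> 2 * \<tau> / sqrt \<kappa>"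
  proof -
    have "(bh j)\<^sup>2 \<le> (2 * \<tau> / sqrt \<kappa>)\<^sup>2"
      using comp[OF j(2)] s22 vj \<kappa> by (simp add: power_divide power_mult_distrib field_simps)
    then show ?thesis using \<tau> \<kappa> abs_le_square_iff[of "bh j" "2 * \<tau> / sqrt \<kappa>"] by simp
  qed
  define w where "w = (\<lambda>i. if i = j then 1 else 0 :: real)"
  define b where "b = bh(j := 0)"
  have bv: "(\<lambda>i. b i - \<beta> i) = (\<lambda>i. v i + (- bh j) * w i)"
    unfolding b_def v_def w_def using \<beta>0[OF j] by auto
  have penb: "(\<Sum>i<p. scad a lam (bh i)) = (\<Sum>i<p. scad a lam (b i)) + lam * \<bar>bh j\<bar>"
  proof -
    have "(\<Sum>i<p. scad a lam (bh i)) = scad a lam (bh j) + (\<Sum>i\<in>{..<p} - {j}. scad a lam (bh i))"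
      using j by (intro sum.remove) auto
    moreover have "(\<Sum>i<p. scad a lam (b i)) = scad a lam (b j) + (\<Sum>i\<in>{..<p} - {j}. scad a lam (b i))"
      using j by (intro sum.remove) auto
    moreover have "(\<Sum>i\<in>{..<p} - {j}. scad a lam (b i)) = (\<Sum>i\<in>{..<p} - {j}. scad a lam (bh i))"
      by (intro sum.cong) (auto simp: b_def)
    moreover have "scad a lam (b j) = 0" using scad0 by (simp add: b_def)
    moreover have "scad a lam (bh j) = lam * \<bar>bh j\<bar>" using small unfolding scad_def by simp
    ultimately show ?thesis by simp
  qed
  have qw: "0 \<le> q w w" "q w w \<le> R" using diag[OF j(2)] psd_form_nonneg[OF q, of w] unfolding w_def by auto
  have step: "q v v - 2 * L v + lam * \<bar>bh j\<bar> \<le> q v v + 2 * (- bh j) * q v w + (- bh j)\<^sup>2 * q w w - 2 * (L v + (- bh j) * L w)"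
    using min[of b] penb unfolding bv psd_form_expand[OF q] L v_def[symmetric] by simp
  have "lam * \<bar>bh j\<bar> \<le> 2 * (- bh j) * (q v w - L w) + (bh j)\<^sup>2 * q w w"
    using step by (simp add: algebra_simps)
  \<comment> \<open>\<open>q v w - L w\<close> is half the derivative of the unpenalized criterion
    in direction \<open>w\<close>. Cauchy-Schwarz with \<open>s \<le> 2 * \<tau>\<close> contributes
    two of the three multiples of \<open>\<tau> * sqrt R\<close>, the linear term the third.\<close>
  also have "2 * (- bh j) * (q v w - L w) \<le> 2 * \<bar>bh j\<bar> * (3 * \<tau> * sqrt R)"
  proof -
    have "\<bar>q v w\<bar> \<le> s * sqrt R"
      using psd_form_cauchy_schwarz[OF q, of v w] qw qv(2) unfolding s_def
      by (meson mult_left_mono order_trans real_sqrt_le_mono)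
    also have "\<dots> \<le> 2 * \<tau> * sqrt R" using s2 qw by (intro mult_right_mono) auto
    finally have "\<bar>q v w\<bar> \<le> 2 * \<tau> * sqrt R" .
    moreover have "\<bar>L w\<bar> \<le> \<tau> * sqrt R"
      using L_le[of w] qw \<tau> by (meson mult_left_mono order_trans real_sqrt_le_mono)
    ultimately have "\<bar>q v w - L w\<bar> \<le> 3 * \<tau> * sqrt R" by linarith
    then have "\<bar>bh j\<bar> * \<bar>q v w - L w\<bar> \<le> \<bar>bh j\<bar> * (3 * \<tau> * sqrt R)"
      by (rule mult_left_mono) simp
    moreover have "- bh j * (q v w - L w) \<le> \<bar>bh j\<bar> * \<bar>q v w - L w\<bar>"
      using abs_ge_self[of "- bh j * (q v w - L w)"] by (simp only: abs_mult abs_minus)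
    ultimately have "2 * (- bh j * (q v w - L w)) \<le> 2 * (\<bar>bh j\<bar> * (3 * \<tau> * sqrt R))" by linarith
    then show ?thesis by (simp only: mult.assoc)
  qed
  also have "(bh j)\<^sup>2 * q w w \<le> \<bar>bh j\<bar> * (2 * \<tau> / sqrt \<kappa> * R)"
  proof -
    have "(bh j)\<^sup>2 * q w w = \<bar>bh j\<bar> * (\<bar>bh j\<bar> * q w w)" by (simp add: power2_eq_square)
    also have "\<dots> \<le> \<bar>bh j\<bar> * (2 * \<tau> / sqrt \<kappa> * R)"
      using bhj_le qw \<tau> \<kappa> by (intro mult_left_mono mult_mono) auto
    finally show ?thesis .
  qed
  finally have "\<bar>bh j\<bar> * lam \<le> \<bar>bh j\<bar> * (6 * \<tau> * sqrt R + 2 * \<tau> / sqrt \<kappa> * R)"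
    by (simp add: algebra_simps)
  then have "lam \<le> 6 * \<tau> * sqrt R + 2 * \<tau> / sqrt \<kappa> * R" using bhj by simp
  with S3 show False by simp
qed


section \<open>Extreme eigenvalues of a symmetric matrix\<close>

text \<open>A closed subset of a product of copies of [-1,1] and {0}, which is compact by Tychonoff.
  The sphere of each dimension \<open>p\<close> thus lives in the one type
  \<open>nat \<Rightarrow> real\<close>.\<close>

lemma compact_unit_sphere_coordinates:
  "compact {u :: nat \<Rightarrow> real. (\<forall>i\<ge>p. u i = 0) \<and> (\<Sum>i<p. (u i)\<^sup>2) = 1}" (is "compact ?S")
proof -
  let ?B = "\<lambda>i. if i < p then {-1..1} else {0::real}"
  have "compactin (product_topology (\<lambda>i. euclidean) UNIV) (PiE UNIV ?B)"
    by (subst compactin_PiE) (auto simp: compactin_euclidean_iff)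
  then have comp: "compact (PiE UNIV ?B)"
    by (simp add: euclidean_product_topology compactin_euclidean_iff)
  have "closed {u :: nat \<Rightarrow> real. (\<Sum>i<p. (u i)\<^sup>2) = 1}"
    by (intro closed_Collect_eq continuous_intros) auto
  with comp have "compact (PiE UNIV ?B \<inter> {u. (\<Sum>i<p. (u i)\<^sup>2) = 1})" by (rule compact_Int_closed)
  also have "PiE UNIV ?B \<inter> {u. (\<Sum>i<p. (u i)\<^sup>2) = 1} = ?S"
  proof (intro equalityI subsetI)
    fix u :: "nat \<Rightarrow> real" assume u: "u \<in> ?S"
    have "\<bar>u i\<bar> \<le> 1" if "i < p" for i
    proof -
      have "(u i)\<^sup>2 \<le> (\<Sum>i<p. (u i)\<^sup>2)" using that by (intro member_le_sum) auto
      then show ?thesis using u by (simp add: abs_square_le_1)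
    qed
    then show "u \<in> PiE UNIV ?B \<inter> {u. (\<Sum>i<p. (u i)\<^sup>2) = 1}"
      using u by (auto simp: PiE_iff abs_le_iff not_less)
  qed (fastforce simp: PiE_iff split: if_splits)
  finally show ?thesis .
qed

definition quad_form :: "nat \<Rightarrow> (nat \<Rightarrow> nat \<Rightarrow> real) \<Rightarrow> (nat \<Rightarrow> real) \<Rightarrow> (nat \<Rightarrow> real) \<Rightarrow> real" where
  "quad_form p A u w = (\<Sum>i<p. \<Sum>j<p. u i * A i j * w j)"

text \<open>Let \<mu> be the minimum of the Rayleigh quotient, attained at \<open>v\<close>. The
  form of A - \<mu> I is positive semidefinite and vanishes at \<open>v\<close>, so by
  Cauchy-Schwarz it vanishes against \<open>v\<close> in every direction; testing with unit vectors
  gives A v = \<mu> v.\<close>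

lemma eigenvalue_of_minimal_rayleigh:
  assumes sym: "\<And>i j. i < p \<Longrightarrow> j < p \<Longrightarrow> A i j = A j i" and p: "p \<ge> 1"
  obtains \<mu> where "eigenvalue (Matrix.mat p p (\<lambda>(i, j). A i j)) \<mu>"
    "\<And>u. \<mu> * (\<Sum>j<p. (u j)\<^sup>2) \<le> quad_form p A u u"
proof -
  define S where "S = {u :: nat \<Rightarrow> real. (\<forall>i\<ge>p. u i = 0) \<and> (\<Sum>i<p. (u i)\<^sup>2) = 1}"
  have "(\<lambda>i. if i = 0 then 1 else 0) \<in> S" using p by (simp add: S_def if_distrib[of "\<lambda>x. x\<^sup>2"] cong: if_cong)
  then have "S \<noteq> {}" by blast
  moreover have "continuous_on S (\<lambda>u. quad_form p A u u)" unfolding quad_form_def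
    by (intro continuous_intros continuous_on_subset[OF continuous_on_product_coordinates]) auto
  ultimately obtain v where v: "v \<in> S" and min: "\<And>u. u \<in> S \<Longrightarrow> quad_form p A v v \<le> quad_form p A u u"
    using continuous_attains_inf[of S "\<lambda>u. quad_form p A u u"] compact_unit_sphere_coordinates[of p]
    unfolding S_def by blast
  define \<mu> where "\<mu> = quad_form p A v v"
  have le: "\<mu> * (\<Sum>j<p. (u j)\<^sup>2) \<le> quad_form p A u u" for u
  proof (cases "(\<Sum>j<p. (u j)\<^sup>2) = 0")
    case True
    then have "u j = 0" if "j < p" for j
      using that by (subst (asm) sum_nonneg_eq_0_iff) auto
    then show ?thesis using True by (simp add: quad_form_def)
  next
    case False
    define s where "s = (\<Sum>j<p. (u j)\<^sup>2)"
    have s: "s > 0" unfolding s_def using False by (simp add: less_le sum_nonneg)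
    define u' where "u' i = (if i < p then u i / sqrt s else 0)" for i
    have "(\<Sum>i<p. (u' i)\<^sup>2) = (\<Sum>i<p. (u i)\<^sup>2 / s)"
      using s by (intro sum.cong) (auto simp: u'_def power_divide)
    also have "\<dots> = 1" using s by (simp add: s_def flip: sum_divide_distrib)
    finally have "u' \<in> S" unfolding S_def u'_def by auto
    then have "\<mu> \<le> quad_form p A u' u'" unfolding \<mu>_def by (rule min)
    also have "\<dots> = (\<Sum>i<p. \<Sum>j<p. u i * A i j * u j / s)"
      unfolding quad_form_def using s by (intro sum.cong refl) (auto simp: u'_def field_simps)
    also have "\<dots> = quad_form p A u u / s" by (simp add: quad_form_def flip: sum_divide_distrib)
    finally show ?thesis using s by (simp add: s_def[symmetric] field_simps)
  qed
  define q where "q u w = quad_form p A u w - \<mu> * (\<Sum>j<p. u j * w j)" for u w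
  have psd: "psd_form q"
    unfolding psd_form_def
  proof (intro conjI allI)
    fix u w :: "nat \<Rightarrow> real"
    have "quad_form p A u w = (\<Sum>j<p. \<Sum>i<p. u i * A i j * w j)"
      unfolding quad_form_def by (rule sum.swap)
    also have "\<dots> = quad_form p A w u" unfolding quad_form_def
      using sym by (intro sum.cong refl) auto
    finally show "q u w = q w u" unfolding q_def by (simp add: mult.commute)
    show "0 \<le> q u u" unfolding q_def using le[of u] by (simp add: power2_eq_square)
  qed (simp add: q_def quad_form_def algebra_simps sum.distrib sum_distrib_left)
  have "q v v = 0" using v unfolding q_def \<mu>_def S_def by (simp add: power2_eq_square)
  then have qv: "q v w = 0" for w using psd_form_cauchy_schwarz[OF psd, of v w] by simp
  have eq: "(\<Sum>j<p. A i j * v j) = \<mu> * v i" if i: "i < p" for i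
  proof -
    let ?w = "\<lambda>j. if j = i then 1 else 0 :: real"
    have "q ?w v = 0" using qv psd unfolding psd_form_def by metis
    moreover have "quad_form p A ?w v = (\<Sum>i'<p. if i' = i then (\<Sum>j<p. A i j * v j) else 0)"
      unfolding quad_form_def by (intro sum.cong refl) auto
    moreover have "(\<Sum>j<p. ?w j * v j) = (\<Sum>j<p. if j = i then v i else 0)"
      by (intro sum.cong refl) auto
    ultimately show ?thesis using i unfolding q_def by simp
  qed
  let ?M = "Matrix.mat p p (\<lambda>(i, j). A i j)"
  have "eigenvector ?M (Matrix.vec p v) \<mu>"
    unfolding eigenvector_def
  proof (intro conjI)
    show "Matrix.vec p v \<noteq> 0\<^sub>v (dim_row ?M)"
    proof
      assume 0: "Matrix.vec p v = 0\<^sub>v (dim_row ?M)"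
      have "v i = 0" if "i < p" for i
        using arg_cong[OF 0, of "\<lambda>x. vec_index x i"] that by simp
      then show False using v unfolding S_def by simp
    qed
    show "?M *\<^sub>v Matrix.vec p v = \<mu> \<cdot>\<^sub>v Matrix.vec p v"
      by (intro eq_vecI) (auto simp: scalar_prod_def eq atLeast0LessThan)
  qed simp
  then have "eigenvalue ?M \<mu>" unfolding eigenvalue_def by blast
  with le that show ?thesis by blast
qed

text \<open>The smallest Rayleigh quotient belongs to the spectrum, so it lies between the two
  extreme eigenvalues. The first part makes the eigenvalue condition a coercivity bound; the second
  carries a lower bound over to the largest eigenvalue, in which the conditions on
  \<open>lam\<close> are expressed.\<close>

lemma min_eigenvalue_le_quad_form:
  assumes "\<And>i j. i < p \<Longrightarrow> j < p \<Longrightarrow> A i j = A j i" "p \<ge> 1"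
  shows "min_eigenvalue (Matrix.mat p p (\<lambda>(i, j). A i j)) * (\<Sum>j<p. (u j)\<^sup>2) \<le> quad_form p A u u"
    and "min_eigenvalue (Matrix.mat p p (\<lambda>(i, j). A i j)) \<le> max_eigenvalue (Matrix.mat p p (\<lambda>(i, j). A i j))"
proof -
  let ?M = "Matrix.mat p p (\<lambda>(i, j). A i j)"
  obtain \<mu> where \<mu>: "eigenvalue ?M \<mu>" "\<And>u. \<mu> * (\<Sum>j<p. (u j)\<^sup>2) \<le> quad_form p A u u"
    by (rule eigenvalue_of_minimal_rayleigh[OF assms]) blast+
  have fin: "finite (spectrum ?M)" by (rule card_finite_spectrum[of _ p]) simp
  have mem: "\<mu> \<in> spectrum ?M" using \<mu>(1) unfolding spectrum_def by simp
  have le: "min_eigenvalue ?M \<le> \<mu>" unfolding min_eigenvalue_def by (rule Min_le[OF fin mem])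
  then have "min_eigenvalue ?M * (\<Sum>j<p. (u j)\<^sup>2) \<le> \<mu> * (\<Sum>j<p. (u j)\<^sup>2)"
    by (intro mult_right_mono sum_nonneg) auto
  then show "min_eigenvalue ?M * (\<Sum>j<p. (u j)\<^sup>2) \<le> quad_form p A u u" using \<mu>(2)[of u] by linarith
  have "\<mu> \<le> max_eigenvalue ?M" unfolding max_eigenvalue_def by (rule Max_ge[OF fin mem])
  with le show "min_eigenvalue ?M \<le> max_eigenvalue ?M" by linarith
qed


section \<open>The estimator on a good event\<close>

lemma psd_form_diff_le:
  assumes "psd_form q"
  shows "q (\<lambda>i. u i - w i) (\<lambda>i. u i - w i) \<le> 2 * q u u + 2 * q w w"
  using psd_form_expand[OF assms, of u 1 w] psd_form_expand[OF assms, of u "-1" w]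
    psd_form_nonneg[OF assms, of "\<lambda>i. u i + 1 * w i"] by simp

lemma proj_form_cong:
  "(\<And>i. i < n \<Longrightarrow> u i = u' i) \<Longrightarrow> (\<And>i. i < n \<Longrightarrow> v i = v' i) \<Longrightarrow> proj_form n e q u v = proj_form n e q u' v'"
  unfolding proj_form_def
  by (intro arg_cong2[of _ _ _ _ "(-)"] sum.cong refl arg_cong2[of _ _ _ _ "(*)"] ip_cong) auto

lemma in_span_lincomb:
  assumes "in_span n e r u" "in_span n e r w"
  shows "in_span n e r (\<lambda>i. a * u i + b * w i)"
  using in_span_sum[of "UNIV :: bool set" n e r "\<lambda>x. if x then u else w" "\<lambda>x. if x then a else b"] assms
  by (simp add: UNIV_bool add.commute)

lemma in_span_self: "l < r \<Longrightarrow> in_span n z r (z l)"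
  unfolding in_span_def
  by (intro exI[of _ "\<lambda>k. if k = l then 1 else 0"]) (simp add: if_distrib[of "\<lambda>x. x * _"] cong: if_cong)

lemma orthonormalize_in_span:
  assumes "l < r"
  shows "in_span n z r (orthonormalize n z l)"
  using assms
proof (induction l rule: less_induct)
  case (less l)
  let ?e = "orthonormalize n z"
  define v where "v = (\<lambda>i. z l i - (\<Sum>k<l. ip n (?e k) (z l) * ?e k i))"
  have "in_span n z r (\<lambda>i. \<Sum>k<l. ip n (?e k) (z l) * ?e k i)"
    using less by (intro in_span_sum) auto
  from in_span_lincomb[OF in_span_self[OF less.prems] this,
      where a = "1 / sqrt (ip n v v)" and b = "- 1 / sqrt (ip n v v)"]
  have "in_span n z r (\<lambda>i. v i / sqrt (ip n v v))" by (simp add: v_def diff_divide_distrib)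
  then show ?case by (subst orthonormalize.simps) (simp add: v_def Let_def)
qed

lemma in_span_trans:
  assumes "in_span n e r w" "\<And>k. k < r \<Longrightarrow> in_span n z r (e k)"
  shows "in_span n z r w"
proof -
  obtain c where c: "\<And>i. i < n \<Longrightarrow> w i = (\<Sum>k<r. c k * e k i)" using assms(1) unfolding in_span_def by auto
  have "in_span n z r (\<lambda>i. \<Sum>k<r. c k * e k i)" using assms(2) by (intro in_span_sum) auto
  then show ?thesis using c unfolding in_span_def by simp
qed

lemma in_span_orthonormalize_iff:
  "in_span n (orthonormalize n z) r w \<longleftrightarrow> in_span n z r w"
  using in_span_trans[of n "orthonormalize n z" r w z] in_span_trans[of n z r w "orthonormalize n z"]
    orthonormalize_in_span in_span_orthonormalize by blast

lemma ip_orthogonal_span: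
  assumes "orthonormal_or_zero n e" "in_span n e q w" "q \<le> l"
  shows "ip n (e l) w = 0"
proof -
  have "ip n w (e l) = (\<Sum>k<q. ip n (e k) w * ip n (e k) (e l))" by (rule parseval[OF assms(1,2)])
  also have "\<dots> = 0" using assms(1,3) unfolding orthonormal_or_zero_def by (intro sum.neutral) auto
  finally show ?thesis by (simp add: ip_commute)
qed

text \<open>By Parseval a vector in the span of \<open>q + p\<close> basis vectors tests
  \<open>h\<close> only against these, and the projection deletes the first \<open>q\<close>. So
  \<open>p\<close> components of the noise matter instead of \<open>n\<close>.\<close>

lemma proj_form_le_components:
  assumes "orthonormal_or_zero n e" "in_span n e (q + p) w"
  shows "\<bar>proj_form n e q h w\<bar> \<le> sqrt (\<Sum>l=q..<q+p. (ip n (e l) h)\<^sup>2) * sqrt (proj_form n e q w w)"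
proof -
  have split: "(\<Sum>l<q+p. f l) = (\<Sum>l<q. f l) + (\<Sum>l=q..<q+p. f l)" for f :: "nat \<Rightarrow> real"
    by (metis atLeast0LessThan le_add1 sum.atLeastLessThan_concat zero_le)
  have "proj_form n e q v w = (\<Sum>l=q..<q+p. ip n (e l) v * ip n (e l) w)" for v
    using parseval[OF assms, of v] ip_commute[of n w v] unfolding proj_form_def split
    by (simp add: mult.commute)
  then have eq: "proj_form n e q h w = (\<Sum>l=q..<q+p. ip n (e l) h * ip n (e l) w)"
    and eq': "proj_form n e q w w = (\<Sum>l=q..<q+p. (ip n (e l) w)\<^sup>2)" by (simp_all add: power2_eq_square)
  have "(proj_form n e q h w)\<^sup>2 \<le> (\<Sum>l=q..<q+p. (ip n (e l) h)\<^sup>2) * proj_form n e q w w"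
    unfolding eq eq' by (rule Cauchy_Schwarz_ineq_sum)
  then have "sqrt ((proj_form n e q h w)\<^sup>2) \<le> sqrt ((\<Sum>l=q..<q+p. (ip n (e l) h)\<^sup>2) * proj_form n e q w w)"
    by (rule real_sqrt_le_mono)
  then show ?thesis by (simp add: real_sqrt_mult)
qed

lemma sum_power2_add_le:
  fixes f g :: "'a \<Rightarrow> real"
  shows "(\<Sum>l\<in>I. (f l + g l)\<^sup>2) \<le> 2 * (\<Sum>l\<in>I. (f l)\<^sup>2) + 2 * (\<Sum>l\<in>I. (g l)\<^sup>2)"
proof -
  have "(f l + g l)\<^sup>2 \<le> 2 * (f l)\<^sup>2 + 2 * (g l)\<^sup>2" for l
    using zero_le_power2[of "f l - g l"] by (simp add: power2_eq_square algebra_simps)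
  then show ?thesis unfolding sum_distrib_left sum.distrib[symmetric] by (intro sum_mono) auto
qed

text \<open>The basis vectors from \<open>q\<close> on are orthogonal to the splines, so
  \<open>g\<close> may be replaced by \<open>g - s\<close>; Bessel's inequality then bounds all its
  components together, without a factor \<open>p\<close>.\<close>

lemma components_spline_plus_noise_le:
  assumes ortho: "orthonormal_or_zero n e" and s: "in_span n e q s"
    and g: "\<And>i. i < n \<Longrightarrow> \<bar>g i - s i\<bar> \<le> d"
  shows "(\<Sum>l=q..<q+p. (ip n (e l) (\<lambda>i. g i + \<epsilon> i))\<^sup>2)
    \<le> 2 * (real n * d\<^sup>2) + 2 * (\<Sum>l=q..<q+p. (ip n (e l) \<epsilon>)\<^sup>2)"
proof -
  have add: "ip n u (\<lambda>i. v i + w i) = ip n u v + ip n u w" for u v w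
    by (simp add: ip_def distrib_left sum.distrib)
  have "ip n (e l) g = ip n (e l) (\<lambda>i. g i - s i)" if "q \<le> l" for l
    using add[of "e l" "\<lambda>i. g i - s i" s] ip_orthogonal_span[OF ortho s that] by simp
  then have "(\<Sum>l=q..<q+p. (ip n (e l) g)\<^sup>2) = (\<Sum>l=q..<q+p. (ip n (e l) (\<lambda>i. g i - s i))\<^sup>2)"
    by (intro sum.cong) auto
  also have "\<dots> \<le> (\<Sum>l<q+p. (ip n (e l) (\<lambda>i. g i - s i))\<^sup>2)" by (intro sum_mono2) auto
  also have "\<dots> \<le> ip n (\<lambda>i. g i - s i) (\<lambda>i. g i - s i)" by (rule bessel[OF ortho])
  also have "\<dots> \<le> real n * d\<^sup>2" by (rule ip_self_le) (use g in auto)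
  finally show ?thesis
    using sum_power2_add_le[of "\<lambda>l. ip n (e l) g" "\<lambda>l. ip n (e l) \<epsilon>" "{q..<q+p}"] unfolding add by linarith
qed

text \<open>After subtracting splines, Cauchy-Schwarz over the \<open>p\<close> summands at each
  observation produces the factor \<open>real p * d\<^sup>2\<close>, which must be small against the
  smallest eigenvalue.\<close>

lemma proj_form_smooth_le:
  assumes ortho: "orthonormal_or_zero n e" and s: "\<And>j. j < p \<Longrightarrow> in_span n e q (s j)"
    and th: "\<And>i j. i < n \<Longrightarrow> j < p \<Longrightarrow> \<bar>th i j - s j i\<bar> \<le> d"
  shows "proj_form n e q (\<lambda>i. \<Sum>j<p. u j * th i j) (\<lambda>i. \<Sum>j<p. u j * th i j) \<le> real n * (real p * d\<^sup>2 * (\<Sum>j<p. (u j)\<^sup>2))"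
proof -
  let ?\<theta> = "\<lambda>i. \<Sum>j<p. u j * th i j" and ?s = "\<lambda>i. \<Sum>j<p. u j * s j i"
  have "in_span n e q ?s" using s by (intro in_span_sum) auto
  then have "proj_form n e q ?\<theta> ?\<theta> = proj_form n e q (\<lambda>i. ?\<theta> i - ?s i) (\<lambda>i. ?\<theta> i - ?s i)"
    by (rule proj_form_sub_span[OF ortho, symmetric])
  also have "\<dots> \<le> ip n (\<lambda>i. ?\<theta> i - ?s i) (\<lambda>i. ?\<theta> i - ?s i)" by (rule proj_form_le_ip)
  also have "\<dots> \<le> (\<Sum>i<n. real p * d\<^sup>2 * (\<Sum>j<p. (u j)\<^sup>2))"
    unfolding ip_def
  proof (intro sum_mono)
    fix i assume i: "i \<in> {..<n}"
    have "?\<theta> i - ?s i = (\<Sum>j<p. u j * (th i j - s j i))" by (simp add: right_diff_distrib sum_subtractf)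
    then have "(?\<theta> i - ?s i) * (?\<theta> i - ?s i) \<le> (\<Sum>j<p. (u j)\<^sup>2) * (\<Sum>j<p. (th i j - s j i)\<^sup>2)"
      using Cauchy_Schwarz_ineq_sum[of u "\<lambda>j. th i j - s j i" "{..<p}"] by (simp add: power2_eq_square)
    also have "\<dots> \<le> (\<Sum>j<p. (u j)\<^sup>2) * (\<Sum>j<p. d\<^sup>2)"
    proof (intro mult_left_mono sum_mono)
      fix j assume "j \<in> {..<p}"
      then have "\<bar>th i j - s j i\<bar>\<^sup>2 \<le> d\<^sup>2" using th[of i j] i by (intro power_mono) auto
      then show "(th i j - s j i)\<^sup>2 \<le> d\<^sup>2" by simp
    qed (simp add: sum_nonneg)
    finally show "(?\<theta> i - ?s i) * (?\<theta> i - ?s i) \<le> real p * d\<^sup>2 * (\<Sum>j<p. (u j)\<^sup>2)"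
      by (simp add: mult_ac)
  qed
  finally show ?thesis by simp
qed

text \<open>Of the coercivity constant \<open>c\<close>, one quarter is spent on the deviation of
  the empirical covariance from \<Xi> and one quarter on the part removed by projecting out the
  splines; \<open>c / 2\<close> remains.\<close>

lemma proj_form_residual_ge:
  assumes W: "(\<Sum>l<q. \<Sum>j<p. (ip n (e l) (\<lambda>i. E i j))\<^sup>2) \<le> real n * (c / 4)"
    and D: "(\<Sum>j<p. \<Sum>l<p. ((\<Sum>i<n. E i j * E i l) / real n - \<Xi> j l)\<^sup>2) \<le> (c / 4)\<^sup>2"
    and \<Xi>: "c * (\<Sum>j<p. (u j)\<^sup>2) \<le> quad_form p \<Xi> u u" and n: "n \<ge> 1" and c: "c > 0"
  shows "real n * (c / 2 * (\<Sum>j<p. (u j)\<^sup>2)) \<le> proj_form n e q (\<lambda>i. \<Sum>j<p. u j * E i j) (\<lambda>i. \<Sum>j<p. u j * E i j)"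
proof -
  define U where "U = (\<Sum>j<p. (u j)\<^sup>2)"
  have U: "U \<ge> 0" unfolding U_def by (intro sum_nonneg) auto
  let ?E = "\<lambda>i. \<Sum>j<p. u j * E i j"
  define d where "d j l = (\<Sum>i<n. E i j * E i l) / real n - \<Xi> j l" for j l
  have "(\<Sum>l<q. ip n (e l) ?E * ip n (e l) ?E) \<le> (\<Sum>l<q. U * (\<Sum>j<p. (ip n (e l) (\<lambda>i. E i j))\<^sup>2))"
  proof (intro sum_mono)
    fix l
    have "ip n (e l) ?E = (\<Sum>j<p. u j * ip n (e l) (\<lambda>i. E i j))"
      using ip_sum_left[of "{..<p}" n u "\<lambda>j i. E i j" "e l"] by (simp add: ip_commute)
    then show "ip n (e l) ?E * ip n (e l) ?E \<le> U * (\<Sum>j<p. (ip n (e l) (\<lambda>i. E i j))\<^sup>2)"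
      using Cauchy_Schwarz_ineq_sum[of u "\<lambda>j. ip n (e l) (\<lambda>i. E i j)" "{..<p}"]
      unfolding U_def by (simp add: power2_eq_square)
  qed
  also have "\<dots> \<le> U * (real n * (c / 4))" unfolding sum_distrib_left[symmetric] by (intro mult_left_mono W U)
  finally have W': "(\<Sum>l<q. ip n (e l) ?E * ip n (e l) ?E) \<le> U * (real n * (c / 4))" .
  have "ip n ?E ?E = (\<Sum>i<n. \<Sum>j<p. \<Sum>l<p. u j * u l * (E i j * E i l))"
    unfolding ip_def sum_product by (simp add: mult_ac)
  also have "\<dots> = (\<Sum>j<p. \<Sum>i<n. \<Sum>l<p. u j * u l * (E i j * E i l))" by (rule sum.swap)
  also have "\<dots> = (\<Sum>j<p. \<Sum>l<p. \<Sum>i<n. u j * u l * (E i j * E i l))"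
    by (intro sum.cong refl sum.swap)
  also have "\<dots> = (\<Sum>j<p. \<Sum>l<p. real n * (u j * \<Xi> j l * u l + u j * u l * d j l))"
    using n by (intro sum.cong refl) (simp add: d_def field_simps flip: sum_distrib_left)
  also have "\<dots> = real n * (quad_form p \<Xi> u u + (\<Sum>j<p. \<Sum>l<p. u j * u l * d j l))"
    by (simp add: quad_form_def sum.distrib flip: sum_distrib_left)
  finally have EE: "ip n ?E ?E = real n * (quad_form p \<Xi> u u + (\<Sum>j<p. \<Sum>l<p. u j * u l * d j l))" .
  \<comment> \<open>Cauchy-Schwarz over pairs of indices: the form of \<open>d\<close> is at most
    its Frobenius norm times \<open>U\<close>. The Frobenius norm is used because its second moment
    is a plain sum over entries.\<close>
  have "(\<Sum>j<p. \<Sum>l<p. u j * u l * d j l)\<^sup>2 = (\<Sum>(j,l)\<in>{..<p}\<times>{..<p}. u j * u l * d j l)\<^sup>2"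
    by (simp add: sum.cartesian_product)
  also have "\<dots> \<le> (\<Sum>(j,l)\<in>{..<p}\<times>{..<p}. (u j * u l)\<^sup>2) * (\<Sum>(j,l)\<in>{..<p}\<times>{..<p}. (d j l)\<^sup>2)"
    using Cauchy_Schwarz_ineq_sum[of "\<lambda>x. u (fst x) * u (snd x)" "\<lambda>x. d (fst x) (snd x)" "{..<p}\<times>{..<p}"]
    by (simp add: case_prod_unfold)
  also have "(\<Sum>(j,l)\<in>{..<p}\<times>{..<p}. (u j * u l)\<^sup>2) = U\<^sup>2"
    by (simp add: U_def power2_eq_square[of "sum _ _"] sum_product sum.cartesian_product power_mult_distrib)
  also have "(\<Sum>(j,l)\<in>{..<p}\<times>{..<p}. (d j l)\<^sup>2) = (\<Sum>j<p. \<Sum>l<p. (d j l)\<^sup>2)"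
    by (simp add: sum.cartesian_product)
  also have "U\<^sup>2 * (\<Sum>j<p. \<Sum>l<p. (d j l)\<^sup>2) \<le> U\<^sup>2 * (c / 4)\<^sup>2"
    using D unfolding d_def by (intro mult_left_mono) auto
  finally have "(\<Sum>j<p. \<Sum>l<p. u j * u l * d j l)\<^sup>2 \<le> (U * (c / 4))\<^sup>2" by (simp only: power_mult_distrib)
  then have "\<bar>\<Sum>j<p. \<Sum>l<p. u j * u l * d j l\<bar> \<le> U * (c / 4)"
    using U c abs_le_square_iff[of "\<Sum>j<p. \<Sum>l<p. u j * u l * d j l" "U * (c / 4)"] by simp
  then have "c * U - U * (c / 4) \<le> quad_form p \<Xi> u u + (\<Sum>j<p. \<Sum>l<p. u j * u l * d j l)"
    using \<Xi> unfolding U_def[symmetric] by linarith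
  then have "real n * (c * U - U * (c / 4)) \<le> ip n ?E ?E" unfolding EE by (intro mult_left_mono) auto
  then have "real n * (c * U - U * (c / 4)) - U * (real n * (c / 4)) \<le> proj_form n e q ?E ?E"
    using W' unfolding proj_form_def by linarith
  then show ?thesis by (simp add: U_def[symmetric] algebra_simps)
qed

text \<open>Profiling out the spline coefficients: \<open>ch\<close> cannot beat the projection for
  \<open>bh\<close>, while for \<open>b\<close> the coefficients of the projection are admissible
  competitors. Only the span of the spline columns enters, so they may be linearly dependent on the
  sample.\<close>

lemma scad_minimizer_projected:
  fixes x z :: "nat \<Rightarrow> nat \<Rightarrow> real"
  assumes min: "scad_minimizer a lam n p q x z y bh ch"
    and ortho: "orthonormal_or_zero n e" and span: "\<And>w. in_span n e q w \<longleftrightarrow> in_span n (\<lambda>l i. z i l) q w"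
  defines "r \<equiv> \<lambda>b i. y i - (\<Sum>j<p. x i j * b j)"
  shows "proj_form n e q (r bh) (r bh) + real n * (\<Sum>j<p. scad a lam (bh j))
    \<le> proj_form n e q (r b) (r b) + real n * (\<Sum>j<p. scad a lam (b j))"
proof -
  have obj: "scad_objective a lam n p q x z y b c
      = ip n (\<lambda>i. r b i - (\<Sum>l<q. c l * z i l)) (\<lambda>i. r b i - (\<Sum>l<q. c l * z i l)) + real n * (\<Sum>j<p. scad a lam (b j))" for b c
    unfolding scad_objective_def ip_def r_def by (simp add: power2_eq_square mult.commute)
  let ?s = "\<lambda>i. \<Sum>k<q. ip n (e k) (r b) * e k i"
  have "in_span n e q ?s" unfolding in_span_def by (intro exI[of _ "\<lambda>k. ip n (e k) (r b)"]) simp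
  then obtain c where c: "\<And>i. i < n \<Longrightarrow> ?s i = (\<Sum>l<q. c l * z i l)"
    unfolding span unfolding in_span_def by auto
  have "in_span n e q (\<lambda>i. \<Sum>l<q. ch l * z i l)"
    unfolding span unfolding in_span_def by (intro exI[of _ ch]) simp
  then have "proj_form n e q (r bh) (r bh) = proj_form n e q (\<lambda>i. r bh i - (\<Sum>l<q. ch l * z i l)) (\<lambda>i. r bh i - (\<Sum>l<q. ch l * z i l))"
    by (rule proj_form_sub_span[OF ortho, symmetric])
  also have "\<dots> \<le> ip n (\<lambda>i. r bh i - (\<Sum>l<q. ch l * z i l)) (\<lambda>i. r bh i - (\<Sum>l<q. ch l * z i l))"
    by (rule proj_form_le_ip)
  finally have "proj_form n e q (r bh) (r bh) + real n * (\<Sum>j<p. scad a lam (bh j)) \<le> scad_objective a lam n p q x z y bh ch"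
    unfolding obj by simp
  also have "\<dots> \<le> scad_objective a lam n p q x z y b c" using min unfolding scad_minimizer_def by blast
  also have "\<dots> = ip n (\<lambda>i. r b i - ?s i) (\<lambda>i. r b i - ?s i) + real n * (\<Sum>j<p. scad a lam (b j))"
    unfolding obj using c by (intro arg_cong2[of _ _ _ _ "(+)"] ip_cong) auto
  also have "ip n (\<lambda>i. r b i - ?s i) (\<lambda>i. r b i - ?s i) = proj_form n e q (r b) (r b)"
    by (rule proj_form_residual[OF ortho])
  finally show ?thesis .
qed

text \<open>Indexed by column first, unlike the design matrices, to match
  \<open>orthonormalize\<close>. The order of the two blocks is essential: splines before
  covariates.\<close>

definition design_columns :: "nat \<Rightarrow> (nat \<Rightarrow> nat \<Rightarrow> real) \<Rightarrow> (nat \<Rightarrow> nat \<Rightarrow> real) \<Rightarrow> nat \<Rightarrow> nat \<Rightarrow> real" where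
  "design_columns q z x = (\<lambda>l i. if l < q then z i l else x i (l - q))"

text \<open>The deterministic core: the chance events enter as \<open>W\<close>, \<open>D\<close>,
  \<open>V\<close> and the bound on \<open>E\<close>. After division by \<open>n\<close>, coercivity
  has constant \<open>c / 8\<close>, from \<open>c / 2\<close> for the residuals, halved when the
  smooth part is split off, less \<open>c / 8\<close> for that part. The diagonal is at most
  \<open>2 * R\<^sup>2 + 2\<close> because \<open>d \<le> 1\<close>. The linear term has size
  \<open>2 * \<eta> * lam\<close>: bias and noise each contribute
  \<open>2 * n * (\<eta> * lam)\<^sup>2\<close> to its square.\<close>

lemma scad_estimator_zero:
  fixes x z E th :: "nat \<Rightarrow> nat \<Rightarrow> real" and n p q k :: nat and a lam c d \<eta> R :: real
  defines "e \<equiv> orthonormalize n (design_columns q z x)"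
  assumes n: "n \<ge> 1" and k: "k \<le> p" and a: "a > 2" and lam: "lam > 0" and c: "c > 0" and \<eta>: "\<eta> > 0"
    and y: "\<And>i. i < n \<Longrightarrow> y i = (\<Sum>j<p. x i j * \<beta> j) + g i + \<epsilon> i"
    and min: "scad_minimizer a lam n p q x z y bh ch"
    and x: "\<And>i j. i < n \<Longrightarrow> j < p \<Longrightarrow> x i j = th i j + E i j"
    and th: "\<And>j. j < p \<Longrightarrow> \<exists>b. \<forall>i<n. \<bar>th i j - (\<Sum>l<q. b l * z i l)\<bar> \<le> d"
    and g: "\<exists>b. \<forall>i<n. \<bar>g i - (\<Sum>l<q. b l * z i l)\<bar> \<le> \<eta> * lam"
    and E: "\<And>i j. i < n \<Longrightarrow> j < p \<Longrightarrow> \<bar>E i j\<bar> \<le> R"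
    and W: "(\<Sum>l<q. \<Sum>j<p. (ip n (e l) (\<lambda>i. E i j))\<^sup>2) \<le> real n * (c / 4)"
    and D: "(\<Sum>j<p. \<Sum>l<p. ((\<Sum>i<n. E i j * E i l) / real n - \<Xi> j l)\<^sup>2) \<le> (c / 4)\<^sup>2"
    and \<Xi>: "\<And>u. c * (\<Sum>j<p. (u j)\<^sup>2) \<le> quad_form p \<Xi> u u"
    and V: "(\<Sum>l=q..<q+p. (ip n (e l) \<epsilon>)\<^sup>2) \<le> real n * (\<eta> * lam)\<^sup>2"
    and d: "0 \<le> d" "d \<le> 1" "real p * d\<^sup>2 \<le> c / 8"
    and \<beta>0: "\<And>j. k \<le> j \<Longrightarrow> j < p \<Longrightarrow> \<beta> j = 0" and \<beta>1: "\<And>j. j < k \<Longrightarrow> b0 \<le> \<bar>\<beta> j\<bar>"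
    and S1: "a * lam < b0" "16 * \<eta>\<^sup>2 * lam\<^sup>2 + (a + 1) * real k * lam\<^sup>2 < c / 8 * (b0 - a * lam)\<^sup>2"
    and S2: "16 * \<eta>\<^sup>2 \<le> c / 8"
    and S3: "12 * \<eta> * sqrt (2 * R\<^sup>2 + 2) + 4 * \<eta> / sqrt (c / 8) * (2 * R\<^sup>2 + 2) < 1"
    and j: "k \<le> j" "j < p"
  shows "bh j = 0"
proof -
  have ortho: "orthonormal_or_zero n e" unfolding e_def by (rule orthonormal_or_zero_orthonormalize)
  have span: "in_span n e q w \<longleftrightarrow> in_span n (\<lambda>l i. z i l) q w" for w
    unfolding e_def in_span_orthonormalize_iff unfolding in_span_def design_columns_def by simp
  define Q where "Q = proj_form n e q"
  have Q: "psd_form Q" unfolding Q_def by (rule psd_form_proj[OF ortho])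
  have Qsym: "Q u v = Q v u" and Qlin: "Q (\<lambda>i. u i + t * w i) v = Q u v + t * Q w v" for u v w t
    using Q unfolding psd_form_def by blast+
  define X where "X u i = (\<Sum>j<p. u j * x i j)" for u i
  have X_lin: "X (\<lambda>j. u j + t * w j) = (\<lambda>i. X u i + t * X w i)" for u w t
    unfolding X_def by (auto simp: distrib_right sum.distrib sum_distrib_left mult.assoc)
  define h where "h i = g i + \<epsilon> i" for i
  define qn where "qn u w = Q (X u) (X w) / real n" for u w
  define L where "L u = Q h (X u) / real n" for u
  have psd: "psd_form qn"
    unfolding psd_form_def qn_def
    using Qsym psd_form_nonneg[OF Q] by (auto simp: X_lin Qlin add_divide_distrib)
  have npos: "real n > 0" using n by simp
  obtain sg where sg: "\<And>i. i < n \<Longrightarrow> \<bar>g i - (\<Sum>l<q. sg l * z i l)\<bar> \<le> \<eta> * lam" using g by auto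
  obtain sth where sth: "\<And>i j. i < n \<Longrightarrow> j < p \<Longrightarrow> \<bar>th i j - (\<Sum>l<q. sth j l * z i l)\<bar> \<le> d" using th by metis
  have z_span: "in_span n e q (\<lambda>i. \<Sum>l<q. b l * z i l)" for b
    unfolding span unfolding in_span_def by (intro exI[of _ b]) simp
  have X_split: "Q (X u) (X u) = Q (\<lambda>i. (\<Sum>j<p. u j * th i j) + (\<Sum>j<p. u j * E i j)) (\<lambda>i. (\<Sum>j<p. u j * th i j) + (\<Sum>j<p. u j * E i j))" for u
  proof -
    have "X u i = (\<Sum>j<p. u j * th i j) + (\<Sum>j<p. u j * E i j)" if "i < n" for i
      unfolding X_def sum.distrib[symmetric] using x[OF that] by (intro sum.cong refl) (simp add: distrib_left)
    then show ?thesis unfolding Q_def by (intro proj_form_cong)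
  qed
  have Qth: "Q (\<lambda>i. \<Sum>j<p. u j * th i j) (\<lambda>i. \<Sum>j<p. u j * th i j) \<le> real n * (real p * d\<^sup>2 * (\<Sum>j<p. (u j)\<^sup>2))" for u
    unfolding Q_def
    by (rule proj_form_smooth_le[OF ortho, where s = "\<lambda>j i. \<Sum>l<q. sth j l * z i l"]) (use z_span sth in auto)
  have coercive: "c / 8 * (\<Sum>j<p. (u j)\<^sup>2) \<le> qn u u" for u
  proof -
    define U where "U = (\<Sum>j<p. (u j)\<^sup>2)"
    have U: "U \<ge> 0" unfolding U_def by (intro sum_nonneg) auto
    have "real n * (c / 2 * U) \<le> Q (\<lambda>i. \<Sum>j<p. u j * E i j) (\<lambda>i. \<Sum>j<p. u j * E i j)"
      unfolding Q_def U_def by (rule proj_form_residual_ge[OF W D \<Xi> n c])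
    also have "\<dots> \<le> 2 * Q (X u) (X u) + 2 * Q (\<lambda>i. \<Sum>j<p. u j * th i j) (\<lambda>i. \<Sum>j<p. u j * th i j)"
      using psd_form_diff_le[OF Q, of "\<lambda>i. (\<Sum>j<p. u j * th i j) + (\<Sum>j<p. u j * E i j)" "\<lambda>i. \<Sum>j<p. u j * th i j"]
      unfolding X_split by simp
    finally have "real n * (c / 2 * U) \<le> 2 * Q (X u) (X u) + 2 * (real n * (real p * d\<^sup>2 * U))"
      using Qth[of u] unfolding U_def by linarith
    moreover have "real n * (real p * d\<^sup>2 * U) \<le> real n * (c / 8 * U)"
      using d U by (intro mult_left_mono mult_right_mono) auto
    ultimately have "real n * (c / 8 * U) \<le> Q (X u) (X u)" by (simp add: algebra_simps)
    then show ?thesis unfolding qn_def U_def[symmetric] using npos by (simp add: field_simps)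
  qed
  have diag: "qn (\<lambda>i. if i = j then 1 else 0) (\<lambda>i. if i = j then 1 else 0) \<le> 2 * R\<^sup>2 + 2" if j: "j < p" for j
  proof -
    let ?u = "\<lambda>i. if i = j then 1 else 0 :: real"
    have delta: "(\<Sum>l<p. ?u l * f l) = f j" for f :: "nat \<Rightarrow> real"
      using j by (simp add: if_distrib[of "\<lambda>x. x * _"] cong: if_cong)
    have "Q (X ?u) (X ?u) \<le> 2 * Q (\<lambda>i. th i j) (\<lambda>i. th i j) + 2 * Q (\<lambda>i. E i j) (\<lambda>i. E i j)"
      unfolding X_split delta by (rule psd_form_add_le[OF Q])
    moreover have "Q (\<lambda>i. E i j) (\<lambda>i. E i j) \<le> real n * R\<^sup>2"
      unfolding Q_def by (rule order_trans[OF proj_form_le_ip ip_self_le]) (use E j in auto)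
    moreover have "Q (\<lambda>i. th i j) (\<lambda>i. th i j) \<le> real n * d\<^sup>2"
    proof -
      have "Q (\<lambda>i. th i j) (\<lambda>i. th i j)
          = Q (\<lambda>i. th i j - (\<Sum>l<q. sth j l * z i l)) (\<lambda>i. th i j - (\<Sum>l<q. sth j l * z i l))"
        unfolding Q_def by (rule proj_form_sub_span[OF ortho z_span, symmetric])
      also have "\<dots> \<le> real n * d\<^sup>2"
        unfolding Q_def by (rule order_trans[OF proj_form_le_ip ip_self_le]) (use sth j in auto)
      finally show ?thesis .
    qed
    moreover have "real n * d\<^sup>2 \<le> real n * 1" using d by (intro mult_left_mono) (auto simp: power_le_one)
    ultimately have "Q (X ?u) (X ?u) \<le> real n * (2 * R\<^sup>2 + 2)" by (simp add: algebra_simps)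
    then show ?thesis unfolding qn_def using npos by (simp add: field_simps)
  qed
  have L_le: "\<bar>L u\<bar> \<le> 2 * \<eta> * lam * sqrt (qn u u)" for u
  proof -
    have "in_span n e (q + p) (X u)"
      unfolding e_def in_span_orthonormalize_iff X_def
    proof (rule in_span_sum)
      fix j assume "j \<in> {..<p}"
      then show "in_span n (design_columns q z x) (q + p) (\<lambda>i. x i j)"
        using in_span_self[of "q + j" "q + p" n "design_columns q z x"] by (simp add: design_columns_def)
    qed simp
    from proj_form_le_components[OF ortho this]
    have "\<bar>Q h (X u)\<bar> \<le> sqrt (\<Sum>l=q..<q+p. (ip n (e l) h)\<^sup>2) * sqrt (Q (X u) (X u))" unfolding Q_def .
    also have "(\<Sum>l=q..<q+p. (ip n (e l) h)\<^sup>2) \<le> real n * (2 * \<eta> * lam)\<^sup>2"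
      using components_spline_plus_noise_le[OF ortho z_span[of sg], where g = g and p = p and \<epsilon> = \<epsilon>] sg V
      unfolding h_def by (force simp: power_mult_distrib)
    finally have "\<bar>Q h (X u)\<bar> \<le> sqrt (real n * (2 * \<eta> * lam)\<^sup>2) * sqrt (Q (X u) (X u))"
      using psd_form_nonneg[OF Q] by (simp add: mult_right_mono)
    also have "\<dots> = real n * (2 * \<eta> * lam * sqrt (qn u u))"
      unfolding qn_def using npos \<eta> lam by (simp add: real_sqrt_mult real_sqrt_divide field_simps)
    finally show ?thesis unfolding L_def using npos by (simp add: field_simps abs_divide)
  qed
  have resid: "proj_form n e q (\<lambda>i. y i - (\<Sum>j<p. x i j * b j)) (\<lambda>i. y i - (\<Sum>j<p. x i j * b j))
      = Q h h + real n * (qn (\<lambda>j. b j - \<beta> j) (\<lambda>j. b j - \<beta> j) - 2 * L (\<lambda>j. b j - \<beta> j))" for b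
  proof -
    let ?v = "\<lambda>j. b j - \<beta> j"
    have "proj_form n e q (\<lambda>i. y i - (\<Sum>j<p. x i j * b j)) (\<lambda>i. y i - (\<Sum>j<p. x i j * b j))
        = Q (\<lambda>i. h i + (-1) * X ?v i) (\<lambda>i. h i + (-1) * X ?v i)"
    proof -
      have "X ?v i = (\<Sum>j<p. x i j * b j) - (\<Sum>j<p. x i j * \<beta> j)" for i
        unfolding X_def sum_subtractf[symmetric] by (intro sum.cong refl) (simp add: algebra_simps)
      then have "y i - (\<Sum>j<p. x i j * b j) = h i + (-1) * X ?v i" if "i < n" for i
        using y[OF that] unfolding h_def by simp
      then show ?thesis unfolding Q_def by (intro proj_form_cong)
    qed
    moreover have "real n * qn ?v ?v = Q (X ?v) (X ?v)" "real n * L ?v = Q h (X ?v)"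
      unfolding qn_def L_def using npos by simp_all
    ultimately show ?thesis unfolding psd_form_expand[OF Q] by (simp add: algebra_simps)
  qed
  show ?thesis
  proof (rule scad_zero_of_quadratic[OF psd _ L_le coercive _ diag _ k \<beta>0 \<beta>1 a lam _ S1(1) _ _ _ j])
    show "L (\<lambda>j. u j + t * w j) = L u + t * L w" for u w t
      unfolding L_def X_lin using Qlin Qsym by (metis add_divide_distrib times_divide_eq_right)
    show "0 < c / 8" using c by simp
    show "0 \<le> 2 * \<eta> * lam" using \<eta> lam by simp
    show "4 * (2 * \<eta> * lam)\<^sup>2 + (a + 1) * real k * lam\<^sup>2 < c / 8 * (b0 - a * lam)\<^sup>2"
      using S1(2) by (simp add: power_mult_distrib)
    show "4 * (2 * \<eta> * lam)\<^sup>2 \<le> c / 8 * lam\<^sup>2"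
      using mult_right_mono[OF S2, of "lam\<^sup>2"] by (simp add: power_mult_distrib)
    have "lam * (12 * \<eta> * sqrt (2 * R\<^sup>2 + 2) + 4 * \<eta> / sqrt (c / 8) * (2 * R\<^sup>2 + 2)) < lam * 1"
      using S3 lam by (rule mult_strict_left_mono)
    then show "6 * (2 * \<eta> * lam) * sqrt (2 * R\<^sup>2 + 2) + 2 * (2 * \<eta> * lam) / sqrt (c / 8) * (2 * R\<^sup>2 + 2) < lam"
      by (simp add: algebra_simps)
    fix b
    have "real n * (qn (\<lambda>j. bh j - \<beta> j) (\<lambda>j. bh j - \<beta> j) - 2 * L (\<lambda>j. bh j - \<beta> j) + (\<Sum>j<p. scad a lam (bh j)))
        \<le> real n * (qn (\<lambda>j. b j - \<beta> j) (\<lambda>j. b j - \<beta> j) - 2 * L (\<lambda>j. b j - \<beta> j) + (\<Sum>j<p. scad a lam (b j)))"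
      using scad_minimizer_projected[OF min ortho span, of b] unfolding resid by (simp add: algebra_simps)
    then show "qn (\<lambda>j. bh j - \<beta> j) (\<lambda>j. bh j - \<beta> j) - 2 * L (\<lambda>j. bh j - \<beta> j) + (\<Sum>j<p. scad a lam (bh j))
        \<le> qn (\<lambda>j. b j - \<beta> j) (\<lambda>j. b j - \<beta> j) - 2 * L (\<lambda>j. b j - \<beta> j) + (\<Sum>j<p. scad a lam (b j))"
      using npos by simp
  qed
qed


section \<open>Conditionally centred sums\<close>

lemma integrable_PiM_component:
  fixes f :: "'o \<Rightarrow> real"
  assumes "prob_space D" "integrable D f" "i < n"
  shows "integrable (PiM {..<n} (\<lambda>_. D)) (\<lambda>x. f (x i))"
proof -
  have "distr (PiM {..<n} (\<lambda>_. D)) D (\<lambda>x. x i) = D"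
    using assms by (intro distr_PiM_component) auto
  moreover have "(\<lambda>x. x i) \<in> measurable (PiM {..<n} (\<lambda>_. D)) D"
    using assms by (intro measurable_component_singleton) auto
  ultimately show ?thesis
    using integrable_distr[of "\<lambda>x. x i" "PiM {..<n} (\<lambda>_. D)" D f] assms(2) by simp
qed

text \<open>The weights depend on the whole sample of \<open>\<tau>\<close>, but not on the rest of the observations: integrating
  out the \<open>i\<close>-th observation alone therefore kills the cross terms with \<open>i\<close>.\<close>

lemma second_moment_weighted_sum:
  fixes f :: "'o \<Rightarrow> real" and w :: "nat \<Rightarrow> (nat \<Rightarrow> 'c) \<Rightarrow> real" and \<tau> :: "'o \<Rightarrow> 'c" and n :: nat
  assumes D: "prob_space D" and \<tau>[measurable]: "\<tau> \<in> measurable D N"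
    and f[measurable]: "f \<in> borel_measurable D" and f2: "integrable D (\<lambda>x. (f x)\<^sup>2)"
    and mean: "\<And>h. h \<in> borel_measurable N \<Longrightarrow> (\<And>t. \<bar>h t\<bar> \<le> 1) \<Longrightarrow> (\<integral>x. h (\<tau> x) * f x \<partial>D) = 0"
    and var: "\<And>h. h \<in> borel_measurable N \<Longrightarrow> (\<And>t. 0 \<le> h t \<and> h t \<le> 1) \<Longrightarrow>
                (\<integral>x. h (\<tau> x) * (f x)\<^sup>2 \<partial>D) \<le> S * (\<integral>x. h (\<tau> x) \<partial>D)"
    and S: "S \<ge> 0"
    and w[measurable]: "\<And>i. i < n \<Longrightarrow> w i \<in> borel_measurable (PiM {..<n} (\<lambda>_. N))"
    and w1: "\<And>i v. i < n \<Longrightarrow> \<bar>w i v\<bar> \<le> 1" and w2: "\<And>v. (\<Sum>i<n. (w i v)\<^sup>2) \<le> 1"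
  defines "T \<equiv> \<lambda>x. \<lambda>i\<in>{..<n}. \<tau> (x i)"
  shows "integrable (PiM {..<n} (\<lambda>_. D)) (\<lambda>x. (\<Sum>i<n. w i (T x) * f (x i))\<^sup>2)"
    and "(\<integral>x. (\<Sum>i<n. w i (T x) * f (x i))\<^sup>2 \<partial>PiM {..<n} (\<lambda>_. D)) \<le> S"
proof -
  interpret D: prob_space D by (rule D)
  interpret product_prob_space "\<lambda>_::nat. D" "{..<n}" by standard
  let ?P = "PiM {..<n} (\<lambda>_. D)"
  interpret P: prob_space ?P by (intro prob_space_PiM D)
  have T[measurable]: "T \<in> measurable ?P (PiM {..<n} (\<lambda>_. N))"
    unfolding T_def by (intro measurable_restrict) measurable
  have wT[measurable]: "(\<lambda>x. w i (T x)) \<in> borel_measurable ?P" if "i < n" for i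
    using measurable_compose[OF T w[OF that]] .
  have fc[measurable]: "(\<lambda>x. f (x i)) \<in> borel_measurable ?P" if "i < n" for i
    using measurable_compose[OF measurable_component_singleton[of i "{..<n}" "\<lambda>_. D"] f] that by simp
  define G where "G i j x = (w i (T x) * f (x i)) * (w j (T x) * f (x j))" for i j x
  have G_int: "integrable ?P (G i j)" if "i < n" "j < n" for i j
  proof (rule Bochner_Integration.integrable_bound)
    show "integrable ?P (\<lambda>x. (f (x i))\<^sup>2 + (f (x j))\<^sup>2)"
      using integrable_PiM_component[OF D f2] that by (intro Bochner_Integration.integrable_add) auto
    show "G i j \<in> borel_measurable ?P"
      unfolding G_def using that by (intro borel_measurable_times wT fc) auto
    show "AE x in ?P. norm (G i j x) \<le> norm ((f (x i))\<^sup>2 + (f (x j))\<^sup>2)"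
    proof (intro AE_I2)
      fix x
      have "\<bar>w i (T x)\<bar> * \<bar>w j (T x)\<bar> \<le> 1 * 1" using w1 that by (intro mult_mono) auto
      then have "(\<bar>w i (T x)\<bar> * \<bar>w j (T x)\<bar>) * (\<bar>f (x i)\<bar> * \<bar>f (x j)\<bar>) \<le> 1 * (\<bar>f (x i)\<bar> * \<bar>f (x j)\<bar>)"
        by (intro mult_right_mono) auto
      moreover have "\<bar>f (x i)\<bar> * \<bar>f (x j)\<bar> \<le> (f (x i))\<^sup>2 + (f (x j))\<^sup>2"
        using sum_squares_bound[of "\<bar>f (x i)\<bar>" "\<bar>f (x j)\<bar>"]
          mult_nonneg_nonneg[of "\<bar>f (x i)\<bar>" "\<bar>f (x j)\<bar>"]
        unfolding power2_abs mult.assoc by linarith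
      ultimately show "norm (G i j x) \<le> norm ((f (x i))\<^sup>2 + (f (x j))\<^sup>2)"
        unfolding G_def by (simp add: abs_mult mult_ac)
    qed
  qed
  have T_upd: "T (x(i := y)) = (\<lambda>k\<in>{..<n}. if k = i then \<tau> y else \<tau> (x k))" for x i y
    unfolding T_def by (auto simp: restrict_def)
  \<comment> \<open>Freezing all observations but the \<open>i\<close>-th turns the weights into
    measurable functions of \<tau> of that one observation, which is the form of test function
    accepted by \<open>mean\<close> and \<open>var\<close>.\<close>
  have slice: "(\<lambda>t. \<lambda>k\<in>{..<n}. if k = i then t else \<tau> (x k)) \<in> measurable N (PiM {..<n} (\<lambda>_. N))"
    if "x \<in> space (PiM ({..<n} - {i}) (\<lambda>_. D))" for x i
  proof (intro measurable_restrict)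
    fix k assume k: "k \<in> {..<n}"
    show "(\<lambda>t. if k = i then t else \<tau> (x k)) \<in> measurable N N"
    proof (cases "k = i")
      case False
      then have "x k \<in> space D" using that k by (auto simp: space_PiM PiE_iff)
      then show ?thesis using False measurable_space[OF \<tau>] by simp
    qed simp
  qed
  have ins: "{..<n} = insert i ({..<n} - {i})" if "i < n" for i using that by auto
  \<comment> \<open>In the inner integral over observation \<open>i\<close> the factor
    \<open>f (x j)\<close> is constant and the product of the two weights is a test function bounded
    by 1, so \<open>mean\<close> applies.\<close>
  have cross: "(\<integral>x. G i j x \<partial>?P) = 0" if ij: "i < n" "j < n" "i \<noteq> j" for i j
  proof -
    have "(\<integral>x. G i j x \<partial>?P) = (\<integral>x. (\<integral>y. G i j (x(i := y)) \<partial>D) \<partial>PiM ({..<n} - {i}) (\<lambda>_. D))"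
      using product_integral_insert[of "{..<n} - {i}" i "G i j"] G_int[OF ij(1,2)] ins[OF ij(1), symmetric] by simp
    also have "\<dots> = (\<integral>x. 0 \<partial>PiM ({..<n} - {i}) (\<lambda>_. D))"
    proof (intro Bochner_Integration.integral_cong refl)
      fix x assume x: "x \<in> space (PiM ({..<n} - {i}) (\<lambda>_. D))"
      define h where "h t = w i (\<lambda>k\<in>{..<n}. if k = i then t else \<tau> (x k)) * w j (\<lambda>k\<in>{..<n}. if k = i then t else \<tau> (x k))" for t
      have "h \<in> borel_measurable N"
        unfolding h_def using measurable_compose[OF slice[OF x] w] ij by (intro borel_measurable_times) auto
      moreover have "\<bar>h t\<bar> \<le> 1" for t
      proof -
        have "\<bar>h t\<bar> \<le> 1 * 1" unfolding h_def abs_mult using w1 ij by (intro mult_mono) auto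
        then show ?thesis by simp
      qed
      ultimately have "(\<integral>y. h (\<tau> y) * f y \<partial>D) = 0" by (rule mean)
      moreover have "G i j (x(i := y)) = f (x j) * (h (\<tau> y) * f y)" for y
        unfolding G_def T_upd h_def using ij by (simp add: mult_ac)
      ultimately show "(\<integral>y. G i j (x(i := y)) \<partial>D) = 0" by simp
    qed
    finally show ?thesis by simp
  qed
  have w_int: "integrable ?P (\<lambda>x. (w i (T x))\<^sup>2)" if "i < n" for i
    using w1[OF that] wT[OF that] by (intro P.integrable_const_bound[where B = 1]) (auto simp: abs_square_le_1)
  have diag: "(\<integral>x. G i i x \<partial>?P) \<le> S * (\<integral>x. (w i (T x))\<^sup>2 \<partial>?P)" if i: "i < n" for i
  proof -
    have G0: "G i i x \<ge> 0" for x unfolding G_def by simp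
    have Gm: "(\<lambda>x. ennreal (G i i x)) \<in> borel_measurable (PiM (insert i ({..<n} - {i})) (\<lambda>_. D))"
      using borel_measurable_integrable[OF G_int[OF i i]] ins[OF i, symmetric] by simp
    have wm: "(\<lambda>x. ennreal ((w i (T x))\<^sup>2)) \<in> borel_measurable (PiM (insert i ({..<n} - {i})) (\<lambda>_. D))"
      using borel_measurable_integrable[OF w_int[OF i]] ins[OF i, symmetric] by simp
    \<comment> \<open>Nonnegative integrals are used here so that the inner integrals can be
      compared pointwise without first proving them integrable.\<close>
    have "ennreal (\<integral>x. G i i x \<partial>?P) = (\<integral>\<^sup>+x. ennreal (G i i x) \<partial>?P)"
      using G0 by (intro nn_integral_eq_integral[symmetric] G_int i) auto
    also have "\<dots> = (\<integral>\<^sup>+x. (\<integral>\<^sup>+y. ennreal (G i i (x(i := y))) \<partial>D) \<partial>PiM ({..<n} - {i}) (\<lambda>_. D))"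
      using product_nn_integral_insert[of "{..<n} - {i}" i, OF _ _ Gm] ins[OF i, symmetric] by simp
    also have "\<dots> \<le> (\<integral>\<^sup>+x. ennreal S * (\<integral>\<^sup>+y. ennreal ((w i (T (x(i := y))))\<^sup>2) \<partial>D) \<partial>PiM ({..<n} - {i}) (\<lambda>_. D))"
    proof (intro nn_integral_mono)
      fix x assume x: "x \<in> space (PiM ({..<n} - {i}) (\<lambda>_. D))"
      define h where "h t = (w i (\<lambda>k\<in>{..<n}. if k = i then t else \<tau> (x k)))\<^sup>2" for t
      have hm[measurable]: "h \<in> borel_measurable N"
        unfolding h_def using measurable_compose[OF slice[OF x] w[OF i]] by (intro borel_measurable_power) auto
      have h01: "0 \<le> h t \<and> h t \<le> 1" for t unfolding h_def using w1[OF i] by (simp add: abs_square_le_1)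
      have hi: "integrable D (\<lambda>y. h (\<tau> y))"
        using h01 by (intro D.integrable_const_bound[where B = 1]) auto
      have hfi: "integrable D (\<lambda>y. h (\<tau> y) * (f y)\<^sup>2)"
        by (rule Bochner_Integration.integrable_bound[OF f2])
           (use h01 in \<open>auto simp: abs_mult intro!: mult_left_le_one_le\<close>)
      have eq: "G i i (x(i := y)) = h (\<tau> y) * (f y)\<^sup>2" "(w i (T (x(i := y))))\<^sup>2 = h (\<tau> y)" for y
        unfolding G_def T_upd h_def by (simp_all add: power2_eq_square mult_ac)
      have "(\<integral>\<^sup>+y. ennreal (h (\<tau> y) * (f y)\<^sup>2) \<partial>D) = ennreal (\<integral>y. h (\<tau> y) * (f y)\<^sup>2 \<partial>D)"
        using h01 by (intro nn_integral_eq_integral hfi) auto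
      also have "\<dots> \<le> ennreal (S * (\<integral>y. h (\<tau> y) \<partial>D))" by (intro ennreal_leI var hm h01)
      also have "\<dots> = ennreal S * (\<integral>\<^sup>+y. ennreal (h (\<tau> y)) \<partial>D)"
        using h01 S nn_integral_eq_integral[OF hi] by (simp add: ennreal_mult)
      finally show "(\<integral>\<^sup>+y. ennreal (G i i (x(i := y))) \<partial>D) \<le> ennreal S * (\<integral>\<^sup>+y. ennreal ((w i (T (x(i := y))))\<^sup>2) \<partial>D)"
        unfolding eq .
    qed
    also have "\<dots> = ennreal S * (\<integral>\<^sup>+x. (\<integral>\<^sup>+y. ennreal ((w i (T (x(i := y))))\<^sup>2) \<partial>D) \<partial>PiM ({..<n} - {i}) (\<lambda>_. D))"
    proof (intro nn_integral_cmult)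
      have "(\<lambda>(x, y). ennreal ((w i (T (x(i := y))))\<^sup>2)) \<in> borel_measurable (PiM ({..<n} - {i}) (\<lambda>_. D) \<Otimes>\<^sub>M D)"
        using measurable_compose[OF measurable_add_dim wm] by (simp add: case_prod_unfold)
      then show "(\<lambda>x. \<integral>\<^sup>+y. ennreal ((w i (T (x(i := y))))\<^sup>2) \<partial>D) \<in> borel_measurable (PiM ({..<n} - {i}) (\<lambda>_. D))"
        by (intro D.borel_measurable_nn_integral) auto
    qed
    also have "\<dots> = ennreal S * (\<integral>\<^sup>+x. ennreal ((w i (T x))\<^sup>2) \<partial>?P)"
      using product_nn_integral_insert[of "{..<n} - {i}" i, OF _ _ wm] ins[OF i, symmetric] by simp
    also have "\<dots> = ennreal (S * (\<integral>x. (w i (T x))\<^sup>2 \<partial>?P))"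
      using S nn_integral_eq_integral[OF w_int[OF i]] by (simp add: ennreal_mult)
    finally show ?thesis using S by (subst (asm) ennreal_le_iff) auto
  qed
  have sq: "(\<Sum>i<n. w i (T x) * f (x i))\<^sup>2 = (\<Sum>i<n. \<Sum>j<n. G i j x)" for x
    unfolding power2_eq_square sum_product G_def ..
  show "integrable ?P (\<lambda>x. (\<Sum>i<n. w i (T x) * f (x i))\<^sup>2)"
    unfolding sq by (intro Bochner_Integration.integrable_sum G_int) auto
  have "(\<integral>x. (\<Sum>i<n. w i (T x) * f (x i))\<^sup>2 \<partial>?P) = (\<Sum>i<n. \<Sum>j<n. \<integral>x. G i j x \<partial>?P)"
    unfolding sq by (subst Bochner_Integration.integral_sum; (intro Bochner_Integration.integrable_sum G_int sum.cong refl Bochner_Integration.integral_sum)?) auto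
  also have "\<dots> = (\<Sum>i<n. \<integral>x. G i i x \<partial>?P)"
  proof (intro sum.cong refl)
    fix i assume i: "i \<in> {..<n}"
    have "(\<Sum>j<n. \<integral>x. G i j x \<partial>?P) = (\<Sum>j<n. if j = i then \<integral>x. G i i x \<partial>?P else 0)"
      using cross i by (intro sum.cong) auto
    then show "(\<Sum>j<n. \<integral>x. G i j x \<partial>?P) = (\<integral>x. G i i x \<partial>?P)" using i by simp
  qed
  also have "\<dots> \<le> (\<Sum>i<n. S * (\<integral>x. (w i (T x))\<^sup>2 \<partial>?P))" using diag by (intro sum_mono) auto
  also have "\<dots> = S * (\<integral>x. (\<Sum>i<n. (w i (T x))\<^sup>2) \<partial>?P)"
    using w_int by (subst Bochner_Integration.integral_sum) (auto simp: sum_distrib_left)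
  also have "\<dots> \<le> S * (\<integral>x. 1 \<partial>?P)"
    using w_int w2 S by (intro mult_left_mono integral_mono Bochner_Integration.integrable_sum) auto
  also have "\<dots> = S" by (simp add: P.prob_space)
  finally show "(\<integral>x. (\<Sum>i<n. w i (T x) * f (x i))\<^sup>2 \<partial>?P) \<le> S" .
qed


section \<open>Residuals and noise in the population\<close>

text \<open>The complement of the support is a union of open sets of probability 0, and by Lindelof
  countably many of them suffice. This converts compact supports into an almost sure bound.\<close>

lemma AE_in_rv_support:
  assumes "prob_space P" and V[measurable]: "V \<in> borel_measurable P"
  shows "AE \<omega> in P. V \<omega> \<in> rv_support P V"
proof -
  interpret prob_space P by fact
  define F where "F = {U :: real set. open U \<and> measure P (V -` U \<inter> space P) = 0}"
  have "\<And>U. U \<in> F \<Longrightarrow> open U" unfolding F_def by blast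
  then obtain F' where F': "F' \<subseteq> F" "countable F'" "\<Union>F' = \<Union>F" using Lindelof[of F] by metis
  have "AE \<omega> in P. \<forall>U\<in>F'. V \<omega> \<notin> U"
  proof (subst AE_ball_countable[OF F'(2)], intro ballI)
    fix U assume "U \<in> F'"
    then have U: "open U" "prob (V -` U \<inter> space P) = 0" using F'(1) unfolding F_def by auto
    from U(1) have [measurable]: "U \<in> sets borel" by simp
    have "V -` U \<inter> space P \<in> null_sets P"
      using U(2) by (intro null_setsI) (auto simp: emeasure_eq_measure)
    then have "AE \<omega> in P. \<omega> \<notin> V -` U \<inter> space P" by (rule AE_not_in)
    with AE_space show "AE \<omega> in P. V \<omega> \<notin> U" by eventually_elim auto
  qed
  then show ?thesis
  proof eventually_elim
    fix \<omega> assume "\<forall>U\<in>F'. V \<omega> \<notin> U"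
    then have "V \<omega> \<notin> \<Union>F" unfolding F'(3)[symmetric] by blast
    then show "V \<omega> \<in> rv_support P V"
      unfolding rv_support_def F_def by (auto simp: less_le)
  qed
qed

section \<open>Conditioning on \<open>T\<close>\<close>

lemma finite_measure_subalgebra_vimage:
  assumes "prob_space P" "T \<in> borel_measurable P"
  shows "finite_measure_subalgebra P (vimage_algebra (space P) T borel)"
proof -
  interpret prob_space P by fact
  show ?thesis
  proof
    show "subalgebra P (vimage_algebra (space P) T borel)"
      unfolding subalgebra_def using assms(2) by (auto simp: sets_vimage_algebra2 intro: measurable_sets)
  qed
qed

context
  fixes P :: "'a measure" and T :: "'a \<Rightarrow> real"
  assumes P: "prob_space P" and T: "T \<in> borel_measurable P"
begin

interpretation prob_space P by (rule P)
interpretation F: finite_measure_subalgebra P "vimage_algebra (space P) T borel"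
  by (rule finite_measure_subalgebra_vimage[OF P T])

lemma borel_measurable_comp_vimage_algebra:
  fixes h :: "real \<Rightarrow> real"
  assumes "h \<in> borel_measurable borel"
  shows "(\<lambda>\<omega>. h (T \<omega>)) \<in> borel_measurable (vimage_algebra (space P) T borel)"
  by (rule measurable_compose[OF _ assms]) (rule measurable_vimage_algebra1, simp)

lemma cond_resid_integrable:
  assumes "integrable P V"
  shows "integrable P (cond_resid P T V)"
  unfolding cond_resid_def cond_mean_def
  by (intro Bochner_Integration.integrable_diff assms F.real_cond_exp_int(1))

lemma cond_resid_orthogonal:
  fixes h :: "real \<Rightarrow> real"
  assumes V: "integrable P V" and h[measurable]: "h \<in> borel_measurable borel" and h1: "\<And>t. \<bar>h t\<bar> \<le> 1"
  shows "(\<integral>\<omega>. h (T \<omega>) * cond_resid P T V \<omega> \<partial>P) = 0"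
proof -
  note [measurable] = T
  have hV: "integrable P (\<lambda>\<omega>. h (T \<omega>) * V' \<omega>)" if V': "integrable P V'" for V'
    using h1 V' by (intro Bochner_Integration.integrable_bound[OF V'])
      (auto simp: abs_mult intro!: mult_left_le_one_le)
  have "(\<integral>\<omega>. h (T \<omega>) * cond_mean P T V \<omega> \<partial>P) = (\<integral>\<omega>. h (T \<omega>) * V \<omega> \<partial>P)"
    unfolding cond_mean_def
    using hV[OF V] V by (intro F.real_cond_exp_intg(2) borel_measurable_comp_vimage_algebra h) auto
  moreover have "integrable P (\<lambda>\<omega>. h (T \<omega>) * cond_mean P T V \<omega>)"
    unfolding cond_mean_def by (intro hV F.real_cond_exp_int(1) V)
  ultimately show ?thesis
    using hV[OF V] unfolding cond_resid_def by (simp add: right_diff_distrib)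
qed

text \<open>\<open>Xi_mat\<close> feeds residuals into \<open>cond_cov\<close>, which takes
  residuals again. A residual has conditional mean 0, so the second pass changes it only on a null
  set, and integrating the conditional mean of the product gives the integral of the product. The
  bound \<open>R\<close> makes the products integrable.\<close>

lemma Xi_mat_entry:
  assumes V: "\<And>j. j < p \<Longrightarrow> integrable P (V j)"
    and R: "\<And>j. j < p \<Longrightarrow> AE \<omega> in P. \<bar>cond_resid P T (V j) \<omega>\<bar> \<le> R"
  shows "Xi_mat P T V p = Matrix.mat p p (\<lambda>(i, j). \<integral>\<omega>. cond_resid P T (V i) \<omega> * cond_resid P T (V j) \<omega> \<partial>P)"
proof -
  let ?e = "\<lambda>j. cond_resid P T (V j)"
  have resid2: "AE \<omega> in P. cond_resid P T (?e j) \<omega> = ?e j \<omega>" if j: "j < p" for j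
  proof -
    have "AE \<omega> in P. cond_mean P T (?e j) \<omega> = cond_mean P T (V j) \<omega> - cond_mean P T (cond_mean P T (V j)) \<omega>"
      unfolding cond_mean_def cond_resid_def
      by (intro F.real_cond_exp_diff V[OF j] F.real_cond_exp_int(1))
    moreover have "AE \<omega> in P. cond_mean P T (cond_mean P T (V j)) \<omega> = cond_mean P T (V j) \<omega>"
      unfolding cond_mean_def by (intro F.real_cond_exp_F_meas F.real_cond_exp_int(1) V[OF j]) simp
    ultimately show ?thesis unfolding cond_resid_def[of P T "?e j"] by eventually_elim simp
  qed
  have "(\<integral>\<omega>. cond_cov P T (?e i) (?e j) \<omega> \<partial>P) = (\<integral>\<omega>. ?e i \<omega> * ?e j \<omega> \<partial>P)" if ij: "i < p" "j < p" for i j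
  proof -
    have m[measurable]: "?e j \<in> borel_measurable P" if "j < p" for j
      using cond_resid_integrable[OF V[OF that]] by simp
    have m2[measurable]: "cond_resid P T (?e j) \<in> borel_measurable P" if "j < p" for j
      using cond_resid_integrable[OF cond_resid_integrable[OF V[OF that]]] by simp
    have "integrable P (\<lambda>\<omega>. ?e i \<omega> * ?e j \<omega>)"
    proof (rule integrable_const_bound[where B = "R * R"])
      show "AE \<omega> in P. norm (?e i \<omega> * ?e j \<omega>) \<le> R * R"
        using R[OF ij(1)] R[OF ij(2)] by eventually_elim (auto simp: abs_mult intro!: mult_mono)
    qed (use m ij in auto)
    moreover have ae: "AE \<omega> in P. cond_resid P T (?e i) \<omega> * cond_resid P T (?e j) \<omega> = ?e i \<omega> * ?e j \<omega>"
      using resid2[OF ij(1)] resid2[OF ij(2)] by eventually_elim simp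
    ultimately have "integrable P (\<lambda>\<omega>. cond_resid P T (?e i) \<omega> * cond_resid P T (?e j) \<omega>)"
      using m m2 ij by (subst integrable_cong_AE) auto
    then have "(\<integral>\<omega>. cond_cov P T (?e i) (?e j) \<omega> \<partial>P) = (\<integral>\<omega>. cond_resid P T (?e i) \<omega> * cond_resid P T (?e j) \<omega> \<partial>P)"
      unfolding cond_cov_def cond_mean_def[of P T "\<lambda>\<omega>. _ \<omega> * _ \<omega>"] by (rule F.real_cond_exp_int(2))
    also have "\<dots> = (\<integral>\<omega>. ?e i \<omega> * ?e j \<omega> \<partial>P)"
      using ae m m2 ij by (intro integral_cong_AE) auto
    finally show ?thesis .
  qed
  then show ?thesis unfolding Xi_mat_def by (intro eq_matI) auto
qed

end

text \<open>The two variables have values in different types, so independence is stated for the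
  generated \<sigma>-algebras. The real functions \<open>h\<close> of \<open>W\<close> and
  \<open>\<phi>\<close> of \<open>V\<close> generate smaller ones and are independent in the
  ordinary sense.\<close>

lemma indep_rv_product:
  fixes V :: "'a \<Rightarrow> real" and W :: "'a \<Rightarrow> 'c" and h :: "'c \<Rightarrow> real" and \<phi> :: "real \<Rightarrow> real"
  assumes "prob_space P" and ind: "indep_rv P borel V N W"
    and h[measurable]: "h \<in> borel_measurable N" and h1: "\<And>t. \<bar>h t\<bar> \<le> 1"
    and \<phi>[measurable]: "\<phi> \<in> borel_measurable borel" and int: "integrable P (\<lambda>\<omega>. \<phi> (V \<omega>))"
  shows "(\<integral>\<omega>. h (W \<omega>) * \<phi> (V \<omega>) \<partial>P) = (\<integral>\<omega>. h (W \<omega>) \<partial>P) * (\<integral>\<omega>. \<phi> (V \<omega>) \<partial>P)"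
proof -
  interpret prob_space P by fact
  have V[measurable]: "V \<in> borel_measurable P" and W[measurable]: "W \<in> measurable P N"
    and ind': "indep_set (sets (vimage_algebra (space P) V borel)) (sets (vimage_algebra (space P) W N))"
    using ind unfolding indep_rv_def by auto
  have V': "(\<lambda>\<omega>. \<phi> (V \<omega>)) \<in> borel_measurable (vimage_algebra (space P) V borel)"
    by (rule measurable_compose[OF _ \<phi>]) (rule measurable_vimage_algebra1, simp)
  have W': "(\<lambda>\<omega>. h (W \<omega>)) \<in> borel_measurable (vimage_algebra (space P) W N)"
    by (rule measurable_compose[OF _ h]) (rule measurable_vimage_algebra1, use measurable_space[OF W] in auto)
  have sub: "sigma_sets (space P) {f -` A \<inter> space P |A. A \<in> sets borel} \<subseteq> sets F"
    if "f \<in> borel_measurable F" "space F = space P" for f :: "'a \<Rightarrow> real" and F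
    using measurable_sets[OF that(1)] that(2) sets.top[of F] by (intro sets.sigma_sets_subset') auto
  have mono: "indep_set A B" if "indep_set A' B'" "A \<subseteq> A'" "B \<subseteq> B'" for A B A' B'
    using that unfolding indep_sets2_eq by blast
  have "indep_var borel (\<lambda>\<omega>. h (W \<omega>)) borel (\<lambda>\<omega>. \<phi> (V \<omega>))"
    unfolding indep_var_eq
  proof (intro conjI)
    have "prob (A \<inter> B) = prob A * prob B"
      if "A \<in> sets (vimage_algebra (space P) W N)" "B \<in> sets (vimage_algebra (space P) V borel)" for A B
    proof -
      have "prob (B \<inter> A) = prob B * prob A" using ind' that unfolding indep_sets2_eq by blast
      then show ?thesis by (simp only: Int_commute[of A B] mult.commute[of "prob A"])
    qed
    then have "indep_set (sets (vimage_algebra (space P) W N)) (sets (vimage_algebra (space P) V borel))"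
      using ind' unfolding indep_sets2_eq by blast
    then show "indep_set (sigma_sets (space P) {(\<lambda>\<omega>. h (W \<omega>)) -` A \<inter> space P |A. A \<in> sets borel})
      (sigma_sets (space P) {(\<lambda>\<omega>. \<phi> (V \<omega>)) -` A \<inter> space P |A. A \<in> sets borel})"
      by (rule mono[OF _ sub[OF W'] sub[OF V']]) simp_all
  qed measurable
  moreover have "integrable P (\<lambda>\<omega>. h (W \<omega>))"
    using h1 by (intro integrable_const_bound[where B = 1]) auto
  ultimately show ?thesis using int by (intro indep_var_lebesgue_integral)
qed


section \<open>Moment bounds for the sample\<close>

text \<open>The weights are the coordinates of one basis vector, whose squares sum to at most 1. A
  single component thus has second moment at most \<open>S\<close>, independently of
  \<open>n\<close>, provided the columns up to \<open>l\<close> are functions of the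
  \<tau>-sample.\<close>

lemma second_moment_component_sum:
  fixes f :: "'o \<Rightarrow> real" and z :: "(nat \<Rightarrow> 'c) \<Rightarrow> nat \<Rightarrow> nat \<Rightarrow> real" and n :: nat
  assumes D: "prob_space D" and \<tau>: "\<tau> \<in> measurable D N"
    and f: "f \<in> borel_measurable D" "integrable D (\<lambda>x. (f x)\<^sup>2)"
    and mean: "\<And>h. h \<in> borel_measurable N \<Longrightarrow> (\<And>t. \<bar>h t\<bar> \<le> 1) \<Longrightarrow> (\<integral>x. h (\<tau> x) * f x \<partial>D) = 0"
    and var: "\<And>h. h \<in> borel_measurable N \<Longrightarrow> (\<And>t. 0 \<le> h t \<and> h t \<le> 1) \<Longrightarrow>
                (\<integral>x. h (\<tau> x) * (f x)\<^sup>2 \<partial>D) \<le> S * (\<integral>x. h (\<tau> x) \<partial>D)"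
    and S: "S \<ge> 0"
    and z: "\<And>k i. k \<le> l \<Longrightarrow> i < n \<Longrightarrow> (\<lambda>v. z v k i) \<in> borel_measurable (PiM {..<n} (\<lambda>_. N))"
  defines "\<Phi> \<equiv> \<lambda>s. (ip n (orthonormalize n (z (\<lambda>i\<in>{..<n}. \<tau> (s i))) l) (\<lambda>i. f (s i)))\<^sup>2"
  shows "integrable (PiM {..<n} (\<lambda>_. D)) \<Phi>" and "(\<integral>s. \<Phi> s \<partial>PiM {..<n} (\<lambda>_. D)) \<le> S"
proof -
  define w where "w i v = orthonormalize n (z v) l i" for i v
  have 1: "w i \<in> borel_measurable (PiM {..<n} (\<lambda>_. N))" if "i < n" for i
    unfolding w_def using z that by (rule borel_measurable_orthonormalize)
  have 2: "\<bar>w i v\<bar> \<le> 1" if "i < n" for i v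
    unfolding w_def by (rule orthonormal_comp_le_one[OF orthonormal_or_zero_orthonormalize that])
  have 3: "(\<Sum>i<n. (w i v)\<^sup>2) \<le> 1" for v
    unfolding w_def by (rule orthonormal_sum_squares_le_one[OF orthonormal_or_zero_orthonormalize])
  have \<Phi>: "\<Phi> = (\<lambda>s. (\<Sum>i<n. w i (\<lambda>i\<in>{..<n}. \<tau> (s i)) * f (s i))\<^sup>2)"
    unfolding \<Phi>_def ip_def w_def ..
  show "integrable (PiM {..<n} (\<lambda>_. D)) \<Phi>" unfolding \<Phi>
    by (rule second_moment_weighted_sum(1)[where N = N and S = S]) (fact D \<tau> f mean var S 1 2 3)+
  show "(\<integral>s. \<Phi> s \<partial>PiM {..<n} (\<lambda>_. D)) \<le> S" unfolding \<Phi>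
    by (rule second_moment_weighted_sum(2)[where N = N and S = S]) (fact D \<tau> f mean var S 1 2 3)+
qed

text \<open>The case of constant weights \<open>1 / sqrt n\<close>, with \<tau> mapping to the
  one-point type so that there is nothing to condition on.\<close>

lemma second_moment_iid_mean:
  fixes f :: "'o \<Rightarrow> real" and n :: nat
  assumes D: "prob_space D" and f: "f \<in> borel_measurable D" "integrable D (\<lambda>x. (f x)\<^sup>2)"
    and mean: "(\<integral>x. f x \<partial>D) = 0" and var: "(\<integral>x. (f x)\<^sup>2 \<partial>D) \<le> S" and n: "n \<ge> 1"
  shows "integrable (PiM {..<n} (\<lambda>_. D)) (\<lambda>s. ((\<Sum>i<n. f (s i)) / real n)\<^sup>2)"
    and "(\<integral>s. ((\<Sum>i<n. f (s i)) / real n)\<^sup>2 \<partial>PiM {..<n} (\<lambda>_. D)) \<le> S / real n"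
proof -
  let ?N = "count_space (UNIV :: unit set)"
  interpret prob_space D by fact
  have "0 \<le> (\<integral>x. (f x)\<^sup>2 \<partial>D)" by (rule Bochner_Integration.integral_nonneg) simp
  then have S: "S \<ge> 0" using var by (rule order_trans)
  define w :: "nat \<Rightarrow> (nat \<Rightarrow> unit) \<Rightarrow> real" where "w i v = 1 / sqrt (real n)" for i v
  have w: "w i \<in> borel_measurable (PiM {..<n} (\<lambda>_. ?N))" if "i < n" for i unfolding w_def by simp
  have w1: "\<bar>w i v\<bar> \<le> 1" if "i < n" for i v using n unfolding w_def by simp
  have w2: "(\<Sum>i<n. (w i v)\<^sup>2) \<le> 1" for v using n unfolding w_def by (simp add: power_divide)
  have m: "(\<integral>x. h () * f x \<partial>D) = 0" if "h \<in> borel_measurable ?N" "\<And>t. \<bar>h t\<bar> \<le> 1" for h :: "unit \<Rightarrow> real"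
    using mean by simp
  have v: "(\<integral>x. h () * (f x)\<^sup>2 \<partial>D) \<le> S * (\<integral>x. h () \<partial>D)"
    if "h \<in> borel_measurable ?N" "\<And>t. 0 \<le> h t \<and> h t \<le> 1" for h :: "unit \<Rightarrow> real"
    using mult_left_mono[OF var, of "h ()"] that by (simp add: prob_space mult.commute)
  have \<tau>: "(\<lambda>_. ()) \<in> measurable D ?N" by simp
  have *: "integrable (PiM {..<n} (\<lambda>_. D)) (\<lambda>s. (\<Sum>i<n. w i (\<lambda>i\<in>{..<n}. ()) * f (s i))\<^sup>2)"
    by (rule second_moment_weighted_sum(1)[where N = ?N and S = S and \<tau> = "\<lambda>_. ()"]) (fact D \<tau> f m v S w w1 w2)+
  have **: "(\<integral>s. (\<Sum>i<n. w i (\<lambda>i\<in>{..<n}. ()) * f (s i))\<^sup>2 \<partial>PiM {..<n} (\<lambda>_. D)) \<le> S"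
    by (rule second_moment_weighted_sum(2)[where N = ?N and S = S and \<tau> = "\<lambda>_. ()"]) (fact D \<tau> f m v S w w1 w2)+
  have eq: "((\<Sum>i<n. f (s i)) / real n)\<^sup>2 = (\<Sum>i<n. f (s i) / sqrt (real n))\<^sup>2 / real n" for s :: "nat \<Rightarrow> 'o"
    using n by (simp add: power_divide power2_eq_square flip: sum_divide_distrib)
  show "integrable (PiM {..<n} (\<lambda>_. D)) (\<lambda>s. ((\<Sum>i<n. f (s i)) / real n)\<^sup>2)"
    unfolding eq using * unfolding w_def by simp
  show "(\<integral>s. ((\<Sum>i<n. f (s i)) / real n)\<^sup>2 \<partial>PiM {..<n} (\<lambda>_. D)) \<le> S / real n"
    unfolding eq using ** n unfolding w_def by (simp add: divide_right_mono)
qed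

text \<open>Measurability is included because a nonmeasurable set has \<open>measure\<close> 0 by
  default, which would make the bound alone meaningless.\<close>

definition event_prob_le :: "'a measure \<Rightarrow> 'a set \<Rightarrow> real \<Rightarrow> bool" where
  "event_prob_le M A b \<longleftrightarrow> A \<in> sets M \<and> measure M A \<le> b"

lemma markov_sum:
  fixes \<Phi> :: "'b \<Rightarrow> 'a \<Rightarrow> real"
  assumes "prob_space M" "finite J" and int: "\<And>j. j \<in> J \<Longrightarrow> integrable M (\<Phi> j)"
    and bound: "\<And>j. j \<in> J \<Longrightarrow> (\<integral>x. \<Phi> j x \<partial>M) \<le> S" and nonneg: "\<And>j x. 0 \<le> \<Phi> j x" and c: "c > 0"
  shows "event_prob_le M {x\<in>space M. c \<le> (\<Sum>j\<in>J. \<Phi> j x)} (real (card J) * S / c)"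
proof -
  interpret prob_space M by fact
  have "(\<lambda>x. \<Sum>j\<in>J. \<Phi> j x) \<in> borel_measurable M"
    using int by (intro borel_measurable_integrable Bochner_Integration.integrable_sum)
  then have meas: "{x\<in>space M. c \<le> (\<Sum>j\<in>J. \<Phi> j x)} \<in> sets M" by measurable
  have "measure M {x\<in>space M. c \<le> (\<Sum>j\<in>J. \<Phi> j x)} \<le> (\<integral>x. (\<Sum>j\<in>J. \<Phi> j x) \<partial>M) / c"
    using int nonneg c by (intro integral_Markov_inequality_measure[where A = "{}"]) (auto intro!: sum_nonneg)
  also have "(\<integral>x. (\<Sum>j\<in>J. \<Phi> j x) \<partial>M) = (\<Sum>j\<in>J. \<integral>x. \<Phi> j x \<partial>M)"
    using int by (intro Bochner_Integration.integral_sum) auto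
  also have "\<dots> / c \<le> real (card J) * S / c"
    using sum_bounded_above[of J "\<lambda>j. \<integral>x. \<Phi> j x \<partial>M" S] bound c by (intro divide_right_mono) auto
  finally show ?thesis using meas unfolding event_prob_le_def by simp
qed


section \<open>Probability of the good event\<close>

text \<open>An observation is \<open>((x, t), y)\<close>. Responses do not enter, so the basis is
  independent of the noise.\<close>

definition sample_basis ::
    "nat \<Rightarrow> nat \<Rightarrow> (nat \<Rightarrow> real \<Rightarrow> real) \<Rightarrow> (nat \<Rightarrow> ((nat \<Rightarrow> real) \<times> real) \<times> real) \<Rightarrow> nat \<Rightarrow> nat \<Rightarrow> real" where
  "sample_basis n q B s = orthonormalize n
     (design_columns q (\<lambda>i l. B l (snd (fst (s i)))) (\<lambda>i j. fst (fst (s i)) j))"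

context
  fixes D :: "(((nat \<Rightarrow> real) \<times> real) \<times> real) measure" and p q n :: nat and B :: "nat \<Rightarrow> real \<Rightarrow> real"
  assumes D: "prob_space D" and sets_D: "sets D = sets (obs_space p)" and n: "n \<ge> 1"
    and B: "\<And>l. l < q \<Longrightarrow> B l \<in> borel_measurable borel"
begin

interpretation D: prob_space D by (rule D)

lemma measurable_fst_obs: "fst \<in> measurable D (covariate_space p)"
  unfolding measurable_cong_sets[OF sets_D refl] obs_space_def by simp

lemma measurable_covariate_time: "snd \<in> borel_measurable (covariate_space p)"
  unfolding covariate_space_def by simp

lemma measurable_covariate_component:
  assumes "j < p"
  shows "(\<lambda>v. fst v j) \<in> borel_measurable (covariate_space p)"
  unfolding covariate_space_def
  by (rule measurable_compose[OF measurable_fst measurable_component_singleton]) (use assms in auto)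

lemma bounded_second_moment:
  assumes [measurable]: "f \<in> borel_measurable D" and R: "AE x in D. \<bar>f x\<bar> \<le> R"
  shows "integrable D (\<lambda>x. (f x)\<^sup>2)"
    and "h \<in> borel_measurable N \<Longrightarrow> \<tau> \<in> measurable D N \<Longrightarrow> (\<And>t. 0 \<le> h t \<and> h t \<le> (1::real)) \<Longrightarrow>
      (\<integral>x. h (\<tau> x) * (f x)\<^sup>2 \<partial>D) \<le> R\<^sup>2 * (\<integral>x. h (\<tau> x) \<partial>D)"
proof -
  have sq: "AE x in D. (f x)\<^sup>2 \<le> R\<^sup>2"
    using R
  proof eventually_elim
    fix x assume "\<bar>f x\<bar> \<le> R"
    from power_mono[OF this, of 2] show "(f x)\<^sup>2 \<le> R\<^sup>2" by simp
  qed
  then show int: "integrable D (\<lambda>x. (f x)\<^sup>2)"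
    by (intro D.integrable_const_bound[where B = "R\<^sup>2"]) auto
  assume [measurable]: "h \<in> borel_measurable N" "\<tau> \<in> measurable D N" and h: "\<And>t. 0 \<le> h t \<and> h t \<le> 1"
  have hi: "integrable D (\<lambda>x. h (\<tau> x))" using h by (intro D.integrable_const_bound[where B = 1]) auto
  have "(\<integral>x. h (\<tau> x) * (f x)\<^sup>2 \<partial>D) \<le> (\<integral>x. h (\<tau> x) * R\<^sup>2 \<partial>D)"
  proof (rule integral_mono_AE)
    show "integrable D (\<lambda>x. h (\<tau> x) * (f x)\<^sup>2)"
      by (rule Bochner_Integration.integrable_bound[OF int])
         (use h in \<open>auto simp: abs_mult intro!: mult_left_le_one_le\<close>)
    show "AE x in D. h (\<tau> x) * (f x)\<^sup>2 \<le> h (\<tau> x) * R\<^sup>2"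
      using sq by eventually_elim (use h in \<open>auto intro!: mult_left_mono\<close>)
  qed (use hi in simp)
  then show "(\<integral>x. h (\<tau> x) * (f x)\<^sup>2 \<partial>D) \<le> R\<^sup>2 * (\<integral>x. h (\<tau> x) \<partial>D)" by (simp add: mult.commute)
qed

text \<open>For \<open>l < q\<close> the basis vector is a function of the times alone, and given
  these the residuals are centred and bounded. Each of the \<open>q * p\<close> components has
  second moment at most \<open>R\<^sup>2\<close>; Markov's inequality does the rest.\<close>

lemma prob_spline_residual_correlation:
  fixes E :: "nat \<Rightarrow> ((nat \<Rightarrow> real) \<times> real) \<times> real \<Rightarrow> real"
  assumes E: "\<And>j. j < p \<Longrightarrow> E j \<in> borel_measurable D"
    and mean: "\<And>j h. j < p \<Longrightarrow> h \<in> borel_measurable borel \<Longrightarrow> (\<And>t. \<bar>h t\<bar> \<le> 1) \<Longrightarrow>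
        (\<integral>x. h (snd (fst x)) * E j x \<partial>D) = 0"
    and R: "\<And>j. j < p \<Longrightarrow> AE x in D. \<bar>E j x\<bar> \<le> R" and c: "c > 0"
  shows "event_prob_le (PiM {..<n} (\<lambda>_. D)) {s \<in> space (PiM {..<n} (\<lambda>_. D)).
      c \<le> (\<Sum>l<q. \<Sum>j<p. (ip n (sample_basis n q B s l) (\<lambda>i. E j (s i)))\<^sup>2)}
      (real (q * p) * R\<^sup>2 / c)"
proof -
  have \<tau>: "(\<lambda>x. snd (fst x)) \<in> measurable D borel"
    by (rule measurable_compose[OF measurable_fst_obs measurable_covariate_time])
  define z :: "(nat \<Rightarrow> real) \<Rightarrow> nat \<Rightarrow> nat \<Rightarrow> real" where "z v k i = B k (v i)" for v k i
  have z: "(\<lambda>v. z v k i) \<in> borel_measurable (PiM {..<n} (\<lambda>_. borel))" if "k < q" "i < n" for k i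
    unfolding z_def
    by (rule measurable_compose[OF measurable_component_singleton[of i "{..<n}" "\<lambda>_. borel"] B[OF that(1)]])
       (use that in auto)
  have eq: "ip n (sample_basis n q B s l) w = ip n (orthonormalize n (z (\<lambda>i\<in>{..<n}. snd (fst (s i)))) l) w"
    if "l < q" for s l w
    unfolding sample_basis_def
    by (intro ip_cong orthonormalize_cong) (use that in \<open>auto simp: design_columns_def z_def\<close>)
  have "event_prob_le (PiM {..<n} (\<lambda>_. D)) {s \<in> space (PiM {..<n} (\<lambda>_. D)).
      c \<le> (\<Sum>x\<in>{..<q}\<times>{..<p}. (ip n (sample_basis n q B s (fst x)) (\<lambda>i. E (snd x) (s i)))\<^sup>2)}
      (real (card ({..<q}\<times>{..<p})) * R\<^sup>2 / c)"
  proof (rule markov_sum[OF prob_space_PiM[OF D]])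
    fix x :: "nat \<times> nat" assume x: "x \<in> {..<q}\<times>{..<p}"
    obtain l j where lj: "x = (l, j)" "l < q" "j < p" using x by (cases x) auto
    note bd = bounded_second_moment[OF E[OF lj(3)] R[OF lj(3)]]
    show "integrable (PiM {..<n} (\<lambda>_. D)) (\<lambda>s. (ip n (sample_basis n q B s (fst x)) (\<lambda>i. E (snd x) (s i)))\<^sup>2)"
      unfolding lj fst_conv snd_conv eq[OF lj(2)]
      by (rule second_moment_component_sum(1)[where N = borel and S = "R\<^sup>2" and \<tau> = "\<lambda>x. snd (fst x)"])
         (use D \<tau> E lj bd mean[OF lj(3)] bd(2)[OF _ \<tau>] z in auto)
    show "(\<integral>s. (ip n (sample_basis n q B s (fst x)) (\<lambda>i. E (snd x) (s i)))\<^sup>2 \<partial>PiM {..<n} (\<lambda>_. D)) \<le> R\<^sup>2"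
      unfolding lj fst_conv snd_conv eq[OF lj(2)]
      by (rule second_moment_component_sum(2)[where N = borel and S = "R\<^sup>2" and \<tau> = "\<lambda>x. snd (fst x)"])
         (use D \<tau> E lj bd mean[OF lj(3)] bd(2)[OF _ \<tau>] z in auto)
  qed (use c in auto)
  then show ?thesis by (simp add: sum.cartesian_product case_prod_unfold)
qed

text \<open>Products of two residuals are bounded by \<open>R\<^sup>2\<close>, so each of the
  \<open>p * p\<close> empirical entries has variance at most \<open>R ^ 4 / n\<close>.\<close>

lemma prob_empirical_covariance:
  fixes E :: "nat \<Rightarrow> ((nat \<Rightarrow> real) \<times> real) \<times> real \<Rightarrow> real"
  assumes E: "\<And>j. j < p \<Longrightarrow> E j \<in> borel_measurable D"
    and R: "\<And>j. j < p \<Longrightarrow> AE x in D. \<bar>E j x\<bar> \<le> R" and c: "c > 0"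
    and \<Xi>: "\<And>j l. j < p \<Longrightarrow> l < p \<Longrightarrow> \<Xi> j l = (\<integral>x. E j x * E l x \<partial>D)"
  shows "event_prob_le (PiM {..<n} (\<lambda>_. D)) {s \<in> space (PiM {..<n} (\<lambda>_. D)).
      c \<le> (\<Sum>j<p. \<Sum>l<p. ((\<Sum>i<n. E j (s i) * E l (s i)) / real n - \<Xi> j l)\<^sup>2)}
      (real (p * p) * (R ^ 4 / real n) / c)"
proof -
  have "event_prob_le (PiM {..<n} (\<lambda>_. D)) {s \<in> space (PiM {..<n} (\<lambda>_. D)).
      c \<le> (\<Sum>x\<in>{..<p}\<times>{..<p}. ((\<Sum>i<n. E (fst x) (s i) * E (snd x) (s i)) / real n - \<Xi> (fst x) (snd x))\<^sup>2)}
      (real (card ({..<p}\<times>{..<p})) * (R ^ 4 / real n) / c)"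
  proof (rule markov_sum[OF prob_space_PiM[OF D]])
    fix x :: "nat \<times> nat" assume x: "x \<in> {..<p}\<times>{..<p}"
    obtain j l where jl: "x = (j, l)" "j < p" "l < p" using x by (cases x) auto
    note [measurable] = E[OF jl(2)] E[OF jl(3)]
    define f where "f x = E j x * E l x - \<Xi> j l" for x
    have bd: "AE x in D. \<bar>E j x * E l x\<bar> \<le> R\<^sup>2"
      using R[OF jl(2)] R[OF jl(3)]
      by eventually_elim (auto simp: abs_mult power2_eq_square intro!: mult_mono)
    have int: "integrable D (\<lambda>x. E j x * E l x)"
      using bd by (intro D.integrable_const_bound[where B = "R\<^sup>2"]) auto
    have int2: "integrable D (\<lambda>x. (E j x * E l x)\<^sup>2)"
      by (rule bounded_second_moment(1)[OF _ bd]) simp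
    have f2: "(f x)\<^sup>2 = (E j x * E l x)\<^sup>2 - 2 * \<Xi> j l * (E j x * E l x) + (\<Xi> j l)\<^sup>2" for x
      unfolding f_def by (simp add: power2_eq_square algebra_simps)
    have f_int: "integrable D (\<lambda>x. (f x)\<^sup>2)"
      unfolding f2 using int int2 by (intro Bochner_Integration.integrable_add Bochner_Integration.integrable_diff integrable_mult_right) auto
    have f_mean: "(\<integral>x. f x \<partial>D) = 0"
      unfolding f_def using int \<Xi>[OF jl(2,3)] by (simp add: D.prob_space)
    have "(\<integral>x. (f x)\<^sup>2 \<partial>D) = (\<integral>x. (E j x * E l x)\<^sup>2 \<partial>D) - 2 * \<Xi> j l * (\<integral>x. E j x * E l x \<partial>D) + (\<Xi> j l)\<^sup>2"
      unfolding f2 using int int2 by (simp add: D.prob_space mult.assoc)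
    also have "\<dots> \<le> (\<integral>x. (E j x * E l x)\<^sup>2 \<partial>D)"
      unfolding \<Xi>[OF jl(2,3), symmetric] by (simp add: power2_eq_square)
    also have "\<dots> \<le> (\<integral>x. (R\<^sup>2)\<^sup>2 \<partial>D)"
    proof (rule integral_mono_AE[OF int2])
      show "AE x in D. (E j x * E l x)\<^sup>2 \<le> (R\<^sup>2)\<^sup>2"
        using bd
      proof eventually_elim
        fix x assume "\<bar>E j x * E l x\<bar> \<le> R\<^sup>2"
        from power_mono[OF this, of 2] show "(E j x * E l x)\<^sup>2 \<le> (R\<^sup>2)\<^sup>2" by simp
      qed
    qed simp
    finally have f_var: "(\<integral>x. (f x)\<^sup>2 \<partial>D) \<le> R ^ 4" by (simp add: D.prob_space flip: power_mult)
    have eq: "(\<Sum>i<n. E j (s i) * E l (s i)) / real n - \<Xi> j l = (\<Sum>i<n. f (s i)) / real n" for s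
      using n unfolding f_def by (simp add: sum_subtractf field_simps)
    have f_meas: "f \<in> borel_measurable D" unfolding f_def by simp
    note * = second_moment_iid_mean[OF D f_meas f_int f_mean f_var n]
    show "integrable (PiM {..<n} (\<lambda>_. D)) (\<lambda>s. ((\<Sum>i<n. E (fst x) (s i) * E (snd x) (s i)) / real n - \<Xi> (fst x) (snd x))\<^sup>2)"
      unfolding jl fst_conv snd_conv eq by (rule *(1))
    show "(\<integral>s. ((\<Sum>i<n. E (fst x) (s i) * E (snd x) (s i)) / real n - \<Xi> (fst x) (snd x))\<^sup>2 \<partial>PiM {..<n} (\<lambda>_. D)) \<le> R ^ 4 / real n"
      unfolding jl fst_conv snd_conv eq by (rule *(2))
  qed (use c in auto)
  then show ?thesis by (simp add: sum.cartesian_product case_prod_unfold)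
qed

text \<open>The basis vectors from \<open>q\<close> to \<open>q + p - 1\<close> depend on times and
  covariates; the noise is centred given both, so here the conditioning variable is the whole
  covariate part of the observation.\<close>

lemma prob_noise_components:
  fixes u :: "((nat \<Rightarrow> real) \<times> real) \<times> real \<Rightarrow> real"
  assumes u: "u \<in> borel_measurable D" "integrable D (\<lambda>x. (u x)\<^sup>2)"
    and mean: "\<And>h. h \<in> borel_measurable (covariate_space p) \<Longrightarrow> (\<And>t. \<bar>h t\<bar> \<le> 1) \<Longrightarrow>
        (\<integral>x. h (fst x) * u x \<partial>D) = 0"
    and var: "\<And>h. h \<in> borel_measurable (covariate_space p) \<Longrightarrow> (\<And>t. 0 \<le> h t \<and> h t \<le> 1) \<Longrightarrow>
        (\<integral>x. h (fst x) * (u x)\<^sup>2 \<partial>D) \<le> S * (\<integral>x. h (fst x) \<partial>D)"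
    and S: "S \<ge> 0" and c: "c > 0"
  shows "event_prob_le (PiM {..<n} (\<lambda>_. D)) {s \<in> space (PiM {..<n} (\<lambda>_. D)).
      c \<le> (\<Sum>l=q..<q+p. (ip n (sample_basis n q B s l) (\<lambda>i. u (s i)))\<^sup>2)}
      (real p * S / c)"
proof -
  define z :: "(nat \<Rightarrow> (nat \<Rightarrow> real) \<times> real) \<Rightarrow> nat \<Rightarrow> nat \<Rightarrow> real"
    where "z v = design_columns q (\<lambda>i l. B l (snd (v i))) (\<lambda>i j. fst (v i) j)" for v
  have z: "(\<lambda>v. z v k i) \<in> borel_measurable (PiM {..<n} (\<lambda>_. covariate_space p))" if "k < q + p" "i < n" for k i
  proof (cases "k < q")
    case True
    have "(\<lambda>v. v i) \<in> measurable (PiM {..<n} (\<lambda>_. covariate_space p)) (covariate_space p)"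
      using that by (intro measurable_component_singleton) auto
    from measurable_compose[OF measurable_compose[OF this measurable_covariate_time] B[OF True]]
    show ?thesis using True by (simp add: z_def design_columns_def)
  next
    case False
    have "(\<lambda>v. v i) \<in> measurable (PiM {..<n} (\<lambda>_. covariate_space p)) (covariate_space p)"
      using that by (intro measurable_component_singleton) auto
    from measurable_compose[OF this measurable_covariate_component[of "k - q"]]
    show ?thesis using False that by (simp add: z_def design_columns_def)
  qed
  have eq: "ip n (sample_basis n q B s l) w = ip n (orthonormalize n (z (\<lambda>i\<in>{..<n}. fst (s i))) l) w" for s l w
    unfolding sample_basis_def
    by (intro ip_cong orthonormalize_cong) (auto simp: design_columns_def z_def)
  have "event_prob_le (PiM {..<n} (\<lambda>_. D)) {s \<in> space (PiM {..<n} (\<lambda>_. D)).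
      c \<le> (\<Sum>l=q..<q+p. (ip n (sample_basis n q B s l) (\<lambda>i. u (s i)))\<^sup>2)}
      (real (card {q..<q+p}) * S / c)"
  proof (rule markov_sum[OF prob_space_PiM[OF D]])
    fix l assume l: "l \<in> {q..<q+p}"
    show "integrable (PiM {..<n} (\<lambda>_. D)) (\<lambda>s. (ip n (sample_basis n q B s l) (\<lambda>i. u (s i)))\<^sup>2)"
      unfolding eq
      by (rule second_moment_component_sum(1)[where N = "covariate_space p" and S = S and \<tau> = fst])
         (use D u S l mean var z measurable_fst_obs in auto)
    show "(\<integral>s. (ip n (sample_basis n q B s l) (\<lambda>i. u (s i)))\<^sup>2 \<partial>PiM {..<n} (\<lambda>_. D)) \<le> S"
      unfolding eq
      by (rule second_moment_component_sum(2)[where N = "covariate_space p" and S = S and \<tau> = fst])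
         (use D u S l mean var z measurable_fst_obs in auto)
  qed (use c in auto)
  then show ?thesis by simp
qed

end


section \<open>A finite-sample bound\<close>

text \<open>A spline is polynomial on finitely many intervals that cover [0,1]. Its values elsewhere
  are unrestricted and are replaced by 0.\<close>

lemma borel_measurable_spline:
  assumes "unit_partition M \<xi>" "f \<in> spline_space m M \<xi>"
  shows "(\<lambda>t. if t \<in> {0..1} then f t else 0) \<in> borel_measurable borel" (is "?f \<in> _")
proof (rule measurable_piecewise_restrict[where C = "insert (- {0..1}) (knot_interval M \<xi> ` {..M})"])
  have sub: "knot_interval M \<xi> \<nu> \<subseteq> {0..1}" if "\<nu> \<le> M" for \<nu>
  proof
    fix t assume "t \<in> knot_interval M \<xi> \<nu>"
    then have "t \<in> {\<xi> \<nu>..\<xi> (Suc \<nu>)}" using knot_interval_subset(1)[OF assms(1) that] by blast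
    then show "t \<in> {0..1}"
      using that unit_partition_range[OF assms(1), of \<nu>] unit_partition_range[OF assms(1), of "Suc \<nu>"] by simp
  qed
  show "\<Omega> \<inter> space borel \<in> sets borel" if "\<Omega> \<in> insert (- {0..1}) (knot_interval M \<xi> ` {..M})" for \<Omega>
    using that by (auto simp: knot_interval_def)
  show "space borel \<subseteq> \<Union> (insert (- {0..1}) (knot_interval M \<xi> ` {..M}))"
  proof
    fix t :: real
    show "t \<in> \<Union> (insert (- {0..1}) (knot_interval M \<xi> ` {..M}))"
    proof (cases "t \<in> {0..1}")
      case True
      then obtain \<nu> where "\<nu> \<le> M" "t \<in> knot_interval M \<xi> \<nu>" using knot_interval_cover[OF assms(1)] by blast
      then show ?thesis by blast
    qed simp
  qed
  fix \<Omega> assume "\<Omega> \<in> insert (- {0..1}) (knot_interval M \<xi> ` {..M})"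
  then consider "\<Omega> = - {0..1}" | \<nu> where "\<nu> \<le> M" "\<Omega> = knot_interval M \<xi> \<nu>" by auto
  then show "?f \<in> borel_measurable (restrict_space borel \<Omega>)"
  proof cases
    case 1
    have "(\<lambda>t::real. 0::real) \<in> borel_measurable (restrict_space borel \<Omega>)" by simp
    also have "?this \<longleftrightarrow> ?f \<in> borel_measurable (restrict_space borel \<Omega>)"
      using 1 by (intro measurable_cong) (auto simp: space_restrict_space)
    finally show ?thesis .
  next
    case 2
    obtain q :: "real poly" where q: "\<forall>t\<in>knot_interval M \<xi> \<nu>. f t = poly q t"
      using assms(2) 2(1) unfolding spline_space_def by blast
    have "poly q \<in> borel_measurable borel" by (intro borel_measurable_continuous_onI continuous_intros)
    then have "poly q \<in> borel_measurable (restrict_space borel \<Omega>)" by (rule measurable_restrict_space1)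
    also have "?this \<longleftrightarrow> ?f \<in> borel_measurable (restrict_space borel \<Omega>)"
      using 2 q sub[OF 2(1)] by (intro measurable_cong) (auto simp: space_restrict_space)
    finally show ?thesis .
  qed
qed simp

lemma holder_deriv_continuous:
  assumes "holder_deriv r \<gamma> L f" "\<gamma> > 0"
  shows "continuous_on {0..1} f"
proof -
  obtain D where D: "derivs_on_unit r f D"
      "\<forall>t1\<in>{0..1}. \<forall>t2\<in>{0..1}. \<bar>D r t2 - D r t1\<bar> \<le> L * \<bar>t2 - t1\<bar> powr \<gamma>"
    using assms(1) unfolding holder_deriv_def by blast
  have "continuous_on {0..1} (D r)"
    unfolding continuous_on_def
  proof
    fix x :: real assume x: "x \<in> {0..1}"
    have "((\<lambda>y. \<bar>y - x\<bar>) \<longlongrightarrow> \<bar>x - x\<bar>) (at x within {0..1})" by (intro tendsto_intros)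
    then have "((\<lambda>y. \<bar>y - x\<bar> powr \<gamma>) \<longlongrightarrow> 0) (at x within {0..1})"
      using tendsto_zero_powrI[of "\<lambda>y. \<bar>y - x\<bar>" "at x within {0..1}" "\<lambda>y. \<gamma>" \<gamma>] assms(2) by simp
    then have lim: "((\<lambda>y. L * \<bar>y - x\<bar> powr \<gamma>) \<longlongrightarrow> 0) (at x within {0..1})"
      by (rule tendsto_mult_right_zero)
    have ev: "\<forall>\<^sub>F y in at x within {0..1}. norm (D r y - D r x) \<le> L * \<bar>y - x\<bar> powr \<gamma>"
      using D(2) x by (auto simp: eventually_at_topological)
    have "((\<lambda>y. D r y - D r x) \<longlongrightarrow> 0) (at x within {0..1})" by (rule Lim_null_comparison[OF ev lim])
    then show "(D r \<longlongrightarrow> D r x) (at x within {0..1})" by (simp add: LIM_zero_iff)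
  qed
  then show ?thesis by (rule continuous_on_derivs_0[OF D(1)])
qed

lemma borel_measurable_cut:
  fixes f :: "real \<Rightarrow> real"
  assumes "continuous_on {0..1} f"
  shows "(\<lambda>t. if t \<in> {0..1} then f t else 0) \<in> borel_measurable borel"
  using assms by (intro borel_measurable_continuous_on_if) auto

lemma basis_approx_of_spline_approx:
  assumes "local_spline_basis m M \<xi> B" "\<exists>s\<in>spline_space m M \<xi>. \<forall>t\<in>{0..1}. \<bar>f t - s t\<bar> \<le> d"
  shows "\<exists>b. \<forall>t\<in>{0..1}. \<bar>f t - (\<Sum>l<M + m. b l * B l t)\<bar> \<le> d"
proof -
  obtain s where s: "s \<in> spline_space m M \<xi>" "\<forall>t\<in>{0..1}. \<bar>f t - s t\<bar> \<le> d" using assms(2) by blast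
  obtain b where "\<forall>t\<in>{0..1}. s t = (\<Sum>l<M + m. b l * B l t)"
    using assms(1) s(1) unfolding local_spline_basis_def by blast
  with s(2) show ?thesis by (intro exI[of _ b]) auto
qed

lemma measurable_obs:
  assumes "\<And>j. j < p \<Longrightarrow> X j \<in> borel_measurable N" "T \<in> borel_measurable N" "Y \<in> borel_measurable N"
  shows "obs p X T Y \<in> measurable N (obs_space p)"
  unfolding obs_def covariates_def obs_space_def covariate_space_def
  using assms by (intro measurable_Pair measurable_restrict) auto

lemma AE_PiM_all_components:
  fixes n :: nat
  assumes D: "prob_space D" and AE: "AE x in D. R x"
  shows "AE s in PiM {..<n} (\<lambda>_. D). \<forall>i<n. R (s i)"
proof -
  have "AE s in PiM {..<n} (\<lambda>_. D). R (s i)" if "i < n" for i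
    by (rule AE_PiM_component[of "{..<n}" "\<lambda>_. D", OF D _ AE]) (use that in auto)
  then have "AE s in PiM {..<n} (\<lambda>_. D). \<forall>i\<in>{..<n}. R (s i)"
    by (intro AE_finite_allI finite_lessThan) auto
  then show ?thesis by (simp add: Ball_def)
qed

text \<open>The three terms subtracted from 1 bound the probabilities that, respectively, residuals
  correlate with splines, the empirical covariance is off, or the noise components are large. The
  events are estimated under the product law of one observation and pulled back to \<open>Q\<close>
  along the sample.\<close>

lemma estimator_zero_finite_sample:
  fixes P :: "'a measure" and Q :: "'b measure" and X :: "nat \<Rightarrow> 'a \<Rightarrow> real" and T \<epsilon> Y :: "'a \<Rightarrow> real"
    and Xs :: "nat \<Rightarrow> nat \<Rightarrow> 'b \<Rightarrow> real" and Ts Ys :: "nat \<Rightarrow> 'b \<Rightarrow> real"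
    and n p k M m :: nat and a lam c d \<eta> R \<sigma> b0 :: real and \<beta> :: "nat \<Rightarrow> real" and g :: "real \<Rightarrow> real"
    and \<theta> B :: "nat \<Rightarrow> real \<Rightarrow> real" and bh ch :: "nat \<Rightarrow> 'b \<Rightarrow> real"
  assumes P: "prob_space P" and n: "n \<ge> 1" and p: "1 \<le> p" "k \<le> p"
    and X: "\<And>j. j < p \<Longrightarrow> integrable P (X j)"
    and T: "T \<in> borel_measurable P" "\<And>\<omega>. \<omega> \<in> space P \<Longrightarrow> T \<omega> \<in> {0..1}"
    and ind: "indep_rv P borel \<epsilon> (covariate_space p) (covariates p X T)"
    and \<epsilon>: "integrable P \<epsilon>" "prob_space.expectation P \<epsilon> = 0" "integrable P (\<lambda>\<omega>. (\<epsilon> \<omega>)\<^sup>2)"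
      "prob_space.variance P \<epsilon> = \<sigma>\<^sup>2"
    and Y: "\<And>\<omega>. Y \<omega> = (\<Sum>j<p. X j \<omega> * \<beta> j) + g (T \<omega>) + \<epsilon> \<omega>"
    and \<beta>0: "\<And>j. k \<le> j \<Longrightarrow> j < p \<Longrightarrow> \<beta> j = 0" and \<beta>1: "\<And>j. j < k \<Longrightarrow> b0 \<le> \<bar>\<beta> j\<bar>"
    and Q: "prob_space Q"
    and iid: "prob_space.indep_vars Q (\<lambda>i. obs_space p) (\<lambda>i. obs p (Xs i) (Ts i) (Ys i)) {..<n}"
      "\<And>i. i < n \<Longrightarrow> distr Q (obs_space p) (obs p (Xs i) (Ts i) (Ys i)) = distr P (obs_space p) (obs p X T Y)"
    and part: "unit_partition M \<xi>" and basis: "local_spline_basis m M \<xi> B"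
    and a: "a > 2" and lam: "lam > 0"
    and bh: "\<And>j. j < p \<Longrightarrow> bh j \<in> borel_measurable Q"
    and min: "AE \<omega> in Q. scad_minimizer a lam n p (M + m) (\<lambda>i j. Xs i j \<omega>) (\<lambda>i l. B l (Ts i \<omega>)) (\<lambda>i. Ys i \<omega>)
        (\<lambda>j. bh j \<omega>) (\<lambda>l. ch l \<omega>)"
    and \<theta>: "\<And>j. j < p \<Longrightarrow> AE \<omega> in P. cond_mean P T (X j) \<omega> = \<theta> j (T \<omega>)"
      "\<And>j. j < p \<Longrightarrow> continuous_on {0..1} (\<theta> j)" and g: "continuous_on {0..1} g"
    and \<theta>_approx: "\<And>j. j < p \<Longrightarrow> \<exists>s\<in>spline_space m M \<xi>. \<forall>t\<in>{0..1}. \<bar>\<theta> j t - s t\<bar> \<le> d"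
    and g_approx: "\<exists>s\<in>spline_space m M \<xi>. \<forall>t\<in>{0..1}. \<bar>g t - s t\<bar> \<le> \<eta> * lam"
    and R: "\<And>j. j < p \<Longrightarrow> AE \<omega> in P. \<bar>cond_resid P T (X j) \<omega>\<bar> \<le> R"
    and c: "0 < c" "c \<le> min_eigenvalue (Xi_mat P T X p)" and \<eta>: "\<eta> > 0"
    and d: "0 \<le> d" "d \<le> 1" "real p * d\<^sup>2 \<le> c / 8"
    and S1: "a * lam < b0" "16 * \<eta>\<^sup>2 * lam\<^sup>2 + (a + 1) * real k * lam\<^sup>2 < c / 8 * (b0 - a * lam)\<^sup>2"
    and S2: "16 * \<eta>\<^sup>2 \<le> c / 8"
    and S3: "12 * \<eta> * sqrt (2 * R\<^sup>2 + 2) + 4 * \<eta> / sqrt (c / 8) * (2 * R\<^sup>2 + 2) < 1"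
  shows "1 - (real ((M + m) * p) * R\<^sup>2 / (real n * (c / 4)) + real (p * p) * (R ^ 4 / real n) / (c / 4)\<^sup>2
      + real p * \<sigma>\<^sup>2 / (real n * (\<eta> * lam)\<^sup>2)) \<le> measure Q {\<omega> \<in> space Q. \<forall>j\<in>{k..<p}. bh j \<omega> = 0}"
proof -
  interpret P: prob_space P by (rule P)
  interpret Q: prob_space Q by (rule Q)
  \<comment> \<open>The spline basis, \<open>\<theta>\<close> and \<open>g\<close> need not be measurable outside \<open>[0,1]\<close>.\<close>
  define cut :: "(real \<Rightarrow> real) \<Rightarrow> real \<Rightarrow> real" where "cut f t = (if t \<in> {0..1} then f t else 0)" for f t
  have cut_on: "cut f t = f t" if "t \<in> {0..1}" for f t using that by (simp add: cut_def)
  have \<theta>_m[measurable]: "cut (\<theta> j) \<in> borel_measurable borel" if "j < p" for j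
    using borel_measurable_cut[OF \<theta>(2)[OF that]] unfolding cut_def[abs_def] .
  have g_m[measurable]: "cut g \<in> borel_measurable borel"
    using borel_measurable_cut[OF g] unfolding cut_def[abs_def] .
  have B_m: "cut (B l) \<in> borel_measurable borel" if "l < M + m" for l
    using borel_measurable_spline[OF part, of "B l" m] basis that
    unfolding cut_def[abs_def] local_spline_basis_def by blast
  have X_m[measurable]: "X j \<in> borel_measurable P" if "j < p" for j using X[OF that] by simp
  have \<epsilon>_m[measurable]: "\<epsilon> \<in> borel_measurable P" using \<epsilon>(1) by simp
  note T_m[measurable] = T(1)
  have Y_m[measurable]: "Y \<in> borel_measurable P"
  proof -
    have "(\<lambda>\<omega>. (\<Sum>j<p. X j \<omega> * \<beta> j) + cut g (T \<omega>) + \<epsilon> \<omega>) \<in> borel_measurable P"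
      using X_m by (intro borel_measurable_add borel_measurable_sum borel_measurable_times) auto
    also have "?this \<longleftrightarrow> Y \<in> borel_measurable P"
      using T(2) by (intro measurable_cong) (simp add: Y cut_on)
    finally show ?thesis .
  qed
  define Ob where "Ob = obs p X T Y"
  have O_m[measurable]: "Ob \<in> measurable P (obs_space p)" unfolding Ob_def by (intro measurable_obs X_m T_m Y_m)
  define D where "D = distr P (obs_space p) Ob"
  have D: "prob_space D" unfolding D_def by (intro P.prob_space_distr O_m)
  have sets_D: "sets D = sets (obs_space p)" unfolding D_def by simp
  have D_m: "f \<in> borel_measurable D \<longleftrightarrow> f \<in> borel_measurable (obs_space p)" for f :: "_ \<Rightarrow> real"
    unfolding measurable_cong_sets[OF sets_D refl] ..
  \<comment> \<open>\<open>E\<close> and \<open>u\<close> recover residuals and noise from an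
    observation, so that both become functions on the observation space: \<open>E j\<close> agrees
    with the residual almost surely, through the version \<theta> of the conditional mean, and
    \<open>u\<close> with \<epsilon> everywhere on \<open>space P\<close>.\<close>
  define E where "E j x = fst (fst x) j - cut (\<theta> j) (snd (fst x))" for j and x :: "((nat \<Rightarrow> real) \<times> real) \<times> real"
  define u where "u x = snd x - (\<Sum>j<p. fst (fst x) j * \<beta> j) - cut g (snd (fst x))"
    for x :: "((nat \<Rightarrow> real) \<times> real) \<times> real"
  have comp_m: "(\<lambda>x. fst (fst x) j) \<in> borel_measurable (obs_space p)" if "j < p" for j
    unfolding obs_space_def covariate_space_def
    using measurable_compose[OF measurable_compose[OF measurable_fst measurable_fst] measurable_component_singleton[of j "{..<p}" "\<lambda>_. borel"]] that
    by simp
  have time_m[measurable]: "(\<lambda>x. snd (fst x)) \<in> borel_measurable (obs_space p)"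
    unfolding obs_space_def covariate_space_def by measurable
  have resp_m[measurable]: "snd \<in> borel_measurable (obs_space p)" unfolding obs_space_def by measurable
  have E_m: "E j \<in> borel_measurable (obs_space p)" if "j < p" for j
    unfolding E_def[abs_def] using comp_m[OF that] \<theta>_m[OF that] by measurable
  have u_m: "u \<in> borel_measurable (obs_space p)"
  proof -
    have "(\<lambda>x. \<Sum>j<p. fst (fst x) j * \<beta> j) \<in> borel_measurable (obs_space p)"
      using comp_m by (intro borel_measurable_sum borel_measurable_times) auto
    then show ?thesis unfolding u_def[abs_def]
      using measurable_compose[OF time_m g_m] resp_m by (intro borel_measurable_diff)
  qed
  have O_simps: "fst (fst (Ob \<omega>)) j = X j \<omega>" "snd (fst (Ob \<omega>)) = T \<omega>" "snd (Ob \<omega>) = Y \<omega>"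
    if "j < p" for j \<omega> using that unfolding Ob_def obs_def covariates_def by auto
  have EO: "AE \<omega> in P. E j (Ob \<omega>) = cond_resid P T (X j) \<omega>" if j: "j < p" for j
    using \<theta>(1)[OF j] AE_space
    by eventually_elim (use T(2) j in \<open>simp add: E_def O_simps cut_on cond_resid_def\<close>)
  have uO: "u (Ob \<omega>) = \<epsilon> \<omega>" if "\<omega> \<in> space P" for \<omega>
    using T(2)[OF that] p(1) O_simps(2,3)[of 0] O_simps(1) unfolding u_def by (simp add: cut_on Y)
  have resid_m[measurable]: "cond_resid P T (X j) \<in> borel_measurable P" if "j < p" for j
    using cond_resid_integrable[OF P T(1) X[OF that]] by simp
  have EO_m: "(\<lambda>\<omega>. E j (Ob \<omega>)) \<in> borel_measurable P" if "j < p" for j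
    by (rule measurable_compose[OF O_m E_m[OF that]])
  have E_mean: "(\<integral>x. h (snd (fst x)) * E j x \<partial>D) = 0"
    if "j < p" "h \<in> borel_measurable borel" "\<And>t. \<bar>h t\<bar> \<le> 1" for j h
  proof -
    have "(\<lambda>x. h (snd (fst x)) * E j x) \<in> borel_measurable (obs_space p)"
      using E_m[OF that(1)] measurable_compose[OF time_m that(2)] by (intro borel_measurable_times)
    then have "(\<integral>x. h (snd (fst x)) * E j x \<partial>D) = (\<integral>\<omega>. h (T \<omega>) * E j (Ob \<omega>) \<partial>P)"
      unfolding D_def using O_simps(2)[OF that(1)] by (subst integral_distr[OF O_m]) simp_all
    also have "\<dots> = (\<integral>\<omega>. h (T \<omega>) * cond_resid P T (X j) \<omega> \<partial>P)"
    proof (rule integral_cong_AE)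
      show "AE \<omega> in P. h (T \<omega>) * E j (Ob \<omega>) = h (T \<omega>) * cond_resid P T (X j) \<omega>"
        using EO[OF that(1)] by eventually_elim simp
    qed (use EO_m[OF that(1)] resid_m[OF that(1)] measurable_compose[OF T_m that(2)] in \<open>auto intro!: borel_measurable_times\<close>)
    also have "\<dots> = 0" by (rule cond_resid_orthogonal[OF P T(1) X[OF that(1)] that(2,3)])
    finally show ?thesis .
  qed
  have E_R: "AE x in D. \<bar>E j x\<bar> \<le> R" if "j < p" for j
    unfolding D_def
  proof (subst AE_distr_iff[OF O_m])
    show "{x \<in> space (obs_space p). \<bar>E j x\<bar> \<le> R} \<in> sets (obs_space p)"
      using E_m[OF that] by measurable
    show "AE \<omega> in P. \<bar>E j (Ob \<omega>)\<bar> \<le> R" using EO[OF that] R[OF that] by eventually_elim simp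
  qed
  define \<Xi> where "\<Xi> i j = (\<integral>\<omega>. cond_resid P T (X i) \<omega> * cond_resid P T (X j) \<omega> \<partial>P)" for i j
  have Xi_mat: "Xi_mat P T X p = Matrix.mat p p (\<lambda>(i, j). \<Xi> i j)"
    unfolding \<Xi>_def by (rule Xi_mat_entry[OF P T(1) X R])
  have \<Xi>_E: "\<Xi> i j = (\<integral>x. E i x * E j x \<partial>D)" if "i < p" "j < p" for i j
  proof -
    have "(\<integral>x. E i x * E j x \<partial>D) = (\<integral>\<omega>. E i (Ob \<omega>) * E j (Ob \<omega>) \<partial>P)"
      unfolding D_def using E_m that by (subst integral_distr[OF O_m]) (auto intro!: borel_measurable_times)
    also have "\<dots> = \<Xi> i j" unfolding \<Xi>_def
    proof (rule integral_cong_AE)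
      show "AE \<omega> in P. E i (Ob \<omega>) * E j (Ob \<omega>) = cond_resid P T (X i) \<omega> * cond_resid P T (X j) \<omega>"
        using EO[OF that(1)] EO[OF that(2)] by eventually_elim simp
    qed (use EO_m resid_m that in \<open>auto intro!: borel_measurable_times\<close>)
    finally show ?thesis ..
  qed
  have \<Xi>_sym: "\<Xi> i j = \<Xi> j i" for i j unfolding \<Xi>_def by (simp add: mult.commute)
  have \<Xi>_c: "c * (\<Sum>j<p. (v j)\<^sup>2) \<le> quad_form p \<Xi> v v" for v
  proof -
    have "c * (\<Sum>j<p. (v j)\<^sup>2) \<le> min_eigenvalue (Xi_mat P T X p) * (\<Sum>j<p. (v j)\<^sup>2)"
      by (intro mult_right_mono c sum_nonneg) simp
    also have "\<dots> \<le> quad_form p \<Xi> v v"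
      unfolding Xi_mat by (rule min_eigenvalue_le_quad_form(1)[OF \<Xi>_sym p(1)])
    finally show ?thesis .
  qed
  have cov_m: "covariates p X T \<in> measurable P (covariate_space p)" using ind unfolding indep_rv_def by blast
  have u_int: "integrable D (\<lambda>x. (u x)\<^sup>2)"
  proof -
    have "integrable P (\<lambda>\<omega>. (u (Ob \<omega>))\<^sup>2)"
      using \<epsilon>(3) uO by (simp cong: Bochner_Integration.integrable_cong)
    then show ?thesis unfolding D_def using u_m by (subst integrable_distr_eq[OF O_m]) auto
  qed
  \<comment> \<open>Taken with \<phi> the identity this gives the conditional centring of the noise,
    with \<phi> the square its conditional variance.\<close>
  have u_prod: "(\<integral>x. h (fst x) * \<phi> (u x) \<partial>D) = (\<integral>x. h (fst x) \<partial>D) * (\<integral>\<omega>. \<phi> (\<epsilon> \<omega>) \<partial>P)"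
    if h: "h \<in> borel_measurable (covariate_space p)" "\<And>t. \<bar>h t\<bar> \<le> 1"
      and \<phi>: "\<phi> \<in> borel_measurable borel" "integrable P (\<lambda>\<omega>. \<phi> (\<epsilon> \<omega>))" for h and \<phi> :: "real \<Rightarrow> real"
  proof -
    have hf: "(\<lambda>x. h (fst x)) \<in> borel_measurable (obs_space p)"
      unfolding obs_space_def by (rule measurable_compose[OF measurable_fst h(1)])
    have fO: "fst (Ob \<omega>) = covariates p X T \<omega>" for \<omega> unfolding Ob_def obs_def by simp
    have "(\<integral>x. h (fst x) * \<phi> (u x) \<partial>D) = (\<integral>\<omega>. h (covariates p X T \<omega>) * \<phi> (u (Ob \<omega>)) \<partial>P)"
      unfolding D_def fO[symmetric]
      using hf measurable_compose[OF u_m \<phi>(1)] by (intro integral_distr[OF O_m] borel_measurable_times)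
    also have "\<dots> = (\<integral>\<omega>. h (covariates p X T \<omega>) * \<phi> (\<epsilon> \<omega>) \<partial>P)"
      using uO by (intro Bochner_Integration.integral_cong) auto
    also have "\<dots> = (\<integral>\<omega>. h (covariates p X T \<omega>) \<partial>P) * (\<integral>\<omega>. \<phi> (\<epsilon> \<omega>) \<partial>P)"
      by (rule indep_rv_product[OF P ind h \<phi>])
    also have "(\<integral>\<omega>. h (covariates p X T \<omega>) \<partial>P) = (\<integral>x. h (fst x) \<partial>D)"
      unfolding D_def fO[symmetric] by (rule integral_distr[OF O_m hf, symmetric])
    finally show ?thesis .
  qed
  have u_mean: "(\<integral>x. h (fst x) * u x \<partial>D) = 0"
    if "h \<in> borel_measurable (covariate_space p)" "\<And>t. \<bar>h t\<bar> \<le> 1" for h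
    using u_prod[OF that, of "\<lambda>x. x"] \<epsilon>(1,2) by simp
  have \<epsilon>2: "(\<integral>\<omega>. (\<epsilon> \<omega>)\<^sup>2 \<partial>P) = \<sigma>\<^sup>2" using \<epsilon>(2,4) by simp
  have u_var: "(\<integral>x. h (fst x) * (u x)\<^sup>2 \<partial>D) \<le> \<sigma>\<^sup>2 * (\<integral>x. h (fst x) \<partial>D)"
    if "h \<in> borel_measurable (covariate_space p)" "\<And>t. 0 \<le> h t \<and> h t \<le> 1" for h
    using u_prod[OF that(1), of "\<lambda>x. x\<^sup>2"] that(2) \<epsilon>(3) \<epsilon>2 by (simp add: abs_le_iff order_trans[OF _ zero_le_one] order_trans[of "- _" 0 1] mult.commute)
  let ?\<Pi> = "PiM {..<n} (\<lambda>_. D)" and ?B = "\<lambda>l. cut (B l)" and ?q = "M + m"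
  define C1 where "C1 = {s \<in> space ?\<Pi>. real n * (c / 4) \<le> (\<Sum>l<?q. \<Sum>j<p. (ip n (sample_basis n ?q ?B s l) (\<lambda>i. E j (s i)))\<^sup>2)}"
  define C2 where "C2 = {s \<in> space ?\<Pi>. (c / 4)\<^sup>2 \<le> (\<Sum>j<p. \<Sum>l<p. ((\<Sum>i<n. E j (s i) * E l (s i)) / real n - \<Xi> j l)\<^sup>2)}"
  define C3 where "C3 = {s \<in> space ?\<Pi>. real n * (\<eta> * lam)\<^sup>2 \<le> (\<Sum>l=?q..<?q+p. (ip n (sample_basis n ?q ?B s l) (\<lambda>i. u (s i)))\<^sup>2)}"
  have C1: "event_prob_le ?\<Pi> C1 (real (?q * p) * R\<^sup>2 / (real n * (c / 4)))"
    unfolding C1_def using n c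
    by (intro prob_spline_residual_correlation[OF D sets_D n B_m _ E_mean E_R]) (auto simp: D_m E_m)
  have C2: "event_prob_le ?\<Pi> C2 (real (p * p) * (R ^ 4 / real n) / (c / 4)\<^sup>2)"
    unfolding C2_def using n c
    by (intro prob_empirical_covariance[OF D sets_D n B_m _ E_R _ \<Xi>_E]) (auto simp: D_m E_m)
  have C3: "event_prob_le ?\<Pi> C3 (real p * \<sigma>\<^sup>2 / (real n * (\<eta> * lam)\<^sup>2))"
    unfolding C3_def using n \<eta> lam
    by (intro prob_noise_components[OF D sets_D n B_m _ u_int u_mean u_var]) (auto simp: D_m u_m)
  define S where "S \<omega> = (\<lambda>i\<in>{..<n}. obs p (Xs i) (Ts i) (Ys i) \<omega>)" for \<omega>
  have obs_m: "obs p (Xs i) (Ts i) (Ys i) \<in> measurable Q (obs_space p)" if "i < n" for i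
    using iid(1) that unfolding Q.indep_vars_def by blast
  have sets_\<Pi>: "sets (PiM {..<n} (\<lambda>_. obs_space p)) = sets ?\<Pi>"
    by (intro sets_PiM_cong) (simp_all add: sets_D)
  have S_m: "S \<in> measurable Q ?\<Pi>"
    unfolding S_def measurable_cong_sets[OF refl sets_\<Pi>, symmetric]
    by (intro measurable_restrict obs_m) simp
  \<comment> \<open>Independence and the common marginal law say that the sample has the product
    law. The criterion requires a nonempty index set, here from \<open>n \<ge> 1\<close>.\<close>
  have "distr Q ?\<Pi> S = distr Q (PiM {..<n} (\<lambda>_. obs_space p)) S"
    by (intro distr_cong sets_\<Pi>[symmetric]) auto
  also have "\<dots> = PiM {..<n} (\<lambda>i. distr Q (obs_space p) (obs p (Xs i) (Ts i) (Ys i)))"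
    unfolding S_def
    by (rule Q.indep_vars_iff_distr_eq_PiM'[THEN iffD1, OF _ _ iid(1)]) (use n obs_m in \<open>auto simp: lessThan_empty_iff\<close>)
  also have "\<dots> = ?\<Pi>" using iid(2) unfolding D_def Ob_def by (intro PiM_cong) auto
  finally have distr_S: "distr Q ?\<Pi> S = ?\<Pi>" .
  have prob_S: "Q.prob (S -` C \<inter> space Q) \<le> b \<and> S -` C \<inter> space Q \<in> sets Q" if "event_prob_le ?\<Pi> C b" for C b
    using that measure_distr[OF S_m, of C] S_m unfolding event_prob_le_def distr_S by (auto intro: measurable_sets)
  have time_D: "AE x in D. snd (fst x) \<in> {0..1}"
    unfolding D_def
  proof (subst AE_distr_iff[OF O_m])
    show "AE \<omega> in P. snd (fst (Ob \<omega>)) \<in> {0..1}"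
      using AE_space by eventually_elim (use T(2) p O_simps(2)[of 0] in simp)
    show "{x \<in> space (obs_space p). snd (fst x) \<in> {0..1}} \<in> sets (obs_space p)"
      using time_m by measurable
  qed
  have "AE x in D. \<forall>j\<in>{..<p}. \<bar>E j x\<bar> \<le> R"
    by (intro AE_finite_allI finite_lessThan E_R) simp
  with time_D have "AE x in D. snd (fst x) \<in> {0..1} \<and> (\<forall>j<p. \<bar>E j x\<bar> \<le> R)" by eventually_elim auto
  from AE_PiM_all_components[OF D this, of n]
  have "AE s in distr Q ?\<Pi> S. \<forall>i<n. snd (fst (s i)) \<in> {0..1} \<and> (\<forall>j<p. \<bar>E j (s i)\<bar> \<le> R)"
    unfolding distr_S .
  from AE_distrD[OF S_m this]
  have S_AE: "AE \<omega> in Q. \<forall>i<n. snd (fst (S \<omega> i)) \<in> {0..1} \<and> (\<forall>j<p. \<bar>E j (S \<omega> i)\<bar> \<le> R)" .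
  have zero: "AE \<omega> in Q. S \<omega> \<notin> C1 \<longrightarrow> S \<omega> \<notin> C2 \<longrightarrow> S \<omega> \<notin> C3 \<longrightarrow> (\<forall>j\<in>{k..<p}. bh j \<omega> = 0)"
    using S_AE min AE_space
  proof eventually_elim
    fix \<omega> assume \<omega>: "\<omega> \<in> space Q"
      and min: "scad_minimizer a lam n p (M + m) (\<lambda>i j. Xs i j \<omega>) (\<lambda>i l. B l (Ts i \<omega>)) (\<lambda>i. Ys i \<omega>)
        (\<lambda>j. bh j \<omega>) (\<lambda>l. ch l \<omega>)"
      and S_ok: "\<forall>i<n. snd (fst (S \<omega> i)) \<in> {0..1} \<and> (\<forall>j<p. \<bar>E j (S \<omega> i)\<bar> \<le> R)"
    show "S \<omega> \<notin> C1 \<longrightarrow> S \<omega> \<notin> C2 \<longrightarrow> S \<omega> \<notin> C3 \<longrightarrow> (\<forall>j\<in>{k..<p}. bh j \<omega> = 0)"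
    proof (intro impI ballI)
      assume C: "S \<omega> \<notin> C1" "S \<omega> \<notin> C2" "S \<omega> \<notin> C3"
      fix j assume j: "j \<in> {k..<p}"
      define s where "s = S \<omega>"
      have s_space: "s \<in> space ?\<Pi>" unfolding s_def using measurable_space[OF S_m \<omega>] .
      have s: "fst (fst (s i)) j = Xs i j \<omega>" "snd (fst (s i)) = Ts i \<omega>" "snd (s i) = Ys i \<omega>" if "i < n" "j < p" for i j
        using that unfolding s_def S_def obs_def covariates_def by auto
      have s2: "snd (fst (s i)) = Ts i \<omega>" "snd (s i) = Ys i \<omega>" if "i < n" for i
        using s(2,3)[OF that, of 0] p(1) by auto
      have t01: "snd (fst (s i)) \<in> {0..1}" if "i < n" for i using S_ok that unfolding s_def by blast
      \<comment> \<open>All sampled times lie in [0,1], so cutting off the basis functions leaves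
        the criterion, and with it the minimizer, unchanged.\<close>
      have obj: "scad_objective a lam n p ?q (\<lambda>i j. fst (fst (s i)) j) (\<lambda>i l. cut (B l) (snd (fst (s i)))) (\<lambda>i. snd (s i)) b b'
          = scad_objective a lam n p ?q (\<lambda>i j. Xs i j \<omega>) (\<lambda>i l. B l (Ts i \<omega>)) (\<lambda>i. Ys i \<omega>) b b'" for b b'
      proof -
        have "snd (s i) - (\<Sum>j<p. fst (fst (s i)) j * b j) - (\<Sum>l<?q. cut (B l) (snd (fst (s i))) * b' l)
            = Ys i \<omega> - (\<Sum>j<p. Xs i j \<omega> * b j) - (\<Sum>l<?q. B l (Ts i \<omega>) * b' l)" if i: "i < n" for i
        proof -
          have "(\<Sum>j<p. fst (fst (s i)) j * b j) = (\<Sum>j<p. Xs i j \<omega> * b j)"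
            by (intro sum.cong refl) (simp add: s(1)[OF i])
          then show ?thesis using cut_on[OF t01[OF i]] by (simp add: s2[OF i])
        qed
        then show ?thesis unfolding scad_objective_def by simp
      qed
      have min': "scad_minimizer a lam n p ?q (\<lambda>i j. fst (fst (s i)) j) (\<lambda>i l. cut (B l) (snd (fst (s i)))) (\<lambda>i. snd (s i))
        (\<lambda>j. bh j \<omega>) (\<lambda>l. ch l \<omega>)"
        using min unfolding scad_minimizer_def obj .
      have approx: "\<exists>b. \<forall>i<n. \<bar>cut f (snd (fst (s i))) - (\<Sum>l<?q. b l * cut (B l) (snd (fst (s i))))\<bar> \<le> r"
        if f: "\<exists>s\<in>spline_space m M \<xi>. \<forall>t\<in>{0..1}. \<bar>f t - s t\<bar> \<le> r" for f r
      proof -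
        obtain b where b: "\<forall>t\<in>{0..1}. \<bar>f t - (\<Sum>l<M + m. b l * B l t)\<bar> \<le> r"
          using basis_approx_of_spline_approx[OF basis f] by blast
        have "\<bar>cut f (snd (fst (s i))) - (\<Sum>l<?q. b l * cut (B l) (snd (fst (s i))))\<bar> \<le> r" if "i < n" for i
          using b t01[OF that] by (simp add: cut_on[OF t01[OF that]])
        then show ?thesis by blast
      qed
      have W: "(\<Sum>l<?q. \<Sum>j<p. (ip n (sample_basis n ?q ?B s l) (\<lambda>i. E j (s i)))\<^sup>2) \<le> real n * (c / 4)"
        using C(1) s_space unfolding s_def[symmetric] C1_def by auto
      have W2: "(\<Sum>j<p. \<Sum>l<p. ((\<Sum>i<n. E j (s i) * E l (s i)) / real n - \<Xi> j l)\<^sup>2) \<le> (c / 4)\<^sup>2"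
        using C(2) s_space unfolding s_def[symmetric] C2_def by auto
      have W3: "(\<Sum>l=?q..<?q+p. (ip n (sample_basis n ?q ?B s l) (\<lambda>i. u (s i)))\<^sup>2) \<le> real n * (\<eta> * lam)\<^sup>2"
        using C(3) s_space unfolding s_def[symmetric] C3_def by auto
      show "bh j \<omega> = 0"
      proof (rule scad_estimator_zero[where n = n and k = k and p = p and q = ?q and \<beta> = \<beta> and R = R and d = d and \<Xi> = \<Xi>
            and x = "\<lambda>i j. fst (fst (s i)) j" and z = "\<lambda>i l. cut (B l) (snd (fst (s i)))" and y = "\<lambda>i. snd (s i)"
            and th = "\<lambda>i j. cut (\<theta> j) (snd (fst (s i)))" and E = "\<lambda>i j. E j (s i)"
            and g = "\<lambda>i. cut g (snd (fst (s i)))" and \<epsilon> = "\<lambda>i. u (s i)"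
            and bh = "\<lambda>j. bh j \<omega>" and ch = "\<lambda>l. ch l \<omega>", OF n p(2) a lam c(1) \<eta> _ min' _ _ _ _ _ W2 \<Xi>_c _ d \<beta>0 \<beta>1 S1 S2 S3])
        show "(\<Sum>l<?q. \<Sum>j<p. (ip n (orthonormalize n (design_columns ?q (\<lambda>i l. cut (B l) (snd (fst (s i)))) (\<lambda>i j. fst (fst (s i)) j)) l) (\<lambda>i. E j (s i)))\<^sup>2) \<le> real n * (c / 4)"
          using W unfolding sample_basis_def .
        show "(\<Sum>l=?q..<?q+p. (ip n (orthonormalize n (design_columns ?q (\<lambda>i l. cut (B l) (snd (fst (s i)))) (\<lambda>i j. fst (fst (s i)) j)) l) (\<lambda>i. u (s i)))\<^sup>2) \<le> real n * (\<eta> * lam)\<^sup>2"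
          using W3 unfolding sample_basis_def .
        show "snd (s i) = (\<Sum>j<p. fst (fst (s i)) j * \<beta> j) + cut g (snd (fst (s i))) + u (s i)" for i
          by (simp add: u_def)
        show "fst (fst (s i)) j = cut (\<theta> j) (snd (fst (s i))) + E j (s i)" for i j by (simp add: E_def)
        show "\<bar>E j (s i)\<bar> \<le> R" if "i < n" "j < p" for i j using S_ok that unfolding s_def by blast
        show "\<exists>b. \<forall>i<n. \<bar>cut (\<theta> j) (snd (fst (s i))) - (\<Sum>l<?q. b l * cut (B l) (snd (fst (s i))))\<bar> \<le> d" if "j < p" for j
          by (rule approx[OF \<theta>_approx[OF that]])
        show "\<exists>b. \<forall>i<n. \<bar>cut g (snd (fst (s i))) - (\<Sum>l<?q. b l * cut (B l) (snd (fst (s i))))\<bar> \<le> \<eta> * lam"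
          by (rule approx[OF g_approx])
      qed (use j in auto)
    qed
  qed
  define G where "G = {\<omega> \<in> space Q. \<forall>j\<in>{k..<p}. bh j \<omega> = 0}"
  have G_m: "G \<in> sets Q" unfolding G_def
  proof (intro sets.sets_Collect_finite_All)
    fix j assume "j \<in> {k..<p}"
    then have [measurable]: "bh j \<in> borel_measurable Q" using bh by simp
    show "{\<omega> \<in> space Q. bh j \<omega> = 0} \<in> sets Q" by measurable
  qed simp
  note P1 = prob_S[OF C1] and P2 = prob_S[OF C2] and P3 = prob_S[OF C3]
  let ?U = "(S -` C1 \<inter> space Q) \<union> ((S -` C2 \<inter> space Q) \<union> (S -` C3 \<inter> space Q))"
  have U_m: "?U \<in> sets Q" using P1 P2 P3 by blast
  have "1 - Q.prob ?U = Q.prob (space Q - ?U)" by (rule Q.prob_compl[OF U_m, symmetric])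
  also have "\<dots> \<le> Q.prob G"
  proof (rule Q.finite_measure_mono_AE[OF _ G_m])
    show "AE \<omega> in Q. \<omega> \<in> space Q - ?U \<longrightarrow> \<omega> \<in> G"
      using zero by eventually_elim (auto simp: G_def)
  qed
  finally have "1 - Q.prob ?U \<le> Q.prob G" .
  moreover have "Q.prob ?U \<le> Q.prob (S -` C1 \<inter> space Q) + (Q.prob (S -` C2 \<inter> space Q) + Q.prob (S -` C3 \<inter> space Q))"
  proof -
    have "Q.prob ?U \<le> Q.prob (S -` C1 \<inter> space Q) + Q.prob ((S -` C2 \<inter> space Q) \<union> (S -` C3 \<inter> space Q))"
      using P1 P2 P3 by (intro measure_Un_le) auto
    moreover have "Q.prob ((S -` C2 \<inter> space Q) \<union> (S -` C3 \<inter> space Q)) \<le> Q.prob (S -` C2 \<inter> space Q) + Q.prob (S -` C3 \<inter> space Q)"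
      using P2 P3 by (intro measure_Un_le) auto
    ultimately show ?thesis by linarith
  qed
  ultimately show ?thesis using P1 P2 P3 unfolding G_def by linarith
qed


section \<open>Letting the sample size grow\<close>

theorem theorem2:
  fixes P :: "'a measure"
    and X :: "nat \<Rightarrow> nat \<Rightarrow> 'a \<Rightarrow> real"
    and T \<epsilon> :: "'a \<Rightarrow> real"
    and Y :: "nat \<Rightarrow> 'a \<Rightarrow> real"
    and Q :: "nat \<Rightarrow> 'b measure"
    and Xs :: "nat \<Rightarrow> nat \<Rightarrow> nat \<Rightarrow> 'b \<Rightarrow> real"
    and Ts Ys :: "nat \<Rightarrow> nat \<Rightarrow> 'b \<Rightarrow> real"
    and g :: "real \<Rightarrow> real"
    and \<sigma> :: real
    and p k M :: "nat \<Rightarrow> nat"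
    and \<beta> :: "nat \<Rightarrow> nat \<Rightarrow> real"
    and m :: nat
    and \<xi> :: "nat \<Rightarrow> nat \<Rightarrow> real"
    and B :: "nat \<Rightarrow> nat \<Rightarrow> real \<Rightarrow> real"
    and a :: real
    and lam :: "nat \<Rightarrow> real"
    and \<beta>hat \<alpha>hat :: "nat \<Rightarrow> nat \<Rightarrow> 'b \<Rightarrow> real"
    and \<theta> :: "nat \<Rightarrow> nat \<Rightarrow> real \<Rightarrow> real"
    and e :: "nat \<Rightarrow> nat \<Rightarrow> 'a \<Rightarrow> real"
    and \<Xi> :: "nat \<Rightarrow> real mat"
    and r\<^sub>\<theta> r\<^sub>g :: nat
    and \<gamma>\<^sub>\<theta> L\<^sub>\<theta> s\<^sub>\<theta> \<gamma>\<^sub>g L\<^sub>g s\<^sub>g \<sigma>\<^sub>4 :: real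
    and K :: "real set"
    and c_lam c_beta :: ereal
  \<comment> \<open>population model\<close>
  assumes "prob_space P"
    and "\<And>n. n \<ge> 1 \<Longrightarrow> 1 \<le> k n \<and> k n \<le> p n"
    and "\<And>n j. n \<ge> 1 \<Longrightarrow> j < p n \<Longrightarrow> integrable P (X n j)"
    and "T \<in> borel_measurable P" and "\<And>\<omega>. \<omega> \<in> space P \<Longrightarrow> T \<omega> \<in> {0..1}"
    and "\<And>n. n \<ge> 1 \<Longrightarrow> indep_rv P borel \<epsilon> (covariate_space (p n)) (covariates (p n) (X n) T)"
    and "integrable P \<epsilon>" and "prob_space.expectation P \<epsilon> = 0"
    and "integrable P (\<lambda>\<omega>. (\<epsilon> \<omega>)\<^sup>2)" and "prob_space.variance P \<epsilon> = \<sigma>\<^sup>2"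
    and "\<And>n \<omega>. Y n \<omega> = (\<Sum>j<p n. X n j \<omega> * \<beta> n j) + g (T \<omega>) + \<epsilon> \<omega>"
    and "\<And>n j. n \<ge> 1 \<Longrightarrow> j < k n \<Longrightarrow> \<beta> n j \<noteq> 0"
    and "\<And>n j. n \<ge> 1 \<Longrightarrow> k n \<le> j \<Longrightarrow> j < p n \<Longrightarrow> \<beta> n j = 0"
  \<comment> \<open>for each sample size, the data are i.i.d. copies\<close>
    and "\<And>n. n \<ge> 1 \<Longrightarrow> prob_space (Q n)"
    and "\<And>n. n \<ge> 1 \<Longrightarrow>
           prob_space.indep_vars (Q n) (\<lambda>i. obs_space (p n))
             (\<lambda>i. obs (p n) (Xs n i) (Ts n i) (Ys n i)) {..<n}"
    and "\<And>n i. n \<ge> 1 \<Longrightarrow> i < n \<Longrightarrow>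
           distr (Q n) (obs_space (p n)) (obs (p n) (Xs n i) (Ts n i) (Ys n i)) =
           distr P (obs_space (p n)) (obs (p n) (X n) T (Y n))"
  \<comment> \<open>splines\<close>
    and "m \<ge> 1"
    and "\<And>n. n \<ge> 1 \<Longrightarrow> unit_partition (M n) (\<xi> n)"
    and "(\<lambda>n. mesh_size (M n) (\<xi> n)) \<in> O(\<lambda>n. 1 / real (M n))"
    and "\<And>n. n \<ge> 1 \<Longrightarrow> local_spline_basis m (M n) (\<xi> n) (B n)"
    and "(\<lambda>n. real (M n)) \<in> o(\<lambda>n. real n)"
  \<comment> \<open>estimator\<close>
    and "a > 2" and "\<And>n. n \<ge> 1 \<Longrightarrow> lam n > 0" and "lam \<longlonglongrightarrow> 0"
    and "\<And>n j. n \<ge> 1 \<Longrightarrow> j < p n \<Longrightarrow> \<beta>hat n j \<in> borel_measurable (Q n)"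
    and "\<And>n. n \<ge> 1 \<Longrightarrow> AE \<omega> in Q n.
           scad_minimizer a (lam n) n (p n) (M n + m)
             (\<lambda>i j. Xs n i j \<omega>) (\<lambda>i l. B n l (Ts n i \<omega>)) (\<lambda>i. Ys n i \<omega>)
             (\<lambda>j. \<beta>hat n j \<omega>) (\<lambda>l. \<alpha>hat n l \<omega>)"
  \<comment> \<open>conditional means, residuals and their covariance matrix\<close>
    and "\<And>n j. n \<ge> 1 \<Longrightarrow> j < p n \<Longrightarrow> AE \<omega> in P. cond_mean P T (X n j) \<omega> = \<theta> n j (T \<omega>)"
    and "\<And>n j. e n j = cond_resid P T (X n j)"
    and "\<And>n. \<Xi> n = Xi_mat P T (X n) (p n)"
  \<comment> \<open>Conditions 1--3\<close>
    and "\<gamma>\<^sub>\<theta> > 0" and "L\<^sub>\<theta> > 0" and "r\<^sub>\<theta> \<le> m - 1" and "s\<^sub>\<theta> = real r\<^sub>\<theta> + \<gamma>\<^sub>\<theta>"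
    and "\<And>n j. n \<ge> 1 \<Longrightarrow> j < p n \<Longrightarrow> holder_deriv r\<^sub>\<theta> \<gamma>\<^sub>\<theta> L\<^sub>\<theta> (\<theta> n j)"
    and "\<And>n j. n \<ge> 1 \<Longrightarrow> j < p n \<Longrightarrow> AE \<omega> in P. cond_mean P T (\<lambda>\<omega>. (e n j \<omega>) ^ 4) \<omega> \<le> \<sigma>\<^sub>4"
    and "\<gamma>\<^sub>g > 0" and "L\<^sub>g > 0" and "r\<^sub>g \<le> m - 1" and "s\<^sub>g = real r\<^sub>g + \<gamma>\<^sub>g"
    and "holder_deriv r\<^sub>g \<gamma>\<^sub>g L\<^sub>g g"
  \<comment> \<open>compact supports\<close>
    and "compact K" and "\<And>n j. n \<ge> 1 \<Longrightarrow> j < p n \<Longrightarrow> rv_support P (e n j) \<subseteq> K"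
  \<comment> \<open>(A1)--(A5)\<close>
    and A1a: "(\<lambda>n. (real (p n))\<^sup>2 / real n) \<longlonglongrightarrow> 0"
    and A1b: "(\<lambda>n. (real (p n))\<^sup>2 * (real (M n))\<^sup>2 / (real n)\<^sup>2) \<longlonglongrightarrow> 0"
    and A1c: "(\<lambda>n. real (p n) / real (M n) powr s\<^sub>\<theta>) \<longlonglongrightarrow> 0"
    and A2: "liminf (\<lambda>n. ereal (min_eigenvalue (\<Xi> n))) = c_lam" "c_lam > 0"
    and A3: "lam \<in> o(\<lambda>n. real (k n) powr (-1/2))"
    and A4: "liminf (\<lambda>n. ereal (Min ((\<lambda>j. \<bar>\<beta> n j\<bar>) ` {..<k n}))) = c_beta" "c_beta > 0"
    and A5a: "(\<lambda>n. sqrt (real (p n) * max_eigenvalue (\<Xi> n)) / (sqrt (real n) * lam n)) \<longlonglongrightarrow> 0"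
    and A5b: "(\<lambda>n. sqrt (real (p n) * max_eigenvalue (\<Xi> n)) / (real (M n) powr s\<^sub>g * lam n)) \<longlonglongrightarrow> 0"
  shows "(\<lambda>n. measure (Q n) {\<omega> \<in> space (Q n). \<forall>j\<in>{k n..<p n}. \<beta>hat n j \<omega> = 0}) \<longlonglongrightarrow> 1"
proof -
  note P = assms(1) and kp = assms(2) and X = assms(3) and T = assms(4,5) and part = assms(18)
    and basis = assms(20) and lam_pos = assms(23) and lam0 = assms(24) and \<theta> = assms(27) and e_def = assms(28)
    and \<Xi>_def = assms(29) and \<theta>_holder = assms(34) and g_holder = assms(40)
  have p1: "1 \<le> p n" "1 \<le> k n" "k n \<le> p n" if "n \<ge> 1" for n using kp[OF that] by auto
  have ev1: "\<forall>\<^sub>F n in sequentially. n \<ge> 1" by (rule eventually_ge_at_top)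
  obtain R where R: "\<And>x. x \<in> K \<Longrightarrow> \<bar>x\<bar> \<le> R"
    using compact_imp_bounded[OF \<open>compact K\<close>] unfolding bounded_iff by auto
  have R_AE: "AE \<omega> in P. \<bar>cond_resid P T (X n j) \<omega>\<bar> \<le> R" if "n \<ge> 1" "j < p n" for n j
  proof -
    have "e n j \<in> borel_measurable P"
      unfolding e_def using cond_resid_integrable[OF P T(1) X[OF that]] by simp
    from AE_in_rv_support[OF P this] show ?thesis
      unfolding e_def[symmetric] by eventually_elim (use R assms(42)[OF that] in blast)
  qed
  \<comment> \<open>Constants strictly below the two lower limits: the eigenvalues and the nonzero
    coefficients stay above them eventually. The lower limits may be infinite, whereas
    \<open>c\<close> and \<open>b0\<close> are real.\<close>
  obtain c where c: "0 < c" "ereal c < c_lam" using ereal_dense2[OF A2(2)] by auto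
  obtain b0 where b0: "0 < b0" "ereal b0 < c_beta" using ereal_dense2[OF A4(2)] by auto
  have ev_c: "\<forall>\<^sub>F n in sequentially. c \<le> min_eigenvalue (\<Xi> n)"
    using less_LiminfD[OF c(2)[folded A2(1)]] by eventually_elim simp
  have ev_b0: "\<forall>\<^sub>F n in sequentially. \<forall>j<k n. b0 \<le> \<bar>\<beta> n j\<bar>"
    using less_LiminfD[OF b0(2)[folded A4(1)]]
  proof eventually_elim
    fix n assume b: "ereal b0 < ereal (Min ((\<lambda>j. \<bar>\<beta> n j\<bar>) ` {..<k n}))"
    show "\<forall>j<k n. b0 \<le> \<bar>\<beta> n j\<bar>"
    proof (intro allI impI)
      fix j assume "j < k n"
      then have "Min ((\<lambda>j. \<bar>\<beta> n j\<bar>) ` {..<k n}) \<le> \<bar>\<beta> n j\<bar>" by (intro Min_le) auto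
      with b show "b0 \<le> \<bar>\<beta> n j\<bar>" by simp
    qed
  qed
  have eig: "min_eigenvalue (\<Xi> n) \<le> max_eigenvalue (\<Xi> n)" if n: "n \<ge> 1" for n
  proof -
    have mat: "Xi_mat P T (X n) (p n) = Matrix.mat (p n) (p n)
        (\<lambda>(i, j). \<integral>\<omega>. cond_resid P T (X n i) \<omega> * cond_resid P T (X n j) \<omega> \<partial>P)"
      by (rule Xi_mat_entry[OF P T(1) X[OF n] R_AE[OF n]])
    show ?thesis unfolding \<Xi>_def mat
      by (rule min_eigenvalue_le_quad_form(2)) (use p1[OF n] in \<open>auto simp: mult.commute\<close>)
  qed
  define A where "A = sqrt (2 * R\<^sup>2 + 2)"
  define A' where "A' = (2 * R\<^sup>2 + 2) / sqrt (c / 8)"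
  have A: "A \<ge> 0" "A' \<ge> 0" unfolding A_def A'_def using c by auto
  \<comment> \<open>The first entry is what \<open>S2\<close> requires, as 16/128 = 1/8. The second
    keeps the left side of \<open>S3\<close> below 1/2; the summand 1 guards against a zero
    denominator.\<close>
  define \<eta> where "\<eta> = min (sqrt (c / 128)) (1 / (2 * (12 * A + 4 * A' + 1)))"
  have \<eta>: "\<eta> > 0" unfolding \<eta>_def using A c by auto
  have S2: "16 * \<eta>\<^sup>2 \<le> c / 8"
  proof -
    have "\<eta>\<^sup>2 \<le> (sqrt (c / 128))\<^sup>2" using \<eta> by (intro power_mono) (auto simp: \<eta>_def)
    then show ?thesis using c by simp
  qed
  have S3: "12 * \<eta> * sqrt (2 * R\<^sup>2 + 2) + 4 * \<eta> / sqrt (c / 8) * (2 * R\<^sup>2 + 2) < 1"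
  proof -
    have "\<eta> * (12 * A + 4 * A') \<le> 1 / (2 * (12 * A + 4 * A' + 1)) * (12 * A + 4 * A')"
      using A by (intro mult_right_mono) (auto simp: \<eta>_def)
    also have "\<dots> < 1" using A by (simp add: field_simps)
    finally show ?thesis unfolding A_def A'_def by (simp add: algebra_simps)
  qed
  obtain C where C: "C > 0" "\<forall>\<^sub>F n in sequentially. norm (mesh_size (M n) (\<xi> n)) \<le> C * norm (1 / real (M n))"
    using assms(19) by (rule landau_o.bigE)
  have ev_mesh: "\<forall>\<^sub>F n in sequentially. M n \<ge> 1 \<and> mesh_size (M n) (\<xi> n) \<le> C / real (M n)"
    using C(2) ev1
  proof eventually_elim
    fix n :: nat assume mesh: "norm (mesh_size (M n) (\<xi> n)) \<le> C * norm (1 / real (M n))" and n: "n \<ge> 1"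
    \<comment> \<open>Since \<open>1 / 0 = 0\<close>, the mesh bound would force a mesh of size 0 if
      there were no interior knot; as a mesh is positive, \<open>M n \<ge> 1\<close>
      follows.\<close>
    have "0 < mesh_size (M n) (\<xi> n)"
      using mesh_size_ge[of 0 "M n" "\<xi> n"] unit_partition_strict[OF part[OF n], of 0 1] by simp
    with mesh have "M n \<ge> 1" by (cases "M n") auto
    with mesh show "M n \<ge> 1 \<and> mesh_size (M n) (\<xi> n) \<le> C / real (M n)" by simp
  qed
  define C\<theta> where "C\<theta> = L\<^sub>\<theta> * (2 ^ m) ^ Suc r\<^sub>\<theta> * C powr s\<^sub>\<theta>"
  define Cg where "Cg = L\<^sub>g * (2 ^ m) ^ Suc r\<^sub>g * C powr s\<^sub>g"
  have C\<theta>: "C\<theta> > 0" unfolding C\<theta>_def using C(1) \<open>L\<^sub>\<theta> > 0\<close> by simp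
  have Cg: "Cg > 0" unfolding Cg_def using C(1) \<open>L\<^sub>g > 0\<close> by simp
  define x where "x n = real (p n) / real (M n) powr s\<^sub>\<theta>" for n
  define yg where "yg n = sqrt (real (p n) * max_eigenvalue (\<Xi> n)) / (real (M n) powr s\<^sub>g * lam n)" for n
  define ze where "ze n = sqrt (real (p n) * max_eigenvalue (\<Xi> n)) / (sqrt (real n) * lam n)" for n
  define v where "v n = lam n / real (k n) powr (-1/2)" for n
  define pm where "pm n = real (p n) * real (M n) / real n" for n
  define pp where "pp n = (real (p n))\<^sup>2 / real n" for n
  have x0: "x \<longlonglongrightarrow> 0" using A1c unfolding x_def .
  have yg0: "yg \<longlonglongrightarrow> 0" using A5b unfolding yg_def .
  have ze0: "ze \<longlonglongrightarrow> 0" using A5a unfolding ze_def .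
  have v0: "v \<longlonglongrightarrow> 0" using smalloD_tendsto[OF A3] unfolding v_def .
  have pp0: "pp \<longlonglongrightarrow> 0" using A1a unfolding pp_def .
  have pm0: "pm \<longlonglongrightarrow> 0"
  proof -
    have "(\<lambda>n. sqrt ((real (p n))\<^sup>2 * (real (M n))\<^sup>2 / (real n)\<^sup>2)) \<longlonglongrightarrow> sqrt 0"
      by (intro tendsto_real_sqrt A1b)
    then show ?thesis unfolding pm_def by (simp add: real_sqrt_mult real_sqrt_divide)
  qed
  have x_lim: "(\<lambda>n. C\<theta> * x n) \<longlonglongrightarrow> C\<theta> * 0" "(\<lambda>n. C\<theta>\<^sup>2 * (x n)\<^sup>2) \<longlonglongrightarrow> C\<theta>\<^sup>2 * 0\<^sup>2"
    by (intro tendsto_intros x0)+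
  have ev_x: "\<forall>\<^sub>F n in sequentially. C\<theta> * x n < 1" "\<forall>\<^sub>F n in sequentially. C\<theta>\<^sup>2 * (x n)\<^sup>2 < c / 8"
    by (rule order_tendstoD(2)[OF x_lim(1)], simp) (rule order_tendstoD(2)[OF x_lim(2)], use c in simp)
  \<comment> \<open>The threshold is the one that turns a lower bound \<open>c\<close> on
    \<open>p\<close> times the largest eigenvalue into a bias of \<open>g\<close> of at most
    \<open>\<eta> * lam n\<close>.\<close>
  have ev_y: "\<forall>\<^sub>F n in sequentially. yg n < \<eta> * sqrt c / Cg"
    using yg0 \<eta> c Cg by (intro order_tendstoD(2)) auto
  have ev_lam: "\<forall>\<^sub>F n in sequentially. a * lam n < b0"
  proof -
    have "(\<lambda>n. a * lam n) \<longlonglongrightarrow> a * 0" by (intro tendsto_intros lam0)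
    then show ?thesis by (rule order_tendstoD(2)) (use b0 in simp)
  qed
  \<comment> \<open>\<open>(v n)\<^sup>2\<close> equals \<open>k n * (lam n)\<^sup>2\<close>, so the
    difference tends to \<open>c / 8 * b0\<^sup>2\<close>, which is positive.\<close>
  have ev_S1: "\<forall>\<^sub>F n in sequentially. 0 < c / 8 * (b0 - a * lam n)\<^sup>2 - (16 * \<eta>\<^sup>2 * (lam n)\<^sup>2 + (a + 1) * (v n)\<^sup>2)"
  proof -
    have "(\<lambda>n. c / 8 * (b0 - a * lam n)\<^sup>2 - (16 * \<eta>\<^sup>2 * (lam n)\<^sup>2 + (a + 1) * (v n)\<^sup>2))
        \<longlonglongrightarrow> c / 8 * (b0 - a * 0)\<^sup>2 - (16 * \<eta>\<^sup>2 * 0\<^sup>2 + (a + 1) * 0\<^sup>2)"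
      by (intro tendsto_intros lam0 v0)
    then show ?thesis by (rule order_tendstoD(1)) (use b0 c in simp)
  qed
  define G where "G n = measure (Q n) {\<omega> \<in> space (Q n). \<forall>j\<in>{k n..<p n}. \<beta>hat n j \<omega> = 0}" for n
  \<comment> \<open>A majorant of the failure probability in terms of the null sequences: the
    dimension \<open>q = M n + m\<close> splits into the terms with \<open>pm\<close> and
    \<open>m\<close>, and \<open>(ze n)\<^sup>2 / c\<close> dominates
    \<open>p / (n * lam\<^sup>2)\<close>.\<close>
  define r where "r n = R\<^sup>2 / (c / 4) * pm n + real m * R\<^sup>2 / (c / 4) * pp n + R ^ 4 / (c / 4)\<^sup>2 * pp n
      + \<sigma>\<^sup>2 / (\<eta>\<^sup>2 * c) * (ze n)\<^sup>2" for n
  have "r \<longlonglongrightarrow> R\<^sup>2 / (c / 4) * 0 + real m * R\<^sup>2 / (c / 4) * 0 + R ^ 4 / (c / 4)\<^sup>2 * 0 + \<sigma>\<^sup>2 / (\<eta>\<^sup>2 * c) * 0\<^sup>2"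
    unfolding r_def by (intro tendsto_intros pm0 pp0 ze0)
  then have "(\<lambda>n. 1 - r n) \<longlonglongrightarrow> 1 - 0" by (intro tendsto_intros) simp
  then have r0: "(\<lambda>n. 1 - r n) \<longlonglongrightarrow> 1" by simp
  have lower: "\<forall>\<^sub>F n in sequentially. 1 - r n \<le> G n"
    using ev1 ev_c ev_b0 ev_mesh ev_x ev_y ev_lam ev_S1
  proof eventually_elim
    fix n :: nat
    assume n: "n \<ge> 1" and c_n: "c \<le> min_eigenvalue (\<Xi> n)" and b0_n: "\<forall>j<k n. b0 \<le> \<bar>\<beta> n j\<bar>"
      and mesh: "M n \<ge> 1 \<and> mesh_size (M n) (\<xi> n) \<le> C / real (M n)"
      and x_n: "C\<theta> * x n < 1" "C\<theta>\<^sup>2 * (x n)\<^sup>2 < c / 8" and y_n: "yg n < \<eta> * sqrt c / Cg"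
      and lam_n: "a * lam n < b0"
      and S1_n: "0 < c / 8 * (b0 - a * lam n)\<^sup>2 - (16 * \<eta>\<^sup>2 * (lam n)\<^sup>2 + (a + 1) * (v n)\<^sup>2)"
    have M: "real (M n) > 0" "mesh_size (M n) (\<xi> n) \<le> C / real (M n)" using mesh by auto
    have lam: "lam n > 0" by (rule lam_pos[OF n])
    have p_pos: "real (p n) \<ge> 1" using p1[OF n] by simp
    define d where "d = C\<theta> / real (M n) powr s\<^sub>\<theta>"
    have d0: "0 \<le> d" unfolding d_def using C\<theta> by simp
    have d_x: "d \<le> C\<theta> * x n" unfolding d_def x_def using C\<theta> p_pos M by (simp add: field_simps)
    have d1: "d \<le> 1" using d_x x_n(1) by linarith
    have pd: "real (p n) * d\<^sup>2 \<le> c / 8"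
    proof -
      \<comment> \<open>The extra factor \<open>p n \<ge> 1\<close> completes the square of
        \<open>x n\<close>, the sequence controlled by \<open>A1c\<close>.\<close>
      have "real (p n) * d\<^sup>2 \<le> (real (p n))\<^sup>2 * d\<^sup>2"
        using p_pos by (intro mult_right_mono) (auto simp: power2_eq_square)
      also have "\<dots> = C\<theta>\<^sup>2 * (x n)\<^sup>2" unfolding d_def x_def by (simp add: power_mult_distrib power_divide)
      finally show ?thesis using x_n(2) by linarith
    qed
    have max_c: "c \<le> max_eigenvalue (\<Xi> n)" using c_n eig[OF n] by linarith
    \<comment> \<open>The lower bound on the smallest eigenvalue is passed to the largest one, which
      allows it to be removed from the numerators in \<open>A5a\<close> and
      \<open>A5b\<close>.\<close>
    have pmax: "c \<le> real (p n) * max_eigenvalue (\<Xi> n)"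
      using mult_mono[OF p_pos max_c] c by simp
    have g_small: "Cg / real (M n) powr s\<^sub>g \<le> \<eta> * lam n"
    proof -
      have "sqrt c / (real (M n) powr s\<^sub>g * lam n) \<le> yg n"
        unfolding yg_def using pmax M lam by (intro divide_right_mono real_sqrt_le_mono) auto
      then have "sqrt c / (real (M n) powr s\<^sub>g * lam n) < \<eta> * sqrt c / Cg" using y_n by linarith
      then have "sqrt c * (1 / (real (M n) powr s\<^sub>g * lam n)) < sqrt c * (\<eta> / Cg)" by (simp add: mult.commute)
      then have "1 / (real (M n) powr s\<^sub>g * lam n) < \<eta> / Cg"
        by (rule mult_left_less_imp_less) (use c in simp)
      then show ?thesis using M lam Cg by (simp add: field_simps)
    qed
    have S1: "16 * \<eta>\<^sup>2 * (lam n)\<^sup>2 + (a + 1) * real (k n) * (lam n)\<^sup>2 < c / 8 * (b0 - a * lam n)\<^sup>2"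
    proof -
      have k_pos: "real (k n) > 0" using p1[OF n] by simp
      have "(real (k n) powr (-1/2))\<^sup>2 = real (k n) powr (-1)"
        using k_pos powr_add[of "real (k n)" "-1/2" "-1/2"] by (simp add: power2_eq_square)
      then have "(v n)\<^sup>2 = real (k n) * (lam n)\<^sup>2"
        unfolding v_def using k_pos by (simp add: power_divide powr_minus field_simps)
      then show ?thesis using S1_n by (simp add: mult.assoc)
    qed
    have mesh_powr: "(C / real (M n)) powr s = C powr s / real (M n) powr s" for s
      using C(1) M by (simp add: powr_divide)
    have \<theta>_approx: "\<exists>s\<in>spline_space m (M n) (\<xi> n). \<forall>t\<in>{0..1}. \<bar>\<theta> n j t - s t\<bar> \<le> d" if "j < p n" for j
      using spline_approx_holder[OF part[OF n] M(2) \<open>\<gamma>\<^sub>\<theta> > 0\<close> \<open>L\<^sub>\<theta> > 0\<close> \<theta>_holder[OF n that]] \<open>r\<^sub>\<theta> \<le> m - 1\<close> \<open>m \<ge> 1\<close>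
      unfolding \<open>s\<^sub>\<theta> = real r\<^sub>\<theta> + \<gamma>\<^sub>\<theta>\<close>[symmetric] mesh_powr d_def C\<theta>_def by (simp add: mult.assoc)
    have g_approx: "\<exists>s\<in>spline_space m (M n) (\<xi> n). \<forall>t\<in>{0..1}. \<bar>g t - s t\<bar> \<le> \<eta> * lam n"
    proof -
      have "\<exists>s\<in>spline_space m (M n) (\<xi> n). \<forall>t\<in>{0..1}. \<bar>g t - s t\<bar> \<le> Cg / real (M n) powr s\<^sub>g"
        using spline_approx_holder[OF part[OF n] M(2) \<open>\<gamma>\<^sub>g > 0\<close> \<open>L\<^sub>g > 0\<close> g_holder] \<open>r\<^sub>g \<le> m - 1\<close> \<open>m \<ge> 1\<close>
        unfolding \<open>s\<^sub>g = real r\<^sub>g + \<gamma>\<^sub>g\<close>[symmetric] mesh_powr Cg_def by (simp add: mult.assoc)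
      then show ?thesis using g_small by (meson order_trans)
    qed
    let ?b = "real ((M n + m) * p n) * R\<^sup>2 / (real n * (c / 4)) + real (p n * p n) * (R ^ 4 / real n) / (c / 4)\<^sup>2
      + real (p n) * \<sigma>\<^sup>2 / (real n * (\<eta> * lam n)\<^sup>2)"
    have "1 - ?b \<le> G n"
      unfolding G_def
      by (rule estimator_zero_finite_sample[where X = "X n" and Y = "Y n" and Xs = "Xs n" and Ts = "Ts n" and Ys = "Ys n"
          and n = n and p = "p n" and k = "k n" and M = "M n" and m = m and a = a and lam = "lam n" and c = c and d = d
          and \<eta> = \<eta> and R = R and \<sigma> = \<sigma> and ?b0.0 = b0 and \<beta> = "\<beta> n" and \<theta> = "\<theta> n" and B = "B n"
          and bh = "\<beta>hat n" and ch = "\<alpha>hat n" and P = P and Q = "Q n" and T = T and \<epsilon> = \<epsilon> and g = g and \<xi> = "\<xi> n",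
          OF P n p1(1,3)[OF n] X[OF n] T assms(6)[OF n] assms(7-10) assms(11) assms(13)[OF n] b0_n[rule_format] assms(14-16)[OF n]
          part[OF n] basis[OF n] assms(22) lam assms(25,26)[OF n] \<theta>[OF n]
          holder_deriv_continuous[OF \<theta>_holder[OF n] \<open>\<gamma>\<^sub>\<theta> > 0\<close>] holder_deriv_continuous[OF g_holder \<open>\<gamma>\<^sub>g > 0\<close>]
          \<theta>_approx g_approx R_AE[OF n] c(1) c_n[unfolded \<Xi>_def] \<eta> d0 d1 pd lam_n S1 S2 S3])
    moreover have "?b \<le> r n"
    proof -
      have n_pos: "real n > 0" using n by simp
      have "real ((M n + m) * p n) * R\<^sup>2 / (real n * (c / 4)) = R\<^sup>2 / (c / 4) * pm n + real m * R\<^sup>2 / (c / 4) * (real (p n) / real n)"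
        unfolding pm_def using n_pos c by (simp add: field_simps)
      moreover have "real (p n) / real n \<le> pp n"
        unfolding pp_def using p_pos n_pos by (intro divide_right_mono) (auto simp: power2_eq_square)
      then have "real m * R\<^sup>2 / (c / 4) * (real (p n) / real n) \<le> real m * R\<^sup>2 / (c / 4) * pp n"
        using c by (intro mult_left_mono) auto
      ultimately have 1: "real ((M n + m) * p n) * R\<^sup>2 / (real n * (c / 4)) \<le> R\<^sup>2 / (c / 4) * pm n + real m * R\<^sup>2 / (c / 4) * pp n"
        by linarith
      have 2: "real (p n * p n) * (R ^ 4 / real n) / (c / 4)\<^sup>2 = R ^ 4 / (c / 4)\<^sup>2 * pp n"
        unfolding pp_def by (simp add: power2_eq_square mult_ac)
      have "real (p n) * c / (real n * (lam n)\<^sup>2) \<le> real (p n) * max_eigenvalue (\<Xi> n) / (real n * (lam n)\<^sup>2)"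
        using max_c lam n_pos by (intro divide_right_mono mult_left_mono) auto
      also have "\<dots> = (ze n)\<^sup>2"
        unfolding ze_def using pmax c by (simp add: power_divide power_mult_distrib)
      finally have "\<sigma>\<^sup>2 / (\<eta>\<^sup>2 * c) * (real (p n) * c / (real n * (lam n)\<^sup>2)) \<le> \<sigma>\<^sup>2 / (\<eta>\<^sup>2 * c) * (ze n)\<^sup>2"
        using c by (intro mult_left_mono) auto
      moreover have "\<sigma>\<^sup>2 / (\<eta>\<^sup>2 * c) * (real (p n) * c / (real n * (lam n)\<^sup>2)) = real (p n) * \<sigma>\<^sup>2 / (real n * (\<eta> * lam n)\<^sup>2)"
        using c by (simp add: power_mult_distrib field_simps)
      ultimately show ?thesis using 1 2 unfolding r_def by linarith
    qed
    ultimately show "1 - r n \<le> G n" by linarith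
  qed
  have upper: "\<forall>\<^sub>F n in sequentially. G n \<le> 1"
    using ev1 by eventually_elim (auto simp: G_def intro!: prob_space.prob_le_1 assms(14))
  have "G \<longlonglongrightarrow> 1" by (rule real_tendsto_sandwich[OF lower upper r0 tendsto_const])
  then show ?thesis unfolding G_def .
qed

end
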